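(* Let $n$ be a positive integer, $\mathbf{g}=(g_0,\dots,g_{n-1})$ with $g_k\in H(\mathbb{D})$ for $0\leq k\leq n-1$, and $0<p\leq q<\infty$. Then (a) $I_{\mathbf{g}}^{(n)}:A^p\to A^q$ is bounded if and only if, for every $0\le k\le n-1$: $g_k\in\mathcal{B}^{0,\,n-k-\frac2p+\frac2q}$ when $n-k\geq\frac2p-\frac2q$, and $g_k\equiv0$ when $n-k<\frac2p-\frac2q$; (b) $I_{\mathbf{g}}^{(n)}:A^p\to A^q$ is compact if and only if, for every $0\le k\le n-1$: $g_k\in\mathcal{B}_0^{0,\,n-k-\frac2p+\frac2q}$ when $n-k>\frac2p-\frac2q$, and $g_k\equiv0$ when $n-k\leq\frac2p-\frac2q$.
   Context: $\mathbb{D}$ is the open unit disc, $H(\mathbb{D})$ the analytic functions on $\mathbb{D}$, $dA=\frac{dx\,dy}{\pi}$, and $A^p=\{f\in H(\mathbb{D}):\int_{\mathbb{D}}|f|^p\,dA<\infty\}$ is the Bergman space. $I$ is the integration operator $(If)(z)=\int_0^zf(w)\,dw$ and $I^n$ its $n$-th iterate; $I_{\mathbf{g}}^{(n)}f=I^n\big(fg_0+f'g_1+\cdots+f^{(n-1)}g_{n-1}\big)$. For an integer $m\geq0$ and real $\alpha\geq0$, $\mathcal{B}^{m,\alpha}=\{f\in H(\mathbb{D}):\sup_{z\in\mathbb{D}}|f^{(m)}(z)|(1-|z|^2)^\alpha<\infty\}$ and $\mathcal{B}_0^{m,\alpha}=\{f\in H(\mathbb{D}):\lim_{|z|\to1^-}|f^{(m)}(z)|(1-|z|^2)^\alpha=0\}$.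 *)

theory Defs
  imports "HOL-Complex_Analysis.Complex_Analysis"
begin

abbreviation disc :: "complex set" where "disc \<equiv> ball 0 1"

definition bergman_int :: "real \<Rightarrow> (complex \<Rightarrow> complex) \<Rightarrow> ennreal" where
  "bergman_int p f =
     (\<integral>\<^sup>+ z. indicator disc z * ennreal (cmod (f z) powr p) \<partial>lborel) / ennreal pi"

definition bergman :: "real \<Rightarrow> (complex \<Rightarrow> complex) set" where
  "bergman p = {f. f holomorphic_on disc \<and> bergman_int p f < \<infinity>}"

definition bergman_norm :: "real \<Rightarrow> (complex \<Rightarrow> complex) \<Rightarrow> real" where
  "bergman_norm p f = enn2real (bergman_int p f) powr (1 / p)"

definition integ_op :: "(complex \<Rightarrow> complex) \<Rightarrow> complex \<Rightarrow> complex" where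
  "integ_op f z = contour_integral (linepath 0 z) f"

definition Ig :: "nat \<Rightarrow> (nat \<Rightarrow> complex \<Rightarrow> complex) \<Rightarrow> (complex \<Rightarrow> complex) \<Rightarrow> complex \<Rightarrow> complex" where
  "Ig n g f = (integ_op ^^ n) (\<lambda>z. \<Sum>k<n. (deriv ^^ k) f z * g k z)"

definition bounded_operator :: "real \<Rightarrow> real \<Rightarrow> ((complex \<Rightarrow> complex) \<Rightarrow> complex \<Rightarrow> complex) \<Rightarrow> bool" where
  "bounded_operator p q T \<longleftrightarrow> (\<forall>f\<in>bergman p. T f \<in> bergman q) \<and>
     (\<exists>C. \<forall>f\<in>bergman p. bergman_norm q (T f) \<le> C * bergman_norm p f)"

text \<open>Compact operator \<open>A^p \<rightarrow> A^q\<close>: maps into \<open>A^q\<close> and the image of the unit ball is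
  relatively compact, i.e. every sequence in the unit ball of \<open>A^p\<close> has a subsequence whose
  image converges in \<open>A^q\<close>.\<close>
definition compact_operator :: "real \<Rightarrow> real \<Rightarrow> ((complex \<Rightarrow> complex) \<Rightarrow> complex \<Rightarrow> complex) \<Rightarrow> bool" where
  "compact_operator p q T \<longleftrightarrow> (\<forall>f\<in>bergman p. T f \<in> bergman q) \<and>
     (\<forall>fs :: nat \<Rightarrow> complex \<Rightarrow> complex. (\<forall>j. fs j \<in> bergman p \<and> bergman_norm p (fs j) \<le> 1) \<longrightarrow>
        (\<exists>(r :: nat \<Rightarrow> nat) h. strict_mono r \<and> h \<in> bergman q \<and>
           (\<lambda>j. bergman_norm q (\<lambda>z. T (fs (r j)) z - h z)) \<longlonglongrightarrow> 0))"

definition bloch :: "nat \<Rightarrow> real \<Rightarrow> (complex \<Rightarrow> complex) set" where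
  "bloch m \<alpha> = {f. f holomorphic_on disc \<and>
     (\<exists>C. \<forall>z\<in>disc. cmod ((deriv ^^ m) f z) * (1 - (cmod z)\<^sup>2) powr \<alpha> \<le> C)}"

definition little_bloch :: "nat \<Rightarrow> real \<Rightarrow> (complex \<Rightarrow> complex) set" where
  "little_bloch m \<alpha> = {f. f holomorphic_on disc \<and>
     (\<forall>\<epsilon>>0. \<exists>r<1. \<forall>z. r < cmod z \<and> cmod z < 1 \<longrightarrow>
        cmod ((deriv ^^ m) f z) * (1 - (cmod z)\<^sup>2) powr \<alpha> < \<epsilon>)}"

end

theory Submission
  imports Defs
begin

text \<open>
  Put \<open>F = f g\<^sub>0 + f' g\<^sub>1 + \<dots>\<close>, the \<open>n\<close>-th derivative of \<open>Ig n g f\<close>. Hardy--Littlewood: the \<open>A\<^sup>q\<close> norm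
  of \<open>Ig n g f\<close> is dominated by the \<open>L\<^sup>q\<close> norm of \<open>F (1 - |z|)\<^sup>n\<close>. Together with the pointwise bound
  \<open>|f\<^sup>(\<^sup>k\<^sup>)(z)| (1 - |z|)\<^bsup>k + 2/p\<^esup> \<le> C \<parallel>f\<parallel>\<^sub>p\<close> this gives sufficiency; for compactness one adds Montel's theorem
  and a splitting of the disc. For necessity only the pointwise bound for \<open>F\<close> is needed: testing it on
  functions with a zero of order \<open>k\<close> at \<open>a\<close> that peak near \<open>a\<close> yields the growth of \<open>g\<^sub>k\<close>, by
  downward induction on \<open>k\<close>. For exponents below \<open>1\<close> the sub-mean value property is obtained from the case
  \<open>1\<close> by an absorption argument, and the Hardy--Littlewood inequality is reduced to exponents
  at most \<open>1\<close> by passing to \<open>F ^ N\<close>.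
\<close>

section \<open>Lebesgue measure on the complex plane\<close>


text \<open>The exponents record growth. At a given point the derivative of order \<open>k\<close>
  of a function in the unit ball of \<open>A^p\<close> can be as large as a multiple of
  \<open>(1 - |z|)^(-(k + 2/p))\<close>, while the \<open>n\<close>-th derivative of a function in
  \<open>A^q\<close> is at most a multiple of \<open>(1 - |z|)^(-(n + 2/q))\<close>;
  \<open>symbol_exp\<close> is the difference of the two exponents. Both parts thus become one
  statement about \<open>|g_k| (1 - |z|)^symbol_exp\<close>, bounded for (a) and tending to 0 at the
  circle for (b). The case distinctions come only from the maximum principle when that exponent is
  negative or zero. The hypothesis \<open>p \<le> q\<close> enters sufficiency through one
  interpolation: of the \<open>q\<close> powers of \<open>|f^(k)|\<close>, \<open>q - p\<close> are
  spent on the pointwise bound and \<open>p\<close> on an integral. Exponents below 1 shape the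
  rest: Minkowski's inequality fails there, so everything is deduced from local means over discs of
  size comparable to \<open>1 - |z|\<close> and from Tonelli. The means themselves rest on the
  rotation invariance of planar Lebesgue measure instead of polar coordinates.\<close>

lemma lborel_complex_eq_distr:
  "(lborel :: complex measure) = distr (lborel \<Otimes>\<^sub>M lborel) borel (\<lambda>(x, y). Complex x y)"
proof (rule lborel_eqI)
  have meas [measurable]: "(\<lambda>(x, y). Complex x y) \<in> borel_measurable (lborel \<Otimes>\<^sub>M lborel)"
  proof -
    have "(\<lambda>z::real\<times>real. Complex (fst z) (snd z)) \<in> borel_measurable borel"
      by (intro borel_measurable_continuous_onI continuous_intros)
    then show ?thesis
      by (simp add: case_prod_unfold lborel_prod)
  qed
  fix l u :: complex
  assume le: "\<And>b. b \<in> Basis \<Longrightarrow> l \<bullet> b \<le> u \<bullet> b"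
  have le': "Re l \<le> Re u" "Im l \<le> Im u"
    using le[of 1] le[of \<i>] by (auto simp: Basis_complex_def)
  have "(\<lambda>(x, y). Complex x y) -` box l u \<inter> space (lborel \<Otimes>\<^sub>M lborel)
      = {Re l<..<Re u} \<times> {Im l<..<Im u}"
    by (auto simp: in_box_complex_iff space_pair_measure)
  then have "emeasure (distr (lborel \<Otimes>\<^sub>M lborel) borel (\<lambda>(x, y). Complex x y)) (box l u)
      = emeasure (lborel \<Otimes>\<^sub>M lborel) ({Re l<..<Re u} \<times> {Im l<..<Im u})"
    by (subst emeasure_distr) auto
  also have "\<dots> = ennreal ((Re u - Re l) * (Im u - Im l))"
    using le' by (subst lborel.emeasure_pair_measure_Times) (auto simp: ennreal_mult)
  also have "\<dots> = ennreal (\<Prod>b\<in>Basis. (u - l) \<bullet> b)"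
    by (simp add: Basis_complex_def)
  finally show "emeasure (distr (lborel \<Otimes>\<^sub>M lborel) borel (\<lambda>(x, y). Complex x y)) (box l u)
      = (\<Prod>b\<in>Basis. (u - l) \<bullet> b)" .
qed auto

lemma borel_measurable_Complex [measurable]:
  assumes "f \<in> borel_measurable M" "g \<in> borel_measurable M"
  shows "(\<lambda>x. Complex (f x) (g x)) \<in> borel_measurable M"
  using assms by (simp add: Complex_eq)

text \<open>Both orders are kept because a horizontal shear is a translation of the inner variable
  when \<open>x\<close> is integrated first, and a vertical shear when \<open>y\<close> is.\<close>

lemma nn_integral_complex_iterated:
  assumes [measurable]: "f \<in> borel_measurable borel"
  shows "(\<integral>\<^sup>+z. f z \<partial>lborel) = (\<integral>\<^sup>+x. \<integral>\<^sup>+y. f (Complex x y) \<partial>lborel \<partial>lborel)"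
    and "(\<integral>\<^sup>+z. f z \<partial>lborel) = (\<integral>\<^sup>+y. \<integral>\<^sup>+x. f (Complex x y) \<partial>lborel \<partial>lborel)"
proof -
  have "(\<integral>\<^sup>+z. f z \<partial>lborel) = (\<integral>\<^sup>+p. f (case p of (x, y) \<Rightarrow> Complex x y) \<partial>(lborel \<Otimes>\<^sub>M lborel))"
    by (subst lborel_complex_eq_distr, subst nn_integral_distr) (auto simp: case_prod_unfold)
  also have "\<dots> = (\<integral>\<^sup>+p. f (Complex (fst p) (snd p)) \<partial>(lborel \<Otimes>\<^sub>M lborel))"
    by (simp add: case_prod_unfold)
  finally have *: "(\<integral>\<^sup>+z. f z \<partial>lborel) = (\<integral>\<^sup>+p. f (Complex (fst p) (snd p)) \<partial>(lborel \<Otimes>\<^sub>M lborel))" .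
  show "(\<integral>\<^sup>+z. f z \<partial>lborel) = (\<integral>\<^sup>+x. \<integral>\<^sup>+y. f (Complex x y) \<partial>lborel \<partial>lborel)"
    unfolding * by (subst lborel.nn_integral_fst[symmetric]) auto
  show "(\<integral>\<^sup>+z. f z \<partial>lborel) = (\<integral>\<^sup>+y. \<integral>\<^sup>+x. f (Complex x y) \<partial>lborel \<partial>lborel)"
    unfolding * by (subst lborel_pair.nn_integral_snd[symmetric]) (auto simp: case_prod_unfold)
qed

lemma nn_integral_real_translate:
  fixes f :: "real \<Rightarrow> ennreal"
  assumes [measurable]: "f \<in> borel_measurable borel"
  shows "(\<integral>\<^sup>+x. f (x + t) \<partial>lborel) = (\<integral>\<^sup>+x. f x \<partial>lborel)"
  using nn_integral_real_affine[of f 1 t] by (simp add: add.commute)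

text \<open>On each line in the direction of the shear the map is a translation, by an amount that
  depends only on the other coordinate.\<close>

lemma nn_integral_complex_shear:
  fixes f :: "complex \<Rightarrow> ennreal" and k :: real
  assumes [measurable]: "f \<in> borel_measurable borel"
  shows "(\<integral>\<^sup>+z. f (Complex (Re z + k * Im z) (Im z)) \<partial>lborel) = (\<integral>\<^sup>+z. f z \<partial>lborel)"
    and "(\<integral>\<^sup>+z. f (Complex (Re z) (Im z + k * Re z)) \<partial>lborel) = (\<integral>\<^sup>+z. f z \<partial>lborel)"
proof -
  have "(\<integral>\<^sup>+z. f (Complex (Re z + k * Im z) (Im z)) \<partial>lborel)
      = (\<integral>\<^sup>+y. \<integral>\<^sup>+x. f (Complex (x + k * y) y) \<partial>lborel \<partial>lborel)"
    by (subst nn_integral_complex_iterated(2)) auto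
  also have "\<dots> = (\<integral>\<^sup>+y. \<integral>\<^sup>+x. f (Complex x y) \<partial>lborel \<partial>lborel)"
    using nn_integral_real_translate[of "\<lambda>x. f (Complex x y)" "k * y" for y] by simp
  also have "\<dots> = (\<integral>\<^sup>+z. f z \<partial>lborel)"
    by (rule nn_integral_complex_iterated(2)[symmetric]) auto
  finally show "(\<integral>\<^sup>+z. f (Complex (Re z + k * Im z) (Im z)) \<partial>lborel) = (\<integral>\<^sup>+z. f z \<partial>lborel)" .
  have "(\<integral>\<^sup>+z. f (Complex (Re z) (Im z + k * Re z)) \<partial>lborel)
      = (\<integral>\<^sup>+x. \<integral>\<^sup>+y. f (Complex x (y + k * x)) \<partial>lborel \<partial>lborel)"
    by (subst nn_integral_complex_iterated(1)) auto
  also have "\<dots> = (\<integral>\<^sup>+x. \<integral>\<^sup>+y. f (Complex x y) \<partial>lborel \<partial>lborel)"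
    using nn_integral_real_translate[of "\<lambda>y. f (Complex x y)" "k * x" for x] by simp
  also have "\<dots> = (\<integral>\<^sup>+z. f z \<partial>lborel)"
    by (rule nn_integral_complex_iterated(1)[symmetric]) auto
  finally show "(\<integral>\<^sup>+z. f (Complex (Re z) (Im z + k * Re z)) \<partial>lborel) = (\<integral>\<^sup>+z. f z \<partial>lborel)" .
qed

text \<open>A rotation by an angle that is not a multiple of \<open>\<pi>\<close> is a product of three shears; the
  remaining rotation \<open>-1\<close> is the square of \<open>\<i>\<close>.\<close>

lemma nn_integral_complex_rotate:
  fixes f :: "complex \<Rightarrow> ennreal"
  assumes f [measurable]: "f \<in> borel_measurable borel" and c: "cmod c = 1"
  shows "(\<integral>\<^sup>+z. f (c * z) \<partial>lborel) = (\<integral>\<^sup>+z. f z \<partial>lborel)"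
proof -
  have rot: "(\<integral>\<^sup>+z. f (d * z) \<partial>lborel) = (\<integral>\<^sup>+z. f z \<partial>lborel)"
    if [measurable]: "f \<in> borel_measurable borel" and d: "cmod d = 1" "Im d \<noteq> 0" for d and f :: "complex \<Rightarrow> ennreal"
  proof -
    \<comment> \<open>For \<open>d = cis \<theta>\<close> the slope \<open>k\<close> is
      \<open>- tan (\<theta> / 2)\<close>; the rotation is the horizontal shear by \<open>k\<close>,
      then the vertical one by \<open>sin \<theta>\<close>, then the horizontal one by
      \<open>k\<close> again.\<close>
    define a b k where "a = Re d" and "b = Im d" and "k = (a - 1) / b"
    have ab: "a\<^sup>2 + b\<^sup>2 = 1" "b \<noteq> 0"
      using d cmod_power2[of d] by (auto simp: a_def b_def)
    have kb: "k * b = a - 1" using ab by (simp add: k_def)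
    have "b * (k + k * a) = (k * b) * (1 + a)"
      by (simp add: algebra_simps)
    also have "\<dots> = b * (- b)"
      using ab unfolding kb by (simp add: algebra_simps power2_eq_square)
    finally have "b * (k + k * a) = b * (- b)" .
    then have ka: "k + k * a = - b" using ab(2) by (metis mult_left_cancel)
    define g where "g z = Complex (Re z + k * Im z) (Im z)" for z
    define h where "h z = Complex (Re z) (Im z + b * Re z)" for z
    have gh [measurable]: "g \<in> borel_measurable borel" "h \<in> borel_measurable borel"
      by (auto simp: g_def[abs_def] h_def[abs_def])
    have eq: "g (h (g z)) = d * z" for z
    proof (rule complex_eqI)
      have "Im (g (h (g z))) = Im z + b * Re z + (k * b) * Im z"
        by (simp add: g_def h_def algebra_simps)
      then show im: "Im (g (h (g z))) = Im (d * z)"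
        unfolding kb by (simp add: a_def b_def algebra_simps)
      have "Re (g (h (g z))) = Re z + k * Im z + k * (Im (d * z))"
        using im by (simp add: g_def h_def)
      also have "\<dots> = Re z + (k * b) * Re z + (k + k * a) * Im z"
        by (simp add: a_def b_def algebra_simps)
      finally show "Re (g (h (g z))) = Re (d * z)"
        unfolding kb ka by (simp add: a_def b_def algebra_simps)
    qed
    have "(\<integral>\<^sup>+z. f (d * z) \<partial>lborel) = (\<integral>\<^sup>+z. (\<lambda>z. f (g (h z))) (g z) \<partial>lborel)"
      by (simp add: eq)
    also have "\<dots> = (\<integral>\<^sup>+z. (\<lambda>z. f (g z)) (h z) \<partial>lborel)"
      unfolding g_def[of "_ :: complex"] by (subst nn_integral_complex_shear(1)) (auto simp flip: g_def)
    also have "\<dots> = (\<integral>\<^sup>+z. f (g z) \<partial>lborel)"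
      unfolding h_def[of "_ :: complex"] by (subst nn_integral_complex_shear(2)) (auto simp flip: h_def)
    also have "\<dots> = (\<integral>\<^sup>+z. f z \<partial>lborel)"
      unfolding g_def by (subst nn_integral_complex_shear(1)) auto
    finally show ?thesis .
  qed
  show ?thesis
  proof (cases "Im c = 0")
    case False
    then show ?thesis using rot f c by blast
  next
    case True
    then have "cmod (c / \<i>) = 1" "Im (c / \<i>) \<noteq> 0"
      using c by (auto simp: norm_divide cmod_def)
    from rot[OF _ this, of "\<lambda>z. f (\<i> * z)"] show ?thesis
      using rot[OF f, of \<i>] by (simp flip: mult.assoc)
  qed
qed

lemma nn_integral_complex_scale:
  fixes f :: "complex \<Rightarrow> ennreal"
  assumes [measurable]: "f \<in> borel_measurable borel" and r: "0 < r"
  shows "ennreal (r\<^sup>2) * (\<integral>\<^sup>+z. f (of_real r * z) \<partial>lborel) = (\<integral>\<^sup>+z. f z \<partial>lborel)"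
proof -
  have eq: "(\<Sum>j\<in>Basis. (r * (x \<bullet> j)) *\<^sub>R j) = of_real r * x" for x :: complex
    by (simp add: Basis_complex_def complex_eq_iff)
  have "(lborel :: complex measure) = density (distr lborel borel (\<lambda>x. of_real r * x)) (\<lambda>_. ennreal (r\<^sup>2))"
    using lborel_affine_euclidean[where c="\<lambda>_. r" and t="0::complex"] r
    by (simp add: eq power2_eq_square)
  then have "(\<integral>\<^sup>+z. f z \<partial>lborel) = (\<integral>\<^sup>+z. f z \<partial>density (distr lborel borel (\<lambda>x. of_real r * x)) (\<lambda>_. ennreal (r\<^sup>2)))"
    by simp
  also have "\<dots> = ennreal (r\<^sup>2) * (\<integral>\<^sup>+z. f (of_real r * z) \<partial>lborel)"
    by (simp add: nn_integral_density nn_integral_distr nn_integral_cmult)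
  finally show ?thesis by simp
qed

lemma nn_integral_complex_translate:
  fixes f :: "complex \<Rightarrow> ennreal"
  assumes [measurable]: "f \<in> borel_measurable borel"
  shows "(\<integral>\<^sup>+z. f (t + z) \<partial>lborel) = (\<integral>\<^sup>+z. f z \<partial>lborel)"
  by (subst (2) lborel_distr_plus[of t, symmetric]) (simp add: nn_integral_distr)

lemma emeasure_complex_ball:
  "0 \<le> r \<Longrightarrow> emeasure lborel (ball (z::complex) r) = ennreal (pi * r\<^sup>2)"
  by (simp add: emeasure_ball unit_ball_vol_2)

section \<open>Sub-mean value inequalities\<close>


lemma pred_in_ball [measurable]:
  fixes f g :: "'a \<Rightarrow> complex"
  assumes [measurable]: "f \<in> borel_measurable M" "g \<in> borel_measurable M" "h \<in> borel_measurable M"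
  shows "Measurable.pred M (\<lambda>x. f x \<in> ball (g x) (h x))"
  by (simp add: dist_norm)

lemma borel_measurable_if_holomorphic:
  assumes "f holomorphic_on A" "open A"
  shows "(\<lambda>z. if z \<in> A then f z else 0) \<in> borel_measurable borel"
  using assms by (intro borel_measurable_continuous_on_if)
    (auto intro: holomorphic_on_imp_continuous_on)

text \<open>Cauchy's formula at the centre, with the circle parametrised over \<open>{0..1}\<close>.
  The bound is stated with the extended nonnegative integral so that later exchanges of integrals
  need no integrability.\<close>

lemma circle_mean_bound:
  assumes f: "f holomorphic_on ball 0 R" and R: "1 < R"
  shows "ennreal (cmod (f 0)) \<le> (\<integral>\<^sup>+t\<in>{0..1}. ennreal (cmod (f (cis (2 * pi * t)))) \<partial>lborel)"
proof -
  have sub: "cball 0 1 \<subseteq> ball (0::complex) R" using R by auto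
  have "f holomorphic_on cball 0 1"
    using f sub holomorphic_on_subset by blast
  then have "((\<lambda>u. f u / (u - 0)) has_contour_integral (2 * of_real pi * \<i> * f 0)) (circlepath 0 1)"
    by (intro Cauchy_integral_circlepath_simple) auto
  then have "((\<lambda>x. f (circlepath 0 1 x) / circlepath 0 1 x * vector_derivative (circlepath 0 1) (at x within {0..1}))
      has_integral (2 * of_real pi * \<i> * f 0)) {0..1}"
    by (simp add: has_contour_integral_def)
  then have "((\<lambda>x. 2 * of_real pi * \<i> * f (cis (2 * pi * x))) has_integral (2 * of_real pi * \<i> * f 0)) {0..1}"
    by (rule has_integral_eq[rotated])
       (simp add: vector_derivative_circlepath01, simp add: circlepath cis_conv_exp mult_ac)
  then have "((\<lambda>x. inverse (2 * of_real pi * \<i>) * (2 * of_real pi * \<i> * f (cis (2 * pi * x)))) has_integral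
       inverse (2 * of_real pi * \<i>) * (2 * of_real pi * \<i> * f 0)) {0..1}"
    by (rule has_integral_mult_right)
  then have hi: "((\<lambda>x. f (cis (2 * pi * x))) has_integral f 0) {0..1}"
    by (simp add: field_simps)
  have "continuous_on {0..1} (\<lambda>x. f (cis (2 * pi * x)))"
    by (rule continuous_on_compose2[OF holomorphic_on_imp_continuous_on[OF f]])
       (use R in \<open>auto intro!: continuous_intros\<close>)
  then have int: "set_integrable lborel {0..1} (\<lambda>x. f (cis (2 * pi * x)))"
    by (rule borel_integrable_atLeastAtMost')
  have "f 0 = (LINT x:{0..1}|lborel. f (cis (2 * pi * x)))"
    using set_borel_integral_eq_integral(2)[OF int] integral_unique[OF hi] by simp
  then have "ennreal (cmod (f 0)) = ennreal (cmod (LINT x|lborel. indicat_real {0..1} x *\<^sub>R f (cis (2 * pi * x))))"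
    by (simp add: set_lebesgue_integral_def)
  also have "\<dots> \<le> (\<integral>\<^sup>+x. ennreal (cmod (indicat_real {0..1} x *\<^sub>R f (cis (2 * pi * x)))) \<partial>lborel)"
    using int unfolding set_integrable_def by (rule integral_norm_bound_ennreal)
  also have "\<dots> = (\<integral>\<^sup>+t\<in>{0..1}. ennreal (cmod (f (cis (2 * pi * t)))) \<partial>lborel)"
    by (intro nn_integral_cong) (auto simp: indicator_def)
  finally show ?thesis .
qed

text \<open>For every \<open>w\<close> the value \<open>f 0\<close> is bounded by the mean of
  \<open>|f|\<close> over the rotations of \<open>w\<close>. Integrating over \<open>w\<close> and
  exchanging the integrals leaves, for each angle, a rotated area integral, and the rotation drops
  out.\<close>

lemma area_mean_bound_0:
  assumes f: "f holomorphic_on ball 0 r" and r: "0 < r"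
  shows "ennreal (pi * r\<^sup>2 * cmod (f 0)) \<le> (\<integral>\<^sup>+w\<in>ball 0 r. ennreal (cmod (f w)) \<partial>lborel)"
proof -
  \<comment> \<open>Extension by 0 gives a Borel function on the whole plane, since nothing is known
    about \<open>f\<close> outside the ball.\<close>
  define F where "F w = (if w \<in> ball 0 r then f w else 0)" for w
  have F [measurable]: "F \<in> borel_measurable borel"
    unfolding F_def by (intro borel_measurable_if_holomorphic f) auto
  have [measurable]: "(\<lambda>t. cis (2 * pi * t)) \<in> borel_measurable borel"
    by (intro borel_measurable_continuous_onI continuous_intros)
  have mean: "ennreal (cmod (f 0)) \<le> (\<integral>\<^sup>+t\<in>{0..1}. ennreal (cmod (F (cis (2 * pi * t) * w))) \<partial>lborel)"
    if w: "w \<in> ball 0 r" for w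
  proof -
    \<comment> \<open>\<open>u * w\<close> stays in \<open>ball 0 r\<close> exactly for
      \<open>|u| < r / cmod w\<close>; for \<open>w = 0\<close> any radius above 1 serves.\<close>
    define R where "R = (if w = 0 then 2 else r / cmod w)"
    have R: "1 < R" using w by (auto simp: R_def)
    have sub: "u * w \<in> ball 0 r" if "u \<in> ball 0 R" for u
      using that w r by (auto simp: R_def norm_mult field_simps split: if_splits)
    have "(\<lambda>u. f (u * w)) holomorphic_on ball 0 R"
      using sub by (intro holomorphic_on_compose_gen[OF _ f, unfolded o_def] holomorphic_intros) auto
    from circle_mean_bound[OF this R] have
      "ennreal (cmod (f 0)) \<le> (\<integral>\<^sup>+t\<in>{0..1}. ennreal (cmod (f (cis (2 * pi * t) * w))) \<partial>lborel)"
      by simp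
    also have "\<dots> = (\<integral>\<^sup>+t\<in>{0..1}. ennreal (cmod (F (cis (2 * pi * t) * w))) \<partial>lborel)"
      using w by (intro nn_integral_cong) (auto simp: F_def norm_mult)
    finally show ?thesis .
  qed
  have "ennreal (pi * r\<^sup>2 * cmod (f 0)) = ennreal (cmod (f 0)) * emeasure lborel (ball (0::complex) r)"
    using r by (simp add: emeasure_complex_ball mult_ac flip: ennreal_mult)
  also have "\<dots> = (\<integral>\<^sup>+w\<in>ball 0 r. ennreal (cmod (f 0)) \<partial>(lborel :: complex measure))"
    by (simp add: nn_integral_cmult_indicator)
  also have "\<dots> \<le> (\<integral>\<^sup>+w\<in>ball 0 r. (\<integral>\<^sup>+t\<in>{0..1}. ennreal (cmod (F (cis (2 * pi * t) * w))) \<partial>lborel) \<partial>lborel)"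
    using mean by (intro nn_integral_mono) (auto simp: indicator_def)
  also have "\<dots> = (\<integral>\<^sup>+w. (\<integral>\<^sup>+t. ennreal (cmod (F (cis (2 * pi * t) * w))) * indicator {0..1} t * indicator (ball 0 r) w \<partial>lborel) \<partial>lborel)"
    by (intro nn_integral_cong nn_integral_multc[symmetric]) measurable
  also have "\<dots> = (\<integral>\<^sup>+t. (\<integral>\<^sup>+w. ennreal (cmod (F (cis (2 * pi * t) * w))) * indicator {0..1} t * indicator (ball 0 r) w \<partial>lborel) \<partial>lborel)"
    by (rule lborel_pair.Fubini'[symmetric]) measurable
  also have "\<dots> = (\<integral>\<^sup>+t\<in>{0..1}. (\<integral>\<^sup>+w\<in>ball 0 r. ennreal (cmod (f w)) \<partial>lborel) \<partial>(lborel::real measure))"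
  proof (intro nn_integral_cong)
    fix t :: real
    have "(\<integral>\<^sup>+w. ennreal (cmod (F (cis (2 * pi * t) * w))) * indicator {0..1} t * indicator (ball 0 r) w \<partial>lborel)
        = (\<integral>\<^sup>+w. (ennreal (cmod (F (cis (2 * pi * t) * w))) * indicator (ball 0 r) (cis (2 * pi * t) * w)) * indicator {0..1} t \<partial>lborel)"
      by (intro nn_integral_cong) (auto simp: indicator_def norm_mult)
    also have "\<dots> = (\<integral>\<^sup>+w. ennreal (cmod (F (cis (2 * pi * t) * w))) * indicator (ball 0 r) (cis (2 * pi * t) * w) \<partial>lborel) * indicator {0..1} t"
      by (rule nn_integral_multc) measurable
    also have "(\<integral>\<^sup>+w. ennreal (cmod (F (cis (2 * pi * t) * w))) * indicator (ball 0 r) (cis (2 * pi * t) * w) \<partial>lborel)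
       = (\<integral>\<^sup>+w. ennreal (cmod (F w)) * indicator (ball 0 r) w \<partial>lborel)"
      by (rule nn_integral_complex_rotate[of "\<lambda>w. ennreal (cmod (F w)) * indicator (ball 0 r) w"]) (auto)
    also have "\<dots> = (\<integral>\<^sup>+w\<in>ball 0 r. ennreal (cmod (f w)) \<partial>lborel)"
      by (intro nn_integral_cong) (auto simp: F_def indicator_def)
    finally show "(\<integral>\<^sup>+w. ennreal (cmod (F (cis (2 * pi * t) * w))) * indicator {0..1} t * indicator (ball 0 r) w \<partial>lborel)
       = (\<integral>\<^sup>+w\<in>ball 0 r. ennreal (cmod (f w)) \<partial>lborel) * indicator {0..1} t" .
  qed
  also have "\<dots> = (\<integral>\<^sup>+w\<in>ball 0 r. ennreal (cmod (f w)) \<partial>lborel)"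
    by (simp add: nn_integral_cmult_indicator)
  finally show ?thesis .
qed

lemma area_mean_bound:
  assumes f: "f holomorphic_on ball z r" and r: "0 < r"
  shows "ennreal (pi * r\<^sup>2 * cmod (f z)) \<le> (\<integral>\<^sup>+w\<in>ball z r. ennreal (cmod (f w)) \<partial>lborel)"
proof -
  define F where "F w = (if w \<in> ball z r then f w else 0)" for w
  have F [measurable]: "F \<in> borel_measurable borel"
    unfolding F_def by (intro borel_measurable_if_holomorphic f) auto
  have "(\<lambda>w. f (z + w)) holomorphic_on ball 0 r"
    by (intro holomorphic_on_compose_gen[OF _ f, unfolded o_def] holomorphic_intros) (auto simp: dist_norm)
  from area_mean_bound_0[OF this r] have
    "ennreal (pi * r\<^sup>2 * cmod (f z)) \<le> (\<integral>\<^sup>+w\<in>ball 0 r. ennreal (cmod (f (z + w))) \<partial>lborel)" by simp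
  also have "\<dots> = (\<integral>\<^sup>+w. ennreal (cmod (F (z + w))) * indicator (ball z r) (z + w) \<partial>lborel)"
    by (intro nn_integral_cong) (auto simp: F_def indicator_def dist_norm)
  also have "\<dots> = (\<integral>\<^sup>+w. ennreal (cmod (F w)) * indicator (ball z r) w \<partial>lborel)"
    by (rule nn_integral_complex_translate[of "\<lambda>w. ennreal (cmod (F w)) * indicator (ball z r) w"]) measurable
  also have "\<dots> = (\<integral>\<^sup>+w\<in>ball z r. ennreal (cmod (f w)) \<partial>lborel)"
    by (intro nn_integral_cong) (auto simp: F_def indicator_def)
  finally show ?thesis .
qed

abbreviation powr_int :: "real \<Rightarrow> (complex \<Rightarrow> complex) \<Rightarrow> complex set \<Rightarrow> ennreal" where
  "powr_int s f A \<equiv> (\<integral>\<^sup>+w\<in>A. ennreal (cmod (f w) powr s) \<partial>lborel)"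

text \<open>Absorption: writing \<open>|f| = |f|^(1 - s) * |f|^s\<close> and bounding the first
  factor by the weighted supremum \<open>S\<close>, the area mean for exponent 1 gives
  \<open>S \<le> K * S^(1 - s) * Y\<close>, where \<open>Y\<close> is the integral of
  \<open>|f|^s\<close>. Cancelling \<open>S^(1 - s)\<close> requires \<open>S\<close> to be finite,
  which is the purpose of the bound \<open>B\<close>.\<close>

lemma powr_submean_bounded_le_1:
  assumes s: "0 < s" "s \<le> 1" and f: "f holomorphic_on ball z r" and r: "0 < r"
    and B: "\<And>w. w \<in> ball z r \<Longrightarrow> cmod (f w) \<le> B"
  shows "ennreal (cmod (f z) powr s * r\<^sup>2)
    \<le> ennreal (4 / pi * 2 powr (2 / s - 2)) * powr_int s f (ball z r)"
    (is "_ \<le> ennreal ?K * ?Y")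
proof (cases "?Y = \<infinity> \<or> f z = 0")
  case True
  then show ?thesis using s by (auto simp: ennreal_mult_top)
next
  case False
  define Y where "Y = enn2real ?Y"
  have Y: "?Y = ennreal Y" "0 \<le> Y"
    using False by (auto simp: Y_def less_top)
  define F where "F w = (if w \<in> ball z r then f w else 0)" for w
  have F [measurable]: "F \<in> borel_measurable borel"
    unfolding F_def by (intro borel_measurable_if_holomorphic f) auto
  \<comment> \<open>The exponent \<open>2 / s\<close> is the one for which all powers of the
    distance \<open>d\<close> to the boundary cancel in the estimate of \<open>\<phi> w\<close>
    below.\<close>
  define \<phi> where "\<phi> w = cmod (f w) * (r - dist z w) powr (2 / s)" for w
  define S where "S = (SUP w\<in>ball z r. \<phi> w)"
  have "\<phi> w \<le> B * r powr (2 / s)" if "w \<in> ball z r" for w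
    unfolding \<phi>_def using that s B[OF that] order_trans[OF norm_ge_zero B[OF that]]
    by (intro mult_mono powr_mono2) auto
  then have bdd: "bdd_above (\<phi> ` ball z r)" by (intro bdd_aboveI2)
  have \<phi>S: "\<phi> w \<le> S" if "w \<in> ball z r" for w
    unfolding S_def using bdd that by (rule cSUP_upper2[OF _ _ order_refl])
  have "0 < \<phi> z" using False r by (simp add: \<phi>_def)
  also have "\<phi> z \<le> S" using r by (intro \<phi>S) auto
  finally have S0: "0 < S" .
  have "\<phi> w \<le> ?K * S powr (1 - s) * Y" if w: "w \<in> ball z r" for w
  proof -
    define d where "d = r - dist z w"
    have d: "0 < d" using w by (simp add: d_def)
    have sub: "ball w (d / 2) \<subseteq> ball z r"
    proof
      fix v assume "v \<in> ball w (d / 2)"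
      then show "v \<in> ball z r" using dist_triangle[of z v w] d by (simp add: d_def)
    qed
    \<comment> \<open>Points of \<open>ball w (d / 2)\<close> keep distance at least
      \<open>d / 2\<close> from the boundary of \<open>ball z r\<close>, so
      \<open>\<phi> \<le> S\<close> turns into \<open>|f| \<le> A\<close> there.\<close>
    define A where "A = S * (d / 2) powr (- (2 / s))"
    have A0: "0 \<le> A" using S0 by (simp add: A_def)
    have fv: "cmod (f v) \<le> A powr (1 - s) * cmod (f v) powr s" if v: "v \<in> ball w (d / 2)" for v
    proof -
      have dv: "d / 2 \<le> r - dist z v"
        using v dist_triangle[of z v w] by (simp add: d_def)
      have "cmod (f v) * (d / 2) powr (2 / s) \<le> \<phi> v"
        unfolding \<phi>_def using d dv s by (intro mult_left_mono powr_mono2) auto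
      also have "\<dots> \<le> S" using v sub by (intro \<phi>S) auto
      finally have le: "cmod (f v) \<le> A"
        using d by (simp add: A_def powr_minus field_simps)
      have "cmod (f v) = cmod (f v) powr (1 - s) * cmod (f v) powr s"
        by (cases "f v = 0") (auto simp: powr_add[symmetric])
      also have "\<dots> \<le> A powr (1 - s) * cmod (f v) powr s"
        using le s by (intro mult_right_mono powr_mono2) auto
      finally show ?thesis .
    qed
    have "ennreal (pi * (d / 2)\<^sup>2 * cmod (f w)) \<le> (\<integral>\<^sup>+v\<in>ball w (d / 2). ennreal (cmod (f v)) \<partial>lborel)"
      using d sub f by (intro area_mean_bound) (auto intro: holomorphic_on_subset)
    also have "\<dots> \<le> (\<integral>\<^sup>+v. ennreal (A powr (1 - s)) * (ennreal (cmod (F v) powr s) * indicator (ball z r) v) \<partial>lborel)"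
    proof (intro nn_integral_mono)
      fix v
      show "ennreal (cmod (f v)) * indicator (ball w (d / 2)) v
         \<le> ennreal (A powr (1 - s)) * (ennreal (cmod (F v) powr s) * indicator (ball z r) v)"
        using fv[of v] sub
        by (auto simp: indicator_def F_def ennreal_mult[symmetric] intro!: ennreal_leI)
    qed
    also have "\<dots> = ennreal (A powr (1 - s)) * (\<integral>\<^sup>+v. (ennreal (cmod (F v) powr s) * indicator (ball z r) v) \<partial>lborel)"
      by (intro nn_integral_cmult) measurable
    also have "(\<integral>\<^sup>+v. (ennreal (cmod (F v) powr s) * indicator (ball z r) v) \<partial>lborel) = ?Y"
      by (intro nn_integral_cong) (auto simp: F_def indicator_def)
    also have "ennreal (A powr (1 - s)) * ?Y = ennreal (A powr (1 - s) * Y)"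
      using Y by (simp add: ennreal_mult)
    finally have "pi * (d / 2)\<^sup>2 * cmod (f w) \<le> A powr (1 - s) * Y"
      using Y by (simp add: ennreal_le_iff)
    then have le: "cmod (f w) \<le> A powr (1 - s) * Y * 4 / (pi * d\<^sup>2)"
      using d by (simp add: field_simps power2_eq_square)
    have "(- (2 / s)) * (1 - s) = 2 - 2 / s" using s by (simp add: field_simps)
    then have Aeq: "A powr (1 - s) = S powr (1 - s) * (d / 2) powr (2 - 2 / s)"
      using S0 d by (simp add: A_def powr_mult powr_powr)
    have "\<phi> w \<le> (A powr (1 - s) * Y * 4 / (pi * d\<^sup>2)) * d powr (2 / s)"
      unfolding \<phi>_def d_def[symmetric] using le by (intro mult_right_mono) auto
    also have "\<dots> = S powr (1 - s) * Y * 4 / pi * ((d / 2) powr (2 - 2 / s) * (d powr (2 / s) / d powr 2))"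
      using d by (simp add: Aeq)
    also have "(d / 2) powr (2 - 2 / s) * (d powr (2 / s) / d powr 2) = 2 powr (2 / s - 2)"
      using d by (simp add: powr_divide powr_diff field_simps)
    finally show ?thesis by (simp add: mult_ac)
  qed
  then have "S \<le> ?K * S powr (1 - s) * Y"
    unfolding S_def using r by (intro cSUP_least) auto
  then have "S powr s * S powr (1 - s) \<le> (?K * Y) * S powr (1 - s)"
    using S0 by (simp add: powr_add[symmetric] mult_ac)
  then have Ss: "S powr s \<le> ?K * Y"
    by (rule mult_right_le_imp_le) (use S0 in simp)
  have "cmod (f z) powr s * r\<^sup>2 = \<phi> z powr s"
    using r s by (simp add: \<phi>_def powr_mult powr_powr)
  also have "\<dots> \<le> S powr s"
    using \<open>\<phi> z \<le> S\<close> \<open>0 < \<phi> z\<close> s by (intro powr_mono2) auto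
  also note Ss
  finally show ?thesis
    using Y by (simp add: ennreal_mult[symmetric] ennreal_leI)
qed

text \<open>A choice of the constant as a function of \<open>s\<close> alone, so that later
  estimates can name it inside their own constants.\<close>

definition submean_const :: "real \<Rightarrow> real" where
  "submean_const s = (SOME C. 0 < C \<and> (\<forall>f z r. 0 < r \<longrightarrow> f holomorphic_on ball z r \<longrightarrow>
     ennreal (cmod (f z) powr s)
       \<le> ennreal (C / r\<^sup>2) * powr_int s f (ball z r)))"

text \<open>Two reductions to the bounded case with exponent at most 1:
  \<open>|f|^s = |f ^ N|^t\<close> with \<open>t = s / N \<le> 1\<close>, and passage to the disc of
  half the radius, on whose compact closure \<open>f\<close> is bounded. The second costs the factor
  4.\<close>

lemma powr_submean_ex:
  assumes s: "0 < s"
  shows "\<exists>C. 0 < C \<and> (\<forall>f z r. 0 < r \<longrightarrow> f holomorphic_on ball z r \<longrightarrow>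
     ennreal (cmod (f z) powr s)
       \<le> ennreal (C / r\<^sup>2) * powr_int s f (ball z r))"
proof -
  define N where "N = Suc (nat \<lceil>s\<rceil>)"
  define t where "t = s / real N"
  have N: "0 < N" "s \<le> real N" by (auto simp: N_def) linarith
  have t: "0 < t" "t \<le> 1" using N s by (auto simp: t_def)
  define K where "K = 4 / pi * 2 powr (2 / t - 2)"
  have K: "0 < K" by (simp add: K_def)
  have pw: "cmod (x ^ N) powr t = cmod x powr s" for x
    using N s by (cases "x = 0") (auto simp: norm_power t_def powr_powr simp flip: powr_realpow)
  have "ennreal (cmod (f z) powr s) \<le> ennreal (4 * K / r\<^sup>2) * powr_int s f (ball z r)"
    if r: "0 < r" and f: "f holomorphic_on ball z r" for f z and r :: real
  proof -
    have sub: "cball z (r / 2) \<subseteq> ball z r" using r by auto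
    then have "continuous_on (cball z (r / 2)) f"
      using f by (blast intro: holomorphic_on_imp_continuous_on holomorphic_on_subset)
    then have "compact ((\<lambda>w. f w ^ N) ` cball z (r / 2))"
      by (intro compact_continuous_image continuous_intros) auto
    then have "bounded ((\<lambda>w. f w ^ N) ` cball z (r / 2))"
      by (rule compact_imp_bounded)
    then obtain B where B: "\<And>w. w \<in> cball z (r / 2) \<Longrightarrow> cmod (f w ^ N) \<le> B"
      unfolding bounded_iff by (metis imageI)
    have "ennreal (cmod (f z ^ N) powr t * (r / 2)\<^sup>2)
      \<le> ennreal K * powr_int t (\<lambda>w. f w ^ N) (ball z (r / 2))"
      unfolding K_def using r sub t B
      by (intro powr_submean_bounded_le_1[where B = B] holomorphic_on_power holomorphic_on_subset[OF f]) auto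
    also have "\<dots> \<le> ennreal K * powr_int s f (ball z r)"
      unfolding pw using r by (intro mult_left_mono nn_integral_mono) (auto simp: indicator_def)
    finally have le: "ennreal (cmod (f z) powr s * (r / 2)\<^sup>2)
       \<le> ennreal K * powr_int s f (ball z r)"
      by (simp add: pw)
    have "ennreal (cmod (f z) powr s) = ennreal (4 / r\<^sup>2) * ennreal (cmod (f z) powr s * (r / 2)\<^sup>2)"
      using r by (simp add: ennreal_mult[symmetric] field_simps power2_eq_square)
    also have "\<dots> \<le> ennreal (4 / r\<^sup>2) * (ennreal K * powr_int s f (ball z r))"
      using le by (rule mult_left_mono) auto
    also have "\<dots> = ennreal (4 * K / r\<^sup>2) * powr_int s f (ball z r)"
      using r K by (simp add: ennreal_mult[symmetric] flip: mult.assoc)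
    finally show ?thesis .
  qed
  then show ?thesis using K by (intro exI[of _ "4 * K"]) auto
qed

lemma
  assumes "0 < s"
  shows submean_const_pos: "0 < submean_const s"
    and powr_submean: "0 < r \<Longrightarrow> f holomorphic_on ball z r \<Longrightarrow> ennreal (cmod (f z) powr s)
       \<le> ennreal (submean_const s / r\<^sup>2) * powr_int s f (ball z r)"
  using someI_ex[OF powr_submean_ex[OF assms]] unfolding submean_const_def[symmetric] by auto

text \<open>Cauchy's inequality on the circle of radius \<open>r / 2\<close> around
  \<open>z\<close>: each of its points is the centre of a disc of radius \<open>r / 2\<close> inside
  \<open>ball z r\<close>, where the sub-mean value inequality applies.\<close>

lemma deriv_submean:
  assumes s: "0 < s"
  obtains C where "0 < C" "\<And>f z r. 0 < r \<Longrightarrow> f holomorphic_on ball z r \<Longrightarrow>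
     ennreal (cmod ((deriv ^^ k) f z) powr s * r powr (real k * s))
       \<le> ennreal (C / r\<^sup>2) * powr_int s f (ball z r)"
proof
  let ?c = "submean_const s"
  define C where "C = (fact k * 2 ^ k) powr s * 4 * ?c"
  show "0 < C" using submean_const_pos[OF s] by (simp add: C_def)
  fix f z and r :: real
  assume r: "0 < r" and f: "f holomorphic_on ball z r"
  let ?Y = "powr_int s f (ball z r)"
  show "ennreal (cmod ((deriv ^^ k) f z) powr s * r powr (real k * s)) \<le> ennreal (C / r\<^sup>2) * ?Y"
  proof (cases "?Y = \<infinity>")
    case True
    then show ?thesis using r \<open>0 < C\<close> by (simp add: ennreal_mult_top)
  next
    case False
    define Y where "Y = enn2real ?Y"
    have Y: "?Y = ennreal Y" "0 \<le> Y"
      using False by (auto simp: Y_def less_top)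
    define B where "B = (?c / (r / 2)\<^sup>2 * Y) powr (1 / s)"
    have fw: "cmod (f w) \<le> B" if w: "dist z w = r / 2" for w
    proof -
      have sub: "ball w (r / 2) \<subseteq> ball z r"
      proof
        fix v assume "v \<in> ball w (r / 2)"
        then show "v \<in> ball z r" using dist_triangle[of z v w] w by simp
      qed
      have "ennreal (cmod (f w) powr s)
         \<le> ennreal (?c / (r / 2)\<^sup>2) * powr_int s f (ball w (r / 2))"
        using s r sub by (intro powr_submean holomorphic_on_subset[OF f]) auto
      also have "\<dots> \<le> ennreal (?c / (r / 2)\<^sup>2) * ?Y"
        using sub by (intro mult_left_mono nn_integral_mono) (auto simp: indicator_def)
      also have "\<dots> = ennreal (?c / (r / 2)\<^sup>2 * Y)"
        using Y submean_const_pos[OF s] by (subst ennreal_mult) auto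
      finally have "cmod (f w) powr s \<le> ?c / (r / 2)\<^sup>2 * Y"
        using Y submean_const_pos[OF s] by (simp add: ennreal_le_iff)
      then have "(cmod (f w) powr s) powr (1 / s) \<le> B"
        unfolding B_def using s by (intro powr_mono2) auto
      then show ?thesis using s by (simp add: powr_powr)
    qed
    have "cmod ((deriv ^^ k) f z) \<le> fact k * B / (r / 2) ^ k"
    proof (rule Cauchy_inequality)
      show "f holomorphic_on ball z (r / 2)"
        using r by (intro holomorphic_on_subset[OF f]) auto
      show "continuous_on (cball z (r / 2)) f"
        using r by (intro holomorphic_on_imp_continuous_on holomorphic_on_subset[OF f]) auto
    qed (use r fw in \<open>auto simp: dist_norm\<close>)
    then have "cmod ((deriv ^^ k) f z) * r powr real k \<le> fact k * 2 ^ k * B"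
      using r by (simp add: powr_realpow field_simps)
    then have "(cmod ((deriv ^^ k) f z) * r powr real k) powr s \<le> (fact k * 2 ^ k * B) powr s"
      using s by (intro powr_mono2) auto
    also have "\<dots> = (fact k * 2 ^ k) powr s * B powr s"
      by (simp add: powr_mult B_def)
    also have "B powr s = ?c / (r / 2)\<^sup>2 * Y"
      using s Y submean_const_pos[OF s] by (simp add: B_def powr_powr)
    also have "(fact k * 2 ^ k) powr s * (?c / (r / 2)\<^sup>2 * Y) = C / r\<^sup>2 * Y"
      using r by (simp add: C_def field_simps power2_eq_square)
    finally have "cmod ((deriv ^^ k) f z) powr s * r powr (real k * s) \<le> C / r\<^sup>2 * Y"
      by (simp add: powr_mult powr_powr)
    then show ?thesis
      using Y \<open>0 < C\<close> by (simp add: ennreal_mult[symmetric] ennreal_leI)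
  qed
qed

section \<open>Derivatives of Bergman functions\<close>


abbreviation weighted_density :: "real \<Rightarrow> real \<Rightarrow> (complex \<Rightarrow> complex) \<Rightarrow> complex \<Rightarrow> ennreal" where
  "weighted_density a s f z \<equiv> ennreal (cmod (f z) powr s * (1 - cmod z) powr a) * indicator disc z"

text \<open>The weight \<open>1 - cmod z\<close> stands in for \<open>1 - (cmod z)^2\<close>, with
  which it is comparable on the disc. No root is taken and the value may be infinite, so the
  estimates can be stated for all holomorphic functions and all positive exponents.\<close>

definition weighted_int :: "real \<Rightarrow> real \<Rightarrow> (complex \<Rightarrow> complex) \<Rightarrow> ennreal" where
  "weighted_int a s f = (\<integral>\<^sup>+z\<in>disc. ennreal (cmod (f z) powr s * (1 - cmod z) powr a) \<partial>lborel)"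

lemma weighted_int_mono:
  assumes "\<And>z. z \<in> disc \<Longrightarrow> cmod (f z) powr s * (1 - cmod z) powr a \<le> cmod (g z) powr t * (1 - cmod z) powr b"
  shows "weighted_int a s f \<le> weighted_int b t g"
  unfolding weighted_int_def using assms
  by (intro nn_integral_mono) (auto simp: indicator_def intro!: ennreal_leI)

lemma weighted_int_cong:
  assumes "\<And>z. z \<in> disc \<Longrightarrow> f z = g z"
  shows "weighted_int a s f = weighted_int a s g"
  unfolding weighted_int_def using assms
  by (intro nn_integral_cong) (auto simp: indicator_def)

lemma measurable_weighted_integrand [measurable]:
  assumes "f holomorphic_on disc"
  shows "(\<lambda>z. weighted_density a s f z) \<in> borel_measurable borel"
proof -
  define F where "F z = (if z \<in> disc then f z else 0)" for z
  have [measurable]: "F \<in> borel_measurable borel"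
    unfolding F_def by (intro borel_measurable_if_holomorphic assms) auto
  have "(\<lambda>z. weighted_density a s F z) \<in> borel_measurable borel"
    by measurable
  also have "(\<lambda>z. weighted_density a s F z)
     = (\<lambda>z. weighted_density a s f z)"
    by (auto simp: F_def indicator_def)
  finally show ?thesis .
qed

text \<open>Integrates a pointwise comparison. \<open>B = 0\<close> exchanges one weight for
  another, \<open>A = 0\<close> gives finiteness for bounded functions, and both terms occur when
  the disc is split into a compact part and an outer ring. The factor \<open>pi\<close> is the area
  of the disc.\<close>

lemma weighted_int_le_split:
  assumes "0 \<le> A" "0 \<le> B" and f: "f holomorphic_on disc"
    and le: "\<And>z. z \<in> disc \<Longrightarrow> cmod (h z) powr q * (1 - cmod z) powr a \<le> A * (cmod (f z) powr s * (1 - cmod z) powr b) + B"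
  shows "weighted_int a q h \<le> ennreal A * weighted_int b s f + ennreal (B * pi)"
proof -
  let ?A = "\<lambda>z. cmod (f z) powr s * (1 - cmod z) powr b"
  have [measurable]: "(\<lambda>z. ennreal (?A z) * indicator disc z) \<in> borel_measurable borel"
    by (rule measurable_weighted_integrand[OF f])
  have "weighted_int a q h \<le> (\<integral>\<^sup>+z. ennreal A * (ennreal (?A z) * indicator disc z)
      + ennreal B * indicator disc z \<partial>lborel)"
    unfolding weighted_int_def
  proof (intro nn_integral_mono)
    fix z
    show "weighted_density a q h z
      \<le> ennreal A * (ennreal (?A z) * indicator disc z) + ennreal B * indicator disc z"
    proof (cases "z \<in> disc")
      case True
      have "ennreal (cmod (h z) powr q * (1 - cmod z) powr a) \<le> ennreal (A * (?A z) + B)"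
        by (rule ennreal_leI[OF le[OF True]])
      also have "\<dots> = ennreal (A * (?A z)) + ennreal B"
        using assms by (intro ennreal_plus) auto
      also have "ennreal (A * (?A z)) = ennreal A * ennreal (?A z)"
        using assms by (intro ennreal_mult) auto
      finally show ?thesis using True by simp
    qed simp
  qed
  also have "\<dots> = ennreal A * weighted_int b s f + ennreal B * ennreal (pi * 1\<^sup>2)"
    unfolding weighted_int_def
    by (subst nn_integral_add) (auto simp: nn_integral_cmult nn_integral_cmult_indicator emeasure_complex_ball)
  also have "ennreal B * ennreal (pi * 1\<^sup>2) = ennreal (B * pi)"
    using assms by (subst ennreal_mult[symmetric]) auto
  finally show ?thesis .
qed

text \<open>The local estimate is applied on the disc of radius \<open>(1 - |z|) / 2\<close> around
  each \<open>z\<close>, and the integrals are exchanged. For fixed \<open>w\<close> the centres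
  \<open>z\<close> whose disc contains \<open>w\<close> fill at most \<open>ball w d\<close> with
  \<open>d = 1 - |w|\<close>, on which the kernel is at most \<open>9 / d^2\<close>; hence the
  constant \<open>9 * pi\<close>.\<close>

lemma weighted_int_deriv_le:
  assumes s: "0 < s"
  obtains C where "0 < C" "\<And>f. f holomorphic_on disc \<Longrightarrow>
    weighted_int (real k * s) s ((deriv ^^ k) f) \<le> ennreal C * weighted_int 0 s f"
proof -
  obtain C where C: "0 < C" "\<And>f z r. 0 < r \<Longrightarrow> f holomorphic_on ball z r \<Longrightarrow>
     ennreal (cmod ((deriv ^^ k) f z) powr s * r powr (real k * s))
       \<le> ennreal (C / r\<^sup>2) * powr_int s f (ball z r)"
    by (rule deriv_submean[OF s, of k]) blast
  define K where "K = 2 powr (real k * s) * C"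
  have K: "0 < K" using C by (simp add: K_def)
  have "weighted_int (real k * s) s ((deriv ^^ k) f) \<le> ennreal (K * 9 * pi) * weighted_int 0 s f"
    if f: "f holomorphic_on disc" for f
  proof -
    define F where "F z = (if z \<in> disc then f z else 0)" for z
    have F [measurable]: "F \<in> borel_measurable borel"
      unfolding F_def by (intro borel_measurable_if_holomorphic f) auto
    \<comment> \<open>\<open>4 / (1 - |z|)^2\<close> is \<open>1 / r^2\<close> for the radius
      \<open>r = (1 - |z|) / 2\<close>.\<close>
    define \<kappa> where "\<kappa> z w = ennreal (4 / (1 - cmod z)\<^sup>2) * indicator (ball z ((1 - cmod z) / 2)) w * indicator disc z" for z w :: complex
    have [measurable]: "(\<lambda>(z, w). \<kappa> z w) \<in> borel_measurable (lborel \<Otimes>\<^sub>M lborel)"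
      unfolding \<kappa>_def by measurable
    have pt: "weighted_density (real k * s) s ((deriv ^^ k) f) z
       \<le> (\<integral>\<^sup>+w. ennreal K * (\<kappa> z w * ennreal (cmod (F w) powr s)) \<partial>lborel)" for z
    proof (cases "z \<in> disc")
      case True
      define r where "r = (1 - cmod z) / 2"
      have r: "0 < r" using True by (simp add: r_def)
      have sub: "ball z r \<subseteq> disc"
      proof
        fix w assume "w \<in> ball z r"
        then show "w \<in> disc" using norm_triangle_sub[of w z] True
          by (simp add: r_def dist_norm norm_minus_commute)
      qed
      have "(1 - cmod z) powr (real k * s) = 2 powr (real k * s) * r powr (real k * s)"
        using r by (simp add: r_def powr_divide)
      then have "ennreal (cmod ((deriv ^^ k) f z) powr s * (1 - cmod z) powr (real k * s))
          = ennreal (2 powr (real k * s)) * ennreal (cmod ((deriv ^^ k) f z) powr s * r powr (real k * s))"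
        by (simp add: ennreal_mult[symmetric] mult_ac)
      also have "\<dots> \<le> ennreal (2 powr (real k * s)) *
           (ennreal (C / r\<^sup>2) * powr_int s f (ball z r))"
        using r sub by (intro mult_left_mono C(2) holomorphic_on_subset[OF f]) auto
      also have "powr_int s f (ball z r)
           = (\<integral>\<^sup>+w. ennreal (cmod (F w) powr s) * indicator (ball z r) w \<partial>lborel)"
        using sub by (intro nn_integral_cong) (auto simp: F_def indicator_def)
      also have "ennreal (2 powr (real k * s)) * (ennreal (C / r\<^sup>2) * (\<integral>\<^sup>+w. ennreal (cmod (F w) powr s) * indicator (ball z r) w \<partial>lborel))
           = (\<integral>\<^sup>+w. ennreal (K / r\<^sup>2) * (ennreal (cmod (F w) powr s) * indicator (ball z r) w) \<partial>lborel)"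
        using C r by (subst nn_integral_cmult) (auto simp: K_def ennreal_mult[symmetric] simp flip: mult.assoc)
      also have "\<dots> = (\<integral>\<^sup>+w. ennreal K * (\<kappa> z w * ennreal (cmod (F w) powr s)) \<partial>lborel)"
      proof (intro nn_integral_cong)
        fix w
        have "K / r\<^sup>2 = K * (4 / (1 - cmod z)\<^sup>2)"
          by (simp add: r_def power_divide)
        moreover have "ennreal (K * (4 / (1 - cmod z)\<^sup>2)) = ennreal K * ennreal (4 / (1 - cmod z)\<^sup>2)"
          using K by (intro ennreal_mult) auto
        ultimately have "ennreal (K / r\<^sup>2) = ennreal K * ennreal (4 / (1 - cmod z)\<^sup>2)"
          by simp
        then show "ennreal (K / r\<^sup>2) * (ennreal (cmod (F w) powr s) * indicator (ball z r) w)
            = ennreal K * (\<kappa> z w * ennreal (cmod (F w) powr s))"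
          using True by (simp add: \<kappa>_def r_def mult_ac)
      qed
      finally show ?thesis using True by simp
    qed simp
    have \<kappa>: "(\<integral>\<^sup>+z. \<kappa> z w * ennreal (cmod (F w) powr s) \<partial>lborel) \<le> ennreal (9 * pi) * (ennreal (cmod (F w) powr s) * indicator disc w)" for w
    proof (cases "w \<in> disc")
      case True
      define d where "d = 1 - cmod w"
      have d: "0 < d" using True by (simp add: d_def)
      have "\<kappa> z w \<le> ennreal (9 / d\<^sup>2) * indicator (ball w d) z" for z
      proof (cases "z \<in> disc \<and> w \<in> ball z ((1 - cmod z) / 2)")
        case True
        then have zw: "cmod (z - w) < (1 - cmod z) / 2" and z: "cmod z < 1" by (auto simp: dist_norm)
        \<comment> \<open>\<open>w\<close> and \<open>z\<close> are closer than half the distance of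
          \<open>z\<close> to the circle, so their distances to the circle are comparable; both
          claims are triangle inequalities.\<close>
        have "2 * d \<le> 3 * (1 - cmod z)" "cmod (z - w) < d"
          using zw norm_triangle_ineq2[of z w] norm_triangle_ineq2[of w z] norm_minus_commute[of w z]
          by (auto simp: d_def)
        then have "z \<in> ball w d"
          by (simp add: dist_norm norm_minus_commute)
        have "(2 * d)\<^sup>2 \<le> (3 * (1 - cmod z))\<^sup>2"
          using d by (intro power_mono \<open>2 * d \<le> 3 * (1 - cmod z)\<close>) auto
        then have "4 / (1 - cmod z)\<^sup>2 \<le> 9 / d\<^sup>2"
          unfolding power_mult_distrib using z d by (simp add: divide_simps mult.commute)
        then show ?thesis using True \<open>z \<in> ball w d\<close>
          by (simp add: \<kappa>_def ennreal_leI)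
      next
        case False
        then show ?thesis by (auto simp: \<kappa>_def)
      qed
      then have "(\<integral>\<^sup>+z. \<kappa> z w * ennreal (cmod (F w) powr s) \<partial>lborel)
         \<le> (\<integral>\<^sup>+z. (ennreal (9 / d\<^sup>2) * indicator (ball w d) z) * ennreal (cmod (F w) powr s) \<partial>lborel)"
        by (intro nn_integral_mono mult_right_mono) auto
      also have "\<dots> = ennreal (9 / d\<^sup>2) * ennreal (pi * d\<^sup>2) * ennreal (cmod (F w) powr s)"
        using d by (subst nn_integral_multc) (auto simp: nn_integral_cmult_indicator emeasure_complex_ball)
      also have "ennreal (9 / d\<^sup>2) * ennreal (pi * d\<^sup>2) = ennreal (9 * pi)"
        using d by (simp add: ennreal_mult[symmetric])
      finally show ?thesis using True by (simp add: mult_ac)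
    next
      case False
      then show ?thesis using s by (simp add: F_def)
    qed
    have "weighted_int (real k * s) s ((deriv ^^ k) f)
       \<le> (\<integral>\<^sup>+z. (\<integral>\<^sup>+w. ennreal K * (\<kappa> z w * ennreal (cmod (F w) powr s)) \<partial>lborel) \<partial>lborel)"
      unfolding weighted_int_def by (intro nn_integral_mono pt)
    also have "\<dots> = (\<integral>\<^sup>+w. (\<integral>\<^sup>+z. ennreal K * (\<kappa> z w * ennreal (cmod (F w) powr s)) \<partial>lborel) \<partial>lborel)"
      by (rule lborel_pair.Fubini'[symmetric]) measurable
    also have "\<dots> = (\<integral>\<^sup>+w. ennreal K * (\<integral>\<^sup>+z. \<kappa> z w * ennreal (cmod (F w) powr s) \<partial>lborel) \<partial>lborel)"
      by (intro nn_integral_cong nn_integral_cmult) measurable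
    also have "\<dots> \<le> (\<integral>\<^sup>+w. ennreal K * (ennreal (9 * pi) * (ennreal (cmod (F w) powr s) * indicator disc w)) \<partial>lborel)"
      by (intro nn_integral_mono mult_left_mono \<kappa>) auto
    also have "\<dots> = (\<integral>\<^sup>+w. ennreal (K * 9 * pi) * (ennreal (cmod (F w) powr s) * indicator disc w) \<partial>lborel)"
      using K by (simp add: ennreal_mult mult_ac)
    also have "\<dots> = ennreal (K * 9 * pi) * (\<integral>\<^sup>+w. ennreal (cmod (F w) powr s) * indicator disc w \<partial>lborel)"
      by (intro nn_integral_cmult) measurable
    also have "(\<integral>\<^sup>+w. ennreal (cmod (F w) powr s) * indicator disc w \<partial>lborel) = weighted_int 0 s f"
      unfolding weighted_int_def by (intro nn_integral_cong) (auto simp: F_def indicator_def)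
    finally show ?thesis .
  qed
  then show ?thesis using K by (intro that[of "K * 9 * pi"]) auto
qed

text \<open>Here the disc is the full \<open>ball z (1 - |z|)\<close>; the extra exponent 2 in the
  weight pays for the factor \<open>1 / r^2\<close> of the area mean.\<close>

lemma deriv_pointwise_le:
  assumes s: "0 < s"
  obtains C where "0 < C" "\<And>f z. f holomorphic_on disc \<Longrightarrow> z \<in> disc \<Longrightarrow>
    ennreal (cmod ((deriv ^^ k) f z) powr s * (1 - cmod z) powr (real k * s + 2)) \<le> ennreal C * weighted_int 0 s f"
proof -
  obtain C where C: "0 < C" "\<And>f z r. 0 < r \<Longrightarrow> f holomorphic_on ball z r \<Longrightarrow>
     ennreal (cmod ((deriv ^^ k) f z) powr s * r powr (real k * s))
       \<le> ennreal (C / r\<^sup>2) * powr_int s f (ball z r)"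
    by (rule deriv_submean[OF s, of k]) blast
  have "ennreal (cmod ((deriv ^^ k) f z) powr s * (1 - cmod z) powr (real k * s + 2)) \<le> ennreal C * weighted_int 0 s f"
    if f: "f holomorphic_on disc" and z: "z \<in> disc" for f z
  proof -
    define r where "r = 1 - cmod z"
    have r: "0 < r" using z by (simp add: r_def)
    have sub: "ball z r \<subseteq> disc"
    proof
      fix w assume "w \<in> ball z r"
      then show "w \<in> disc" using norm_triangle_sub[of w z]
        by (simp add: r_def dist_norm norm_minus_commute)
    qed
    have "ennreal (cmod ((deriv ^^ k) f z) powr s * r powr (real k * s + 2))
        = ennreal (r\<^sup>2) * ennreal (cmod ((deriv ^^ k) f z) powr s * r powr (real k * s))"
      using r by (simp add: ennreal_mult[symmetric] mult_ac powr_add)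
    also have "\<dots> \<le> ennreal (r\<^sup>2) * (ennreal (C / r\<^sup>2) * powr_int s f (ball z r))"
      using r sub by (intro mult_left_mono C(2) holomorphic_on_subset[OF f]) auto
    also have "\<dots> = ennreal C * powr_int s f (ball z r)"
      using r C by (simp add: ennreal_mult[symmetric] flip: mult.assoc)
    also have "\<dots> \<le> ennreal C * weighted_int 0 s f"
      unfolding weighted_int_def using sub
      by (intro mult_left_mono nn_integral_mono) (auto simp: indicator_def)
    finally show ?thesis by (simp add: r_def)
  qed
  then show ?thesis using C by (intro that[of C])
qed

text \<open>Interpolation between the pointwise and the integral bound: with
  \<open>e = (q - p) / p \<ge> 0\<close>, \<open>|f^(k)|^q\<close> is
  \<open>(|f^(k)|^p)^e * |f^(k)|^p\<close>; the first factor is estimated pointwise and the second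
  is integrated. The weights add up to
  \<open>(k * p + 2) * e + k * p = k * q + 2 * q / p - 2\<close>, and \<open>e + 1 = q / p\<close>
  is the power of \<open>M\<close>.\<close>

lemma weighted_int_deriv_embed:
  assumes p: "0 < p" and pq: "p \<le> q"
  obtains C where "0 < C" "\<And>f M. f holomorphic_on disc \<Longrightarrow> 0 \<le> M \<Longrightarrow> weighted_int 0 p f \<le> ennreal M \<Longrightarrow>
    weighted_int (real k * q + 2 * q / p - 2) q ((deriv ^^ k) f) \<le> ennreal (C * M powr (q / p))"
proof -
  obtain A where A: "0 < A" "\<And>f. f holomorphic_on disc \<Longrightarrow>
    weighted_int (real k * p) p ((deriv ^^ k) f) \<le> ennreal A * weighted_int 0 p f"
    by (rule weighted_int_deriv_le[OF p, of k]) blast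
  obtain B where B: "0 < B" "\<And>f z. f holomorphic_on disc \<Longrightarrow> z \<in> disc \<Longrightarrow>
    ennreal (cmod ((deriv ^^ k) f z) powr p * (1 - cmod z) powr (real k * p + 2)) \<le> ennreal B * weighted_int 0 p f"
    by (rule deriv_pointwise_le[OF p, of k]) blast
  define e where "e = (q - p) / p"
  have e: "0 \<le> e" using p pq by (simp add: e_def)
  have "weighted_int (real k * q + 2 * q / p - 2) q ((deriv ^^ k) f) \<le> ennreal (B powr e * A * M powr (q / p))"
    if f: "f holomorphic_on disc" and M: "0 \<le> M" "weighted_int 0 p f \<le> ennreal M" for f M
  proof -
    let ?g = "(deriv ^^ k) f"
    have hol: "?g holomorphic_on disc" by (intro holomorphic_higher_deriv f) auto
    have pt: "cmod (?g z) powr q * (1 - cmod z) powr (real k * q + 2 * q / p - 2)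
        \<le> (B * M) powr e * (cmod (?g z) powr p * (1 - cmod z) powr (real k * p))" if z: "z \<in> disc" for z
    proof (cases "?g z = 0")
      case True
      then show ?thesis using p pq by simp
    next
      case False
      have d: "0 < 1 - cmod z" using z by simp
      have "ennreal (cmod (?g z) powr p * (1 - cmod z) powr (real k * p + 2)) \<le> ennreal B * weighted_int 0 p f"
        by (rule B(2)[OF f z])
      also have "\<dots> \<le> ennreal B * ennreal M"
        by (intro mult_left_mono M) auto
      also have "\<dots> = ennreal (B * M)" using B M by (simp add: ennreal_mult)
      finally have le: "cmod (?g z) powr p * (1 - cmod z) powr (real k * p + 2) \<le> B * M"
        using B M by (simp add: ennreal_le_iff)
      have e1: "p * e + p = q" using p by (simp add: e_def field_simps)
      have e2: "(real k * p + 2) * e + real k * p = real k * q + 2 * q / p - 2"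
        using p by (simp add: e_def field_simps)
      have "cmod (?g z) powr q * (1 - cmod z) powr (real k * q + 2 * q / p - 2)
        = (cmod (?g z) powr p * (1 - cmod z) powr (real k * p + 2)) powr e * (cmod (?g z) powr p * (1 - cmod z) powr (real k * p))"
        unfolding powr_mult powr_powr using powr_add[of "cmod (?g z)" "p * e" p]
          powr_add[of "1 - cmod z" "(real k * p + 2) * e" "real k * p"] unfolding e1 e2
        by simp
      also have "\<dots> \<le> (B * M) powr e * (cmod (?g z) powr p * (1 - cmod z) powr (real k * p))"
        using le e by (intro mult_right_mono powr_mono2) auto
      finally show ?thesis .
    qed
    have "weighted_int (real k * q + 2 * q / p - 2) q ?g \<le> ennreal ((B * M) powr e) * weighted_int (real k * p) p ?g"
      using weighted_int_le_split[of "(B * M) powr e" 0 ?g ?g q _ p, OF _ _ hol] pt by simp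
    also have "\<dots> \<le> ennreal ((B * M) powr e) * (ennreal A * ennreal M)"
      by (intro mult_left_mono order_trans[OF A(2)[OF f]] M) auto
    also have "\<dots> = ennreal ((B * M) powr e * A * M)"
      using A B M by (simp add: ennreal_mult mult_ac)
    also have "(B * M) powr e * A * M = B powr e * A * M powr (q / p)"
    proof (cases "M = 0")
      case False
      then have "M powr (e + 1) = M powr e * M" using M by (simp add: powr_add)
      moreover have "e + 1 = q / p" using p by (simp add: e_def field_simps)
      ultimately show ?thesis using B M by (simp add: powr_mult)
    qed simp
    finally show ?thesis .
  qed
  then show ?thesis using A B by (intro that[of "B powr e * A"]) auto
qed

section \<open>A Hardy-Littlewood inequality\<close>


text \<open>After division by \<open>x + y\<close> this is \<open>u \<le> u^s\<close> on
  \<open>[0, 1]\<close>, summed over the two quotients.\<close>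

lemma powr_add_le_add_powr:
  fixes x y s :: real
  assumes "0 \<le> x" "0 \<le> y" "0 < s" "s \<le> 1"
  shows "(x + y) powr s \<le> x powr s + y powr s"
proof (cases "x + y = 0")
  case False
  define t where "t = x + y"
  have t: "0 < t" using False assms by (simp add: t_def)
  have le: "u / t \<le> (u / t) powr s" if "0 \<le> u" "u \<le> t" for u
  proof (cases "u = 0")
    case False
    then have "(u / t) powr 1 \<le> (u / t) powr s"
      using that t assms by (intro powr_mono') (auto simp: field_simps)
    then show ?thesis using that t by simp
  qed simp
  have "1 = x / t + y / t" using t by (simp add: t_def add_divide_distrib[symmetric])
  also have "\<dots> \<le> (x / t) powr s + (y / t) powr s"
    using assms by (intro add_mono le) (auto simp: t_def)
  also have "\<dots> = (x powr s + y powr s) / t powr s"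
    using assms t by (simp add: powr_divide add_divide_distrib)
  finally show ?thesis using t by (simp add: t_def[symmetric] field_simps)
qed (use assms in auto)

lemma powr_sum_le_sum_powr:
  fixes x :: "'a \<Rightarrow> real"
  assumes "finite I" "\<And>i. i \<in> I \<Longrightarrow> 0 \<le> x i" "0 < s" "s \<le> 1"
  shows "(\<Sum>i\<in>I. x i) powr s \<le> (\<Sum>i\<in>I. x i powr s)"
  using assms(1,2)
proof (induction I rule: finite_induct)
  case (insert i I)
  have "(\<Sum>i\<in>insert i I. x i) powr s = (x i + (\<Sum>i\<in>I. x i)) powr s"
    using insert by simp
  also have "\<dots> \<le> x i powr s + (\<Sum>i\<in>I. x i) powr s"
    using insert assms by (intro powr_add_le_add_powr sum_nonneg) auto
  also have "\<dots> \<le> x i powr s + (\<Sum>i\<in>I. x i powr s)"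
    using insert by auto
  finally show ?case using insert by simp
qed (use assms in auto)

text \<open>The condition keeps only the tail of a geometric series that starts near
  \<open>log 2 (1 / x)\<close>. In the induction, \<open>x > 1\<close> allows the whole series;
  otherwise the term \<open>j = 0\<close> is absent, and shifting the index doubles \<open>x\<close>
  while contributing the factor \<open>2^(-s)\<close>, which leaves \<open>x^s\<close>
  unchanged.\<close>

lemma sum_dyadic_le:
  fixes s x :: real
  assumes s: "0 < s" and x: "0 < x"
  shows "(\<Sum>j<J. if 1 / 2 ^ j < x then (2 powr (- s)) ^ j else 0) \<le> x powr s / (1 - 2 powr (- s))"
  using x
proof (induction J arbitrary: x)
  case 0
  have "(2::real) powr (- s) < 2 powr 0" using s by (subst powr_less_cancel_iff) auto
  then show ?case by simp
next
  case (Suc J)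
  define t :: real where "t = 2 powr (- s)"
  have t: "0 < t" "t < 1" using s powr_less_cancel_iff[of 2 "-s" 0] by (auto simp: t_def)
  show ?case
  proof (cases "1 < x")
    case True
    have "(\<Sum>j<Suc J. if 1 / 2 ^ j < x then t ^ j else 0) \<le> (\<Sum>j<Suc J. t ^ j)"
      using t by (intro sum_mono) auto
    also have "\<dots> \<le> 1 / (1 - t)"
      using t by (subst sum_gp_strict) (auto simp: divide_simps)
    also have "\<dots> \<le> x powr s / (1 - t)"
      using True s t by (intro divide_right_mono) (auto intro: ge_one_powr_ge_zero)
    finally show ?thesis unfolding t_def .
  next
    case False
    have "(\<Sum>j<Suc J. if 1 / 2 ^ j < x then t ^ j else 0)
       = (\<Sum>j<J. if 1 / 2 ^ Suc j < x then t ^ Suc j else 0)"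
      using False by (subst sum.lessThan_Suc_shift) simp
    also have "\<dots> = t * (\<Sum>j<J. if 1 / 2 ^ j < 2 * x then t ^ j else 0)"
      unfolding sum_distrib_left by (intro sum.cong) (auto simp: field_simps)
    also have "\<dots> \<le> t * ((2 * x) powr s / (1 - t))"
      using Suc.IH[of "2 * x", folded t_def] Suc.prems t by (intro mult_left_mono) auto
    also have "\<dots> = x powr s / (1 - t)"
      using Suc.prems by (simp add: t_def powr_mult powr_minus field_simps)
    finally show ?thesis unfolding t_def .
  qed
qed

lemma suminf_dyadic_le:
  fixes s x :: real
  assumes s: "0 < s" and x: "0 < x"
  shows "(\<Sum>j. ennreal (if 1 / 2 ^ j < x then (2 powr (- s)) ^ j else 0)) \<le> ennreal (x powr s / (1 - 2 powr (- s)))"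
proof (rule suminf_le_const)
  fix J
  have "(\<Sum>j<J. ennreal (if 1 / 2 ^ j < x then (2 powr (- s)) ^ j else 0))
     = ennreal (\<Sum>j<J. if 1 / 2 ^ j < x then (2 powr (- s)) ^ j else 0)"
    by (intro sum_ennreal) auto
  also have "\<dots> \<le> ennreal (x powr s / (1 - 2 powr (- s)))"
    by (intro ennreal_leI sum_dyadic_le s x)
  finally show "(\<Sum>j<J. ennreal (if 1 / 2 ^ j < x then (2 powr (- s)) ^ j else 0)) \<le> ennreal (x powr s / (1 - 2 powr (- s)))" .
qed auto

text \<open>The increments of \<open>F\<close> between the dilates \<open>\<rho> j * z\<close>, \<open>\<rho> j = 1 - 2^(-j)\<close>, are controlled by
  averages of \<open>F'\<close> over discs of radius comparable to \<open>2^(-j)\<close>.\<close>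

lemma dyadic_increment_le:
  fixes j :: nat
  defines "\<rho> \<equiv> \<lambda>j::nat. 1 - 1 / 2 ^ j"
  assumes s: "0 < s" and F: "F holomorphic_on disc" and z: "z \<in> disc"
  shows "ennreal (cmod (F (of_real (\<rho> (Suc j)) * z) - F (of_real (\<rho> j) * z)) powr s)
    \<le> ennreal (16 * submean_const s * (4 ^ j * (2 powr (- s)) ^ j)) *
       (\<integral>\<^sup>+w. ennreal (cmod (if w \<in> disc then deriv F w else 0) powr s) * indicator (ball 0 (1 - 1 / (4 * 2 ^ j))) w
           * indicator (ball (of_real (\<rho> (Suc j)) * z) (1 / 2 ^ j)) w \<partial>lborel)"
    (is "_ \<le> _ * ?Y")
proof -
  let ?c = "submean_const s"
  define a where "a = of_real (\<rho> j) * z"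
  define b where "b = of_real (\<rho> (Suc j)) * z"
  \<comment> \<open>A quarter of the dyadic scale: the segment from \<open>a\<close> to
    \<open>b\<close> stays in \<open>|v| \<le> 1 - 2 * e\<close> and within \<open>2 * e\<close> of
    \<open>b\<close>, which leaves room for a disc of radius \<open>e\<close> around each of its
    points.\<close>
  define e :: real where "e = 1 / (4 * 2 ^ j)"
  have e: "0 < e" "1 / 2 ^ j = 4 * e" by (auto simp: e_def)
  have \<rho>: "\<rho> (Suc j) = 1 - 2 * e" "\<rho> j = 1 - 4 * e" by (auto simp: \<rho>_def e_def)
  have e4: "4 * e \<le> 1" by (simp add: e_def)
  have c: "0 < ?c" by (rule submean_const_pos[OF s])
  have hd: "deriv F holomorphic_on disc" by (intro holomorphic_deriv F) auto
  have nz: "cmod z < 1" using z by simp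
  have seg: "cmod v \<le> 1 - 2 * e" "cmod (v - b) \<le> 2 * e" if vs: "v \<in> closed_segment a b" for v
  proof -
    obtain u where u: "0 \<le> u" "u \<le> 1" "v = (1 - u) *\<^sub>R a + u *\<^sub>R b"
      using vs by (auto simp: closed_segment_def)
    have v: "v = of_real (1 - 4 * e + 2 * e * u) * z"
      unfolding u(3) a_def b_def \<rho> by (simp add: scaleR_conv_of_real algebra_simps)
    have "cmod v = (1 - 4 * e + 2 * e * u) * cmod z"
      unfolding v norm_mult norm_of_real using e e4 u(1) by simp
    also have "\<dots> \<le> (1 - 4 * e + 2 * e * u) * 1"
      using e e4 u(1) nz by (intro mult_left_mono) auto
    also have "\<dots> \<le> 1 - 2 * e" using e u by simp
    finally show "cmod v \<le> 1 - 2 * e" .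
    have "v - b = of_real (- (2 * e * (1 - u))) * z"
      unfolding v b_def \<rho> by (simp add: algebra_simps)
    then have "cmod (v - b) = (2 * e * (1 - u)) * cmod z"
      using e u by (simp add: norm_mult del: of_real_minus of_real_mult)
    also have "\<dots> \<le> (2 * e * 1) * 1"
      using e u nz by (intro mult_mono) auto
    finally show "cmod (v - b) \<le> 2 * e" by simp
  qed
  have dv: "ennreal (cmod (deriv F v) powr s) \<le> ennreal (?c / e\<^sup>2) * ?Y" if v: "v \<in> closed_segment a b" for v
  proof -
    have sub: "w \<in> ball 0 (1 - e)" "w \<in> ball b (4 * e)" if "w \<in> ball v e" for w
    proof -
      have wv: "cmod (w - v) < e" using that by (simp add: dist_norm norm_minus_commute)
      show "w \<in> ball 0 (1 - e)"
        using norm_triangle_sub[of w v] seg(1)[OF v] wv by simp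
      have "cmod (w - b) \<le> cmod (w - v) + cmod (v - b)"
        using norm_triangle_ineq[of "w - v" "v - b"] by simp
      then show "w \<in> ball b (4 * e)"
        using seg(2)[OF v] wv e by (simp add: dist_norm norm_minus_commute)
    qed
    have disc: "w \<in> disc" if "w \<in> ball v e" for w using sub(1)[OF that] e by simp
    have "ennreal (cmod (deriv F v) powr s) \<le> ennreal (?c / e\<^sup>2) * powr_int s (deriv F) (ball v e)"
      using e disc by (intro powr_submean s holomorphic_on_subset[OF hd]) auto
    also have "\<dots> \<le> ennreal (?c / e\<^sup>2) * ?Y"
      using sub disc by (intro mult_left_mono nn_integral_mono) (auto simp: indicator_def e b_def e_def[symmetric])
    finally show ?thesis .
  qed
  show ?thesis
  proof (cases "?Y = \<infinity>")
    case True
    then show ?thesis using c by (simp add: ennreal_mult_top)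
  next
    case False
    define Y where "Y = enn2real ?Y"
    have Y: "?Y = ennreal Y" "0 \<le> Y"
      using False by (auto simp: Y_def less_top)
    define B where "B = (?c / e\<^sup>2 * Y) powr (1 / s)"
    have "cmod (deriv F v) \<le> B" if v: "v \<in> closed_segment a b" for v
    proof -
      have "ennreal (cmod (deriv F v) powr s) \<le> ennreal (?c / e\<^sup>2 * Y)"
        using dv[OF v] unfolding Y(1) using c Y(2) by (subst ennreal_mult) auto
      then have "cmod (deriv F v) powr s \<le> ?c / e\<^sup>2 * Y"
        using c Y by (subst (asm) ennreal_le_iff) auto
      then have "(cmod (deriv F v) powr s) powr (1 / s) \<le> B"
        unfolding B_def using s by (intro powr_mono2) auto
      then show ?thesis using s by (simp add: powr_powr)
    qed
    then have "cmod (F b - F a) \<le> B * cmod (b - a)"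
      using seg(1) e
      by (intro field_differentiable_bound[of "closed_segment a b" F "deriv F"])
         (auto intro!: holomorphic_derivI[OF F] dest!: seg(1))
    also have "\<dots> \<le> B * (2 * e)"
      using seg(2)[of a] by (intro mult_left_mono) (auto simp: B_def norm_minus_commute)
    finally have "cmod (F b - F a) powr s \<le> (B * (2 * e)) powr s"
      using s by (intro powr_mono2) auto
    also have "\<dots> = ?c / e\<^sup>2 * Y * (2 * e) powr s"
      using s e c Y by (simp add: powr_mult powr_powr B_def)
    also have "\<dots> \<le> ?c / e\<^sup>2 * Y * (2 powr (- s)) ^ j"
    proof -
      have "(2 * e) powr s \<le> (1 / 2 ^ j) powr s"
        unfolding e using e s by (intro powr_mono2) auto
      also have "\<dots> = (2 powr (- real j)) powr s"
        by (simp add: powr_minus powr_realpow divide_inverse)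
      also have "\<dots> = (2 powr (- s)) powr real j"
        by (simp only: powr_powr) (simp add: mult.commute)
      also have "\<dots> = (2 powr (- s)) ^ j"
        by (simp add: powr_realpow)
      finally show ?thesis using c Y by (intro mult_left_mono) auto
    qed
    also have "?c / e\<^sup>2 * Y * (2 powr (- s)) ^ j = 16 * ?c * (4 ^ j * (2 powr (- s)) ^ j) * Y"
    proof -
      have "1 / e\<^sup>2 = 16 * 4 ^ j" by (simp add: e_def power_mult_distrib power2_eq_square flip: power_mult_distrib)
      then have "?c / e\<^sup>2 = ?c * (16 * 4 ^ j)" by (metis times_divide_eq_right mult.right_neutral)
      then show ?thesis by simp
    qed
    finally have "cmod (F b - F a) powr s \<le> 16 * ?c * (4 ^ j * (2 powr (- s)) ^ j) * Y"
      .
    then have "ennreal (cmod (F b - F a) powr s) \<le> ennreal (16 * ?c * (4 ^ j * (2 powr (- s)) ^ j) * Y)"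
      by (rule ennreal_leI)
    also have "\<dots> = ennreal (16 * ?c * (4 ^ j * (2 powr (- s)) ^ j)) * ?Y"
      unfolding Y using c Y by (intro ennreal_mult) auto
    finally show ?thesis by (simp add: a_def b_def)
  qed
qed


text \<open>Since \<open>\<rho> 0 = 0\<close> and \<open>F 0 = 0\<close>, the increments telescope
  to \<open>F\<close> at the dilated point; for \<open>s \<le> 1\<close> the power is subadditive,
  and continuity at \<open>z\<close> removes the dilation.\<close>

lemma cmod_powr_le_suminf_increments:
  fixes F :: "complex \<Rightarrow> complex"
  defines "\<rho> \<equiv> \<lambda>j::nat. 1 - 1 / 2 ^ j"
  assumes s: "0 < s" "s \<le> 1" and F: "F holomorphic_on disc" "F 0 = 0" and z: "z \<in> disc"
  shows "ennreal (cmod (F z) powr s)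
    \<le> (\<Sum>j. ennreal (cmod (F (of_real (\<rho> (Suc j)) * z) - F (of_real (\<rho> j) * z)) powr s))"
    (is "_ \<le> suminf ?D")
proof -
  have le: "ennreal (cmod (F (of_real (\<rho> J) * z)) powr s) \<le> suminf ?D" for J
  proof -
    have "F (of_real (\<rho> J) * z) = (\<Sum>j<J. F (of_real (\<rho> (Suc j)) * z) - F (of_real (\<rho> j) * z))"
      using F(2) by (subst sum_lessThan_telescope) (simp add: \<rho>_def)
    then have "cmod (F (of_real (\<rho> J) * z)) \<le> (\<Sum>j<J. cmod (F (of_real (\<rho> (Suc j)) * z) - F (of_real (\<rho> j) * z)))"
      by (metis norm_sum)
    then have "cmod (F (of_real (\<rho> J) * z)) powr s \<le> (\<Sum>j<J. cmod (F (of_real (\<rho> (Suc j)) * z) - F (of_real (\<rho> j) * z))) powr s"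
      using s by (intro powr_mono2) auto
    also have "\<dots> \<le> (\<Sum>j<J. cmod (F (of_real (\<rho> (Suc j)) * z) - F (of_real (\<rho> j) * z)) powr s)"
      using s by (intro powr_sum_le_sum_powr) auto
    finally have "ennreal (cmod (F (of_real (\<rho> J) * z)) powr s) \<le> (\<Sum>j<J. ?D j)"
      by (simp add: sum_ennreal ennreal_leI)
    also have "\<dots> \<le> suminf ?D" by (rule sum_le_suminf) auto
    finally show ?thesis .
  qed
  have "(\<lambda>J. \<rho> J) \<longlonglongrightarrow> 1 - 0"
    unfolding \<rho>_def by (intro tendsto_diff tendsto_const) (simp add: LIMSEQ_divide_realpow_zero)
  then have "(\<lambda>J. of_real (\<rho> J) * z) \<longlonglongrightarrow> of_real (1 - 0) * z"
    by (intro tendsto_intros)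
  moreover have "isCont F z"
    using F z by (metis open_ball holomorphic_on_imp_continuous_on continuous_on_eq_continuous_at)
  ultimately have "(\<lambda>J. F (of_real (\<rho> J) * z)) \<longlonglongrightarrow> F z"
    using isCont_tendsto_compose[of z F] by simp
  then have "(\<lambda>J. ennreal (cmod (F (of_real (\<rho> J) * z)) powr s)) \<longlonglongrightarrow> ennreal (cmod (F z) powr s)"
    using s by (intro tendsto_ennrealI tendsto_powr' tendsto_norm tendsto_const) auto
  then show ?thesis by (rule LIMSEQ_le_const2) (use le in blast)
qed

text \<open>After the increments are summed and the integrals exchanged, a point \<open>w\<close> is
  met only by scales with \<open>2^(-j) < 4 * (1 - |w|)\<close>, and for each of them
  \<open>z\<close> ranges over a disc of area comparable to \<open>4^(-j)\<close>. This cancels the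
  \<open>4^j\<close> of the increment estimate; the remaining \<open>2^(-j * s)\<close> sum to a
  multiple of \<open>(1 - |w|)^s\<close>, the gain in weight.\<close>

lemma weighted_int_le_deriv_small:
  assumes s: "0 < s" "s \<le> 1" and a: "0 \<le> a"
  obtains C where "0 < C" "\<And>F. F holomorphic_on disc \<Longrightarrow> F 0 = 0 \<Longrightarrow>
     weighted_int a s F \<le> ennreal C * weighted_int (s + a) s (deriv F)"
proof -
  define t :: real where "t = 2 powr (- s)"
  have t: "0 < t" "t < 1" using s powr_less_cancel_iff[of 2 "-s" 0] by (auto simp: t_def)
  define K where "K = 16 * submean_const s"
  have K: "0 < K" using submean_const_pos[OF s(1)] by (simp add: K_def)
  define \<rho> where "\<rho> j = 1 - 1 / (2::real) ^ j" for j :: nat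
  \<comment> \<open>\<open>K\<close> comes from the increments, \<open>5 powr a * 4 * pi\<close>
    from the integral over \<open>z\<close>, and \<open>4 powr s / (1 - t)\<close> from the dyadic
    sum at \<open>x = 4 * (1 - |w|)\<close>.\<close>
  define C where "C = K * (5 powr a * 4 * pi) * (4 powr s / (1 - t))"
  have C: "0 < C" using K t by (simp add: C_def)
  have "weighted_int a s F \<le> ennreal C * weighted_int (s + a) s (deriv F)"
    if F: "F holomorphic_on disc" "F 0 = 0" for F
  proof -
    define f where "f w = (if w \<in> disc then deriv F w else 0)" for w
    have f [measurable]: "f \<in> borel_measurable borel"
      unfolding f_def by (intro borel_measurable_if_holomorphic holomorphic_deriv F) auto
    define \<kappa> where "\<kappa> j z w = ennreal (cmod (f w) powr s) * indicator (ball 0 (1 - 1 / (4 * 2 ^ j))) w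
           * indicator (ball (of_real (\<rho> (Suc j)) * z) (1 / 2 ^ j)) w" for j z w
    have [measurable]: "(\<lambda>(z, w). \<kappa> j z w) \<in> borel_measurable (lborel \<Otimes>\<^sub>M lborel)" for j
      unfolding \<kappa>_def by measurable
    define c where "c j = ennreal (K * (4 ^ j * t ^ j))" for j :: nat
    let ?D = "\<lambda>z. (ennreal ((1 - cmod z) powr a) * indicator disc z)"
    let ?I = "\<lambda>w j. ennreal (if 1 / 2 ^ j < 4 * (1 - cmod w) then 1 else 0)"
    let ?J = "\<lambda>w j. ennreal (if 1 / 2 ^ j < 4 * (1 - cmod w) then t ^ j else 0)"
    let ?V = "\<lambda>w. ennreal (cmod (f w) powr s * (1 - cmod w) powr a)"
    have pt: "weighted_density a s F z
       \<le> (\<Sum>j. \<integral>\<^sup>+w. c j * (\<kappa> j z w * ?D z) \<partial>lborel)" for z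
    proof (cases "z \<in> disc")
      case True
      have "ennreal (cmod (F z) powr s) \<le> (\<Sum>j. c j * (\<integral>\<^sup>+w. \<kappa> j z w \<partial>lborel))"
      proof (rule order_trans[OF cmod_powr_le_suminf_increments[OF s F True]], rule suminf_le)
        fix j
        show "ennreal (cmod (F (of_real (1 - 1 / 2 ^ Suc j) * z) - F (of_real (1 - 1 / 2 ^ j) * z)) powr s)
           \<le> c j * (\<integral>\<^sup>+w. \<kappa> j z w \<partial>lborel)"
          unfolding c_def \<kappa>_def f_def t_def K_def \<rho>_def by (rule dyadic_increment_le[OF s(1) F(1) True])
      qed auto
      then have "weighted_density a s F z
        \<le> (\<Sum>j. c j * (\<integral>\<^sup>+w. \<kappa> j z w \<partial>lborel)) * ?D z"
        using True by (simp add: ennreal_mult mult_right_mono)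
      also have "\<dots> = (\<Sum>j. c j * (\<integral>\<^sup>+w. \<kappa> j z w \<partial>lborel) * ?D z)"
        by (rule ennreal_suminf_multc[symmetric])
      also have "\<dots> = (\<Sum>j. \<integral>\<^sup>+w. c j * (\<kappa> j z w * ?D z) \<partial>lborel)"
        by (intro suminf_cong) (subst nn_integral_cmult, simp, subst nn_integral_multc, simp, simp add: mult.assoc)
      finally show ?thesis .
    qed simp
    have inner: "(\<integral>\<^sup>+z. \<kappa> j z w * ?D z \<partial>lborel)
       \<le> ennreal (5 powr a * 4 * pi / 4 ^ j) * (?V w * indicator disc w
             * ?I w j)" for j w
    proof (cases "w \<in> ball 0 (1 - 1 / (4 * 2 ^ j))")
      case True
      define e :: real where "e = 1 / 2 ^ j"
      have e: "0 < e" by (simp add: e_def)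
      have d: "e < 4 * (1 - cmod w)" using True by (simp add: e_def)
      have \<rho>: "1 / 2 \<le> \<rho> (Suc j)" "\<rho> (Suc j) \<le> 1" by (auto simp: \<rho>_def)
      \<comment> \<open>For fixed \<open>w\<close> the points \<open>z\<close> lie in the disc of
        radius \<open>e / r \<le> 2 * e\<close> around \<open>w / r\<close>, because
        \<open>r \<ge> 1 / 2\<close>; and \<open>1 - |z|\<close> is at most
        \<open>1 - |w| + e\<close>, hence at most \<open>5 * (1 - |w|)\<close>.\<close>
      define r where "r = \<rho> (Suc j)"
      have bd: "\<kappa> j z w * ?D z
         \<le> ennreal (cmod (f w) powr s * (5 powr a * (1 - cmod w) powr a)) * indicator (ball (w / of_real r) (2 * e)) z" for z
      proof (cases "z \<in> disc \<and> w \<in> ball (of_real r * z) e")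
        case True
        then have zw: "cmod (of_real r * z - w) < e" and z: "cmod z < 1" by (auto simp: dist_norm)
        have "cmod w - cmod (of_real r * z) \<le> cmod (of_real r * z - w)"
          by (metis norm_minus_commute norm_triangle_ineq2)
        then have "cmod w - e < r * cmod z" using zw \<rho> by (simp add: norm_mult r_def)
        also have "r * cmod z \<le> 1 * cmod z" using \<rho> by (intro mult_right_mono) (auto simp: r_def)
        finally have "1 - cmod z \<le> 5 * (1 - cmod w)" using d by simp
        then have "(1 - cmod z) powr a \<le> (5 * (1 - cmod w)) powr a"
          using z a by (intro powr_mono2) auto
        also have "\<dots> = 5 powr a * (1 - cmod w) powr a"
          by (simp only: powr_mult)
        finally have le: "(1 - cmod z) powr a \<le> 5 powr a * (1 - cmod w) powr a" .
        have "w / of_real r - z = (w - of_real r * z) / of_real r"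
          using \<rho> by (simp add: r_def field_simps)
        then have "cmod (w / of_real r - z) = cmod (of_real r * z - w) / r"
          using \<rho> by (simp add: norm_divide norm_minus_commute r_def del: of_real_diff)
        also have "\<dots> < e / r" using zw \<rho> by (simp add: r_def divide_strict_right_mono)
        also have "\<dots> \<le> 2 * e" using \<rho> e by (simp add: r_def divide_simps)
        finally have "z \<in> ball (w / of_real r) (2 * e)" by (simp add: dist_norm)
        then show ?thesis using le z
          by (auto simp: \<kappa>_def indicator_def ennreal_mult[symmetric] intro!: ennreal_leI mult_left_mono)
      next
        case False
        then show ?thesis by (auto simp: \<kappa>_def e_def r_def)
      qed
      have "(\<integral>\<^sup>+z. \<kappa> j z w * ?D z \<partial>lborel)
         \<le> ennreal (cmod (f w) powr s * (5 powr a * (1 - cmod w) powr a)) * ennreal (pi * (2 * e)\<^sup>2)"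
        using e by (intro order_trans[OF nn_integral_mono[OF bd]])
           (simp add: nn_integral_cmult_indicator emeasure_complex_ball)
      also have "\<dots> = ennreal (5 powr a * 4 * pi / 4 ^ j) * (?V w * indicator disc w
             * ?I w j)"
      proof -
        have "e\<^sup>2 = 1 / 4 ^ j" by (simp add: e_def power_divide flip: power_mult_distrib power2_eq_square) (simp add: power_mult power2_eq_square flip: power_mult_distrib)
        moreover have "w \<in> disc" using d e by simp
        ultimately show ?thesis using d
          by (simp add: e_def[symmetric] ennreal_mult[symmetric] power_mult_distrib mult_ac)
      qed
      finally show ?thesis .
    next
      case False
      then show ?thesis by (simp add: \<kappa>_def)
    qed
    have "weighted_int a s F \<le> (\<integral>\<^sup>+z. (\<Sum>j. \<integral>\<^sup>+w. c j * (\<kappa> j z w * ?D z) \<partial>lborel) \<partial>lborel)"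
      unfolding weighted_int_def by (intro nn_integral_mono pt)
    also have "\<dots> = (\<Sum>j. \<integral>\<^sup>+z. \<integral>\<^sup>+w. c j * (\<kappa> j z w * ?D z) \<partial>lborel \<partial>lborel)"
      by (intro nn_integral_suminf) measurable
    also have "\<dots> = (\<Sum>j. \<integral>\<^sup>+w. \<integral>\<^sup>+z. c j * (\<kappa> j z w * ?D z) \<partial>lborel \<partial>lborel)"
      by (intro suminf_cong lborel_pair.Fubini'[symmetric]) measurable
    also have "\<dots> = (\<Sum>j. \<integral>\<^sup>+w. c j * (\<integral>\<^sup>+z. \<kappa> j z w * ?D z \<partial>lborel) \<partial>lborel)"
      by (intro suminf_cong nn_integral_cong nn_integral_cmult) measurable
    also have "\<dots> \<le> (\<Sum>j. \<integral>\<^sup>+w. c j * (ennreal (5 powr a * 4 * pi / 4 ^ j) * (?V w * indicator disc w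
             * ?I w j)) \<partial>lborel)"
      by (intro suminf_le nn_integral_mono mult_left_mono inner) auto
    also have "\<dots> = (\<Sum>j. \<integral>\<^sup>+w. ennreal (K * (5 powr a * 4 * pi)) * (?V w * indicator disc w)
             * ?J w j \<partial>lborel)"
    proof (intro suminf_cong nn_integral_cong)
      fix j :: nat and w :: complex
      have 1: "c j * ennreal (5 powr a * 4 * pi / 4 ^ j) = ennreal (K * (5 powr a * 4 * pi)) * ennreal (t ^ j)"
        unfolding c_def using K t by (simp add: ennreal_mult[symmetric] mult_ac)
      have 2: "ennreal (t ^ j) * ?I w j
         = ?J w j" by simp
      have "c j * (ennreal (5 powr a * 4 * pi / 4 ^ j) * (?V w * indicator disc w
             * ?I w j))
        = (c j * ennreal (5 powr a * 4 * pi / 4 ^ j)) * (?V w * indicator disc w)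
             * ?I w j"
        by (simp only: mult.assoc)
      also have "\<dots> = ennreal (K * (5 powr a * 4 * pi)) * (?V w * indicator disc w)
             * (ennreal (t ^ j) * ?I w j)"
        unfolding 1 by (simp only: mult_ac)
      finally show "c j * (ennreal (5 powr a * 4 * pi / 4 ^ j) * (?V w * indicator disc w
             * ?I w j))
         = ennreal (K * (5 powr a * 4 * pi)) * (?V w * indicator disc w)
             * ?J w j" unfolding 2 .
    qed
    also have "\<dots> = (\<integral>\<^sup>+w. (\<Sum>j. ennreal (K * (5 powr a * 4 * pi)) * (?V w * indicator disc w)
             * ?J w j) \<partial>lborel)"
      by (intro nn_integral_suminf[symmetric]) measurable
    also have "\<dots> \<le> (\<integral>\<^sup>+w. ennreal C * (weighted_density (s + a) s f w) \<partial>lborel)"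
    proof (intro nn_integral_mono)
      fix w :: complex
      show "(\<Sum>j. ennreal (K * (5 powr a * 4 * pi)) * (?V w * indicator disc w)
             * ?J w j)
         \<le> ennreal C * (weighted_density (s + a) s f w)"
      proof (cases "w \<in> disc")
        case True
        let ?A = "K * (5 powr a * 4 * pi) * (cmod (f w) powr s * (1 - cmod w) powr a)"
        have A: "0 \<le> ?A" using K by simp
        have "(\<Sum>j. ennreal (K * (5 powr a * 4 * pi)) * (?V w * indicator disc w)
             * ?J w j)
           = ennreal ?A * (\<Sum>j. ?J w j)"
          using K True by (subst ennreal_suminf_cmult[symmetric]) (simp add: ennreal_mult)
        also have "\<dots> \<le> ennreal ?A * ennreal ((4 * (1 - cmod w)) powr s / (1 - t))"
          unfolding t_def using True s by (intro mult_left_mono suminf_dyadic_le) auto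
        also have "\<dots> = ennreal (?A * ((4 * (1 - cmod w)) powr s / (1 - t)))"
          using A t by (intro ennreal_mult[symmetric]) auto
        also have "?A * ((4 * (1 - cmod w)) powr s / (1 - t)) = C * (cmod (f w) powr s * (1 - cmod w) powr (s + a))"
          unfolding C_def powr_mult[of 4 "1 - cmod w"] powr_add by simp
        also have "ennreal \<dots> = ennreal C * (weighted_density (s + a) s f w)"
          using True C by (simp add: ennreal_mult)
        finally show ?thesis .
      qed simp
    qed
    also have "\<dots> = ennreal C * (\<integral>\<^sup>+w. weighted_density (s + a) s f w \<partial>lborel)"
      by (intro nn_integral_cmult) measurable
    also have "(\<integral>\<^sup>+w. weighted_density (s + a) s f w \<partial>lborel) = weighted_int (s + a) s (deriv F)"
      unfolding weighted_int_def by (intro nn_integral_cong) (auto simp: f_def indicator_def)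
    finally show ?thesis .
  qed
  then show ?thesis using C by (intro that[of C])
qed


text \<open>Change of variable \<open>z \<mapsto> r * z\<close>: the Jacobian costs
  \<open>1 / r^2 \<le> 4\<close>, and the weight only increases because \<open>r * z\<close> is
  further from the circle and \<open>b \<ge> 0\<close>.\<close>

lemma weighted_int_dilate_le:
  assumes f: "f holomorphic_on disc" and b: "0 \<le> b" and r: "1 / 2 \<le> r" "r \<le> 1"
  shows "weighted_int b q (\<lambda>z. f (of_real r * z)) \<le> 4 * weighted_int b q f"
proof -
  define F where "F z = (if z \<in> disc then f z else 0)" for z
  have F [measurable]: "F \<in> borel_measurable borel"
    unfolding F_def by (intro borel_measurable_if_holomorphic f) auto
  define h where "h z = weighted_density b q F z" for z
  have h [measurable]: "h \<in> borel_measurable borel" unfolding h_def by measurable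
  have sq: "1 \<le> 4 * r\<^sup>2"
    using power_mono[of "1/2" r 2] r by (simp add: power2_eq_square)
  have "weighted_int b q (\<lambda>z. f (of_real r * z)) \<le> (\<integral>\<^sup>+z. h (of_real r * z) \<partial>lborel)"
    unfolding weighted_int_def
  proof (intro nn_integral_mono)
    fix z :: complex
    show "weighted_density b q (\<lambda>z. f (of_real r * z)) z \<le> h (of_real r * z)"
    proof (cases "z \<in> disc")
      case True
      have "r * cmod z \<le> 1 * cmod z" using r by (intro mult_right_mono) auto
      then have rz: "cmod (of_real r * z) \<le> cmod z" using r by (simp add: norm_mult)
      then have "(1 - cmod z) powr b \<le> (1 - cmod (of_real r * z)) powr b"
        using True b by (intro powr_mono2) auto
      then show ?thesis using True rz
        by (auto simp: h_def F_def indicator_def intro!: ennreal_leI mult_left_mono)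
    qed simp
  qed
  also have "\<dots> = 1 * (\<integral>\<^sup>+z. h (of_real r * z) \<partial>lborel)" by simp
  also have "\<dots> \<le> ennreal (4 * r\<^sup>2) * (\<integral>\<^sup>+z. h (of_real r * z) \<partial>lborel)"
    using sq by (intro mult_right_mono) auto
  also have "\<dots> = 4 * (ennreal (r\<^sup>2) * (\<integral>\<^sup>+z. h (of_real r * z) \<partial>lborel))"
    by (simp add: ennreal_mult mult.assoc)
  also have "ennreal (r\<^sup>2) * (\<integral>\<^sup>+z. h (of_real r * z) \<partial>lborel) = (\<integral>\<^sup>+z. h z \<partial>lborel)"
    using r by (intro nn_integral_complex_scale) auto
  also have "(\<integral>\<^sup>+z. h z \<partial>lborel) = weighted_int b q f"
    unfolding weighted_int_def by (intro nn_integral_cong) (auto simp: h_def F_def indicator_def)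
  finally show ?thesis .
qed

lemma weighted_int_bounded_finite:
  assumes a: "0 \<le> a" and B: "\<And>z. z \<in> disc \<Longrightarrow> cmod (f z) \<le> B" and q: "0 < q"
  shows "weighted_int a q f < \<infinity>"
proof -
  have B0: "0 \<le> B" using B[of 0] norm_ge_zero[of "f 0"] by (simp del: norm_ge_zero)
  have "cmod (f z) powr q * (1 - cmod z) powr a \<le> B powr q" if z: "z \<in> disc" for z
    using mult_mono[of "cmod (f z) powr q" "B powr q" "(1 - cmod z) powr a" 1] z B[OF z] a q
    by (simp add: powr_mono2 powr_le1)
  then have "weighted_int a q f \<le> ennreal (B powr q * pi)"
    using weighted_int_le_split[of 0 "B powr q" "\<lambda>_. 0" f q a q 0] by simp
  then show ?thesis using le_less_trans by fastforce
qed

text \<open>Young's inequality without sharp constants: according to whether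
  \<open>y \<le> \<eta> * x\<close>, one of the two terms alone dominates the product.\<close>

lemma young_powr:
  fixes x y s q \<eta> :: real
  assumes x: "0 \<le> x" and y: "0 \<le> y" and s: "0 < s" "s \<le> q" and \<eta>: "0 < \<eta>"
  shows "x powr (q - s) * y powr s \<le> \<eta> powr s * x powr q + \<eta> powr (s - q) * y powr q"
proof (cases "y \<le> \<eta> * x")
  case True
  have "x powr (q - s) * y powr s \<le> x powr (q - s) * (\<eta> * x) powr s"
    using True y s by (intro mult_left_mono powr_mono2) auto
  also have "\<dots> = \<eta> powr s * x powr q"
    using x \<eta> s by (cases "x = 0") (auto simp: powr_mult powr_add[symmetric])
  finally show ?thesis by (simp add: add_increasing2)
next
  case False
  then have "x \<le> y / \<eta>" using \<eta> by (simp add: field_simps)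
  then have "x powr (q - s) * y powr s \<le> (y / \<eta>) powr (q - s) * y powr s"
    using x s by (intro mult_right_mono powr_mono2) auto
  also have "\<dots> = \<eta> powr (s - q) * y powr q"
  proof -
    have "(y / \<eta>) powr (q - s) = \<eta> powr (s - q) * y powr (q - s)"
      using y \<eta> by (simp add: powr_divide powr_minus_divide[symmetric] powr_diff)
    moreover have "y powr (q - s) * y powr s = y powr q" using y s by (cases "y = 0") (auto simp: powr_add[symmetric])
    ultimately show ?thesis by simp
  qed
  finally show ?thesis by (simp add: add_increasing)
qed

text \<open>For a large integer \<open>N\<close> the case \<open>q / N \<le> 1\<close> applies to \<open>F ^ N\<close>. Its derivative contains the factor
  \<open>F ^ (N - 1)\<close>, which Young's inequality moves into a term that is absorbed on the left.\<close>

lemma weighted_int_le_deriv_bounded: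
  assumes q: "0 < q" and a: "0 \<le> a"
  obtains C where "0 < C" "\<And>F. F holomorphic_on disc \<Longrightarrow> F 0 = 0 \<Longrightarrow> weighted_int a q F < \<infinity> \<Longrightarrow>
     weighted_int a q F \<le> ennreal C * weighted_int (q + a) q (deriv F)"
proof -
  \<comment> \<open>\<open>Suc\<close> ensures \<open>N \<ge> 2\<close>, so that
    \<open>F ^ (N - 1)\<close> still vanishes where \<open>F\<close> does and
    \<open>s \<le> q\<close> holds; the rounding gives \<open>q / N \<le> 1\<close>.\<close>
  define N where "N = Suc (nat \<lceil>q\<rceil>)"
  define s where "s = q / real N"
  have N: "0 < N" "q \<le> real N" by (auto simp: N_def) linarith
  have s: "0 < s" "s \<le> 1" using N q by (auto simp: s_def)
  have Ns: "real N * s = q" using N by (simp add: s_def)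
  have "0 < \<lceil>q\<rceil>" using q by simp
  then have N2: "2 \<le> N" by (simp add: N_def Suc_le_eq)
  have sq: "s \<le> q" using q N2 by (simp add: s_def divide_le_eq)
  obtain C0 where C0: "0 < C0" "\<And>F. F holomorphic_on disc \<Longrightarrow> F 0 = 0 \<Longrightarrow>
     weighted_int a s F \<le> ennreal C0 * weighted_int (s + a) s (deriv F)"
    by (rule weighted_int_le_deriv_small[OF s a]) blast
  define A where "A = C0 * real N powr s"
  have A: "0 < A" using C0 N by (simp add: A_def)
  \<comment> \<open>Chosen so that \<open>A * \<eta> powr s = 1 / 2\<close>: the term to be absorbed
    appears with coefficient one half.\<close>
  define \<eta> where "\<eta> = (1 / (2 * A)) powr (1 / s)"
  have \<eta>: "0 < \<eta>" "\<eta> powr s = 1 / (2 * A)" using A s by (auto simp: \<eta>_def powr_powr)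
  define K where "K = A * \<eta> powr (s - q)"
  have K: "0 < K" using A \<eta> by (simp add: K_def)
  have "weighted_int a q F \<le> ennreal (2 * K) * weighted_int (q + a) q (deriv F)"
    if F: "F holomorphic_on disc" "F 0 = 0" and fin: "weighted_int a q F < \<infinity>" for F
  proof -
    define H where "H z = F z ^ N" for z
    let ?A = "\<lambda>z. ennreal (cmod (F z) powr q * (1 - cmod z) powr a)"
    let ?B = "\<lambda>z. ennreal (cmod (deriv F z) powr q * (1 - cmod z) powr (q + a))"
    have H: "H holomorphic_on disc" "H 0 = 0" using F N holomorphic_on_power[OF F(1), of N] by (auto simp: H_def[abs_def])
    have hd: "deriv F holomorphic_on disc" by (intro holomorphic_deriv F) auto
    have dH: "deriv H z = of_nat N * F z ^ (N - 1) * deriv F z" if "z \<in> disc" for z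
    proof -
      have "(F has_field_derivative deriv F z) (at z)"
        using holomorphic_derivI[OF F(1) _ that] by simp
      then have "(H has_field_derivative of_nat N * (F z ^ (N - 1) * deriv F z)) (at z)"
        unfolding H_def by (auto intro!: derivative_eq_intros)
      then show ?thesis by (simp add: DERIV_imp_deriv mult.assoc)
    qed
    have "weighted_int a q F = weighted_int a s H"
      unfolding weighted_int_def
    proof (intro nn_integral_cong)
      fix z
      have "cmod (H z) powr s = cmod (F z) powr q"
        using N s Ns by (cases "F z = 0") (auto simp: H_def norm_power powr_powr simp flip: powr_realpow)
      then show "?A z * indicator disc z
         = weighted_density a s H z" by simp
    qed
    also have "\<dots> \<le> ennreal C0 * weighted_int (s + a) s (deriv H)"
      by (rule C0(2)[OF H])
    also have "\<dots> = (\<integral>\<^sup>+z. ennreal C0 * (weighted_density (s + a) s (deriv H) z) \<partial>lborel)"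
      unfolding weighted_int_def using measurable_weighted_integrand[OF holomorphic_deriv[OF H(1)], of s "s + a"]
      by (subst nn_integral_cmult) auto
    also have "\<dots> \<le> (\<integral>\<^sup>+z. ennreal (1 / 2) * (?A z * indicator disc z)
         + ennreal K * (?B z * indicator disc z) \<partial>lborel)"
    proof (intro nn_integral_mono)
      fix z
      show "ennreal C0 * (weighted_density (s + a) s (deriv H) z)
        \<le> ennreal (1 / 2) * (?A z * indicator disc z)
         + ennreal K * (?B z * indicator disc z)"
      proof (cases "z \<in> disc")
        case True
        define d where "d = 1 - cmod z"
        have d: "0 < d" using True by (simp add: d_def)
        define x y where "x = cmod (F z)" and "y = cmod (deriv F z)"
        have xy: "0 \<le> x" "0 \<le> y" by (auto simp: x_def y_def)
        have x: "(x ^ (N - 1)) powr s = x powr (q - s)"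
        proof (cases "x = 0")
          case False
          then have "(x ^ (N - 1)) powr s = x powr (real (N - 1) * s)"
            using xy by (simp add: powr_powr flip: powr_realpow)
          also have "real (N - 1) * s = q - s"
            using N Ns by (simp add: of_nat_diff algebra_simps)
          finally show ?thesis .
        qed (use N2 in \<open>auto simp: power_0_left\<close>)
        have "C0 * (cmod (deriv H z) powr s * d powr (s + a)) = A * (x powr (q - s) * (y * d) powr s) * d powr a"
          using True by (simp add: dH norm_mult norm_power x_def[symmetric] y_def[symmetric] powr_mult x[unfolded One_nat_def] A_def powr_add)
        also have "\<dots> \<le> A * (\<eta> powr s * x powr q + \<eta> powr (s - q) * (y * d) powr q) * d powr a"
          using xy d s sq \<eta> A by (intro mult_right_mono mult_left_mono young_powr) auto
        also have "\<dots> = 1 / 2 * (x powr q * d powr a) + K * (y powr q * d powr (q + a))"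
          using A unfolding \<eta>(2) by (simp add: K_def powr_mult powr_add algebra_simps)
        finally have le: "C0 * (cmod (deriv H z) powr s * d powr (s + a)) \<le> 1 / 2 * (x powr q * d powr a) + K * (y powr q * d powr (q + a))" .
        have "ennreal C0 * ennreal (cmod (deriv H z) powr s * d powr (s + a)) = ennreal (C0 * (cmod (deriv H z) powr s * d powr (s + a)))"
          using C0(1) by (intro ennreal_mult[symmetric]) auto
        also have "\<dots> \<le> ennreal (1 / 2 * (x powr q * d powr a) + K * (y powr q * d powr (q + a)))"
          by (rule ennreal_leI[OF le])
        also have "\<dots> = ennreal (1 / 2 * (x powr q * d powr a)) + ennreal (K * (y powr q * d powr (q + a)))"
          using K by (intro ennreal_plus) auto
        also have "\<dots> = ennreal (1 / 2) * ennreal (x powr q * d powr a) + ennreal K * ennreal (y powr q * d powr (q + a))"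
          using K by (intro arg_cong2[of _ _ _ _ plus] ennreal_mult) auto
        finally show ?thesis using True by (simp add: d_def x_def y_def)
      qed simp
    qed
    also have "\<dots> = ennreal (1 / 2) * weighted_int a q F + ennreal K * weighted_int (q + a) q (deriv F)"
    proof -
      have [measurable]: "(\<lambda>z. ?A z * indicator disc z) \<in> borel_measurable borel"
        "(\<lambda>z. ?B z * indicator disc z) \<in> borel_measurable borel"
        by (intro measurable_weighted_integrand F hd)+
      show ?thesis unfolding weighted_int_def by (simp add: nn_integral_add nn_integral_cmult)
    qed
    finally have le: "weighted_int a q F \<le> ennreal (1 / 2) * weighted_int a q F + ennreal K * weighted_int (q + a) q (deriv F)" .
    show ?thesis
    proof (cases "weighted_int (q + a) q (deriv F) = \<infinity>")
      case True
      then show ?thesis using K by (simp add: ennreal_mult_top)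
    next
      case False
      then obtain Y where Y: "weighted_int (q + a) q (deriv F) = ennreal Y" "0 \<le> Y"
        by (metis ennreal_cases infinity_ennreal_def)
      \<comment> \<open>Finiteness of the left side is what permits subtracting \<open>X / 2\<close>
        from both sides.\<close>
      obtain X where X: "weighted_int a q F = ennreal X" "0 \<le> X"
        using fin by (metis ennreal_cases infinity_ennreal_def less_irrefl)
      have "ennreal X \<le> ennreal (1 / 2 * X + K * Y)"
      proof -
        have "ennreal (1 / 2) * ennreal X = ennreal (1 / 2 * X)" "ennreal K * ennreal Y = ennreal (K * Y)"
          using X(2) Y(2) K by (intro ennreal_mult[symmetric]; simp)+
        moreover have "ennreal (1 / 2 * X) + ennreal (K * Y) = ennreal (1 / 2 * X + K * Y)"
          using X(2) Y(2) K by (intro ennreal_plus[symmetric]) auto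
        ultimately show ?thesis using le unfolding X(1) Y(1) by metis
      qed
      then have "X \<le> 1 / 2 * X + K * Y"
        using X(2) Y(2) K by (subst (asm) ennreal_le_iff) auto
      then have "X \<le> 2 * K * Y" by simp
      then have "ennreal X \<le> ennreal (2 * K * Y)" by (rule ennreal_leI)
      also have "\<dots> = ennreal (2 * K) * ennreal Y" using Y(2) K by (intro ennreal_mult) auto
      finally show ?thesis unfolding X(1) Y(1) .
    qed
  qed
  then show ?thesis using K by (intro that[of "2 * K"]) auto
qed

text \<open>The finiteness assumption is removed by dilation: each \<open>F (\<rho> j * z)\<close>
  is bounded on the disc, the resulting bound does not depend on \<open>j\<close>, and Fatou's lemma
  passes to the limit.\<close>

lemma weighted_int_le_deriv:
  assumes q: "0 < q" and a: "0 \<le> a"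
  obtains C where "0 < C" "\<And>F. F holomorphic_on disc \<Longrightarrow> F 0 = 0 \<Longrightarrow>
     weighted_int a q F \<le> ennreal C * weighted_int (q + a) q (deriv F)"
proof -
  obtain C where C: "0 < C" "\<And>F. F holomorphic_on disc \<Longrightarrow> F 0 = 0 \<Longrightarrow> weighted_int a q F < \<infinity> \<Longrightarrow>
     weighted_int a q F \<le> ennreal C * weighted_int (q + a) q (deriv F)"
    by (rule weighted_int_le_deriv_bounded[OF q a]) blast
  have "weighted_int a q F \<le> ennreal (4 * C) * weighted_int (q + a) q (deriv F)"
    if F: "F holomorphic_on disc" "F 0 = 0" for F
  proof -
    \<comment> \<open>\<open>Suc j\<close> makes the dilations start at \<open>1 / 2\<close>, the
      least factor for which the loss under dilation is controlled by 4.\<close>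
    define \<rho> where "\<rho> j = 1 - 1 / (2::real) ^ Suc j" for j :: nat
    have \<rho>: "1 / 2 \<le> \<rho> j" "\<rho> j < 1" for j by (auto simp: \<rho>_def)
    have sub: "cmod (of_real (\<rho> j) * z) < 1" if "cmod z \<le> 1" for j z
    proof -
      have "\<rho> j * cmod z \<le> \<rho> j * 1" using \<rho>[of j] that by (intro mult_left_mono) auto
      then have "\<rho> j * cmod z < 1" using \<rho>(2)[of j] by linarith
      then show ?thesis using \<rho>[of j] by (simp add: norm_mult)
    qed
    define G where "G j z = F (of_real (\<rho> j) * z)" for j z
    have contG: "continuous_on (cball 0 1) (G j)" for j
      unfolding G_def using sub
      by (intro continuous_on_compose2[OF holomorphic_on_imp_continuous_on[OF F(1)]] continuous_intros) auto
    have holG: "G j holomorphic_on disc" for j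
      unfolding G_def using sub
      by (intro holomorphic_on_compose_gen[OF _ F(1), unfolded o_def] holomorphic_intros) auto
    have le: "weighted_int a q (G j) \<le> ennreal (4 * C) * weighted_int (q + a) q (deriv F)" for j
    proof -
      have "bounded (G j ` cball 0 1)"
        by (intro compact_imp_bounded compact_continuous_image contG) auto
      then obtain B where B: "\<And>z. z \<in> cball 0 1 \<Longrightarrow> cmod (G j z) \<le> B"
        unfolding bounded_iff by (metis imageI)
      have "weighted_int a q (G j) < \<infinity>"
        using B by (intro weighted_int_bounded_finite[OF a _ q, of _ B]) auto
      moreover have "G j 0 = 0" using F by (simp add: G_def)
      ultimately have "weighted_int a q (G j) \<le> ennreal C * weighted_int (q + a) q (deriv (G j))"
        using C(2)[OF holG] by blast
      also have "weighted_int (q + a) q (deriv (G j)) \<le> weighted_int (q + a) q (\<lambda>z. deriv F (of_real (\<rho> j) * z))"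
      proof (rule weighted_int_mono)
        fix z assume z: "z \<in> disc"
        have "(F has_field_derivative deriv F (of_real (\<rho> j) * z)) (at (of_real (\<rho> j) * z))"
          using sub[of z j] z by (intro holomorphic_derivI[OF F(1)]) auto
        then have "((\<lambda>z. F (of_real (\<rho> j) * z)) has_field_derivative deriv F (of_real (\<rho> j) * z) * of_real (\<rho> j)) (at z)"
          by (rule DERIV_chain2) (auto intro!: derivative_eq_intros)
        then have "deriv (G j) z = deriv F (of_real (\<rho> j) * z) * of_real (\<rho> j)"
          unfolding G_def by (rule DERIV_imp_deriv)
        moreover have "cmod (deriv F (of_real (\<rho> j) * z)) * \<rho> j \<le> cmod (deriv F (of_real (\<rho> j) * z)) * 1"
          using \<rho>[of j] by (intro mult_left_mono) auto
        ultimately have "cmod (deriv (G j) z) \<le> cmod (deriv F (of_real (\<rho> j) * z))"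
          using \<rho>[of j] by (simp add: norm_mult)
        then show "cmod (deriv (G j) z) powr q * (1 - cmod z) powr (q + a)
          \<le> cmod (deriv F (of_real (\<rho> j) * z)) powr q * (1 - cmod z) powr (q + a)"
          using q by (intro mult_right_mono powr_mono2) auto
      qed
      also have "\<dots> \<le> 4 * weighted_int (q + a) q (deriv F)"
        using q a \<rho>[of j] by (intro weighted_int_dilate_le holomorphic_deriv F) auto
      also have "ennreal C * (4 * weighted_int (q + a) q (deriv F)) = ennreal (4 * C) * weighted_int (q + a) q (deriv F)"
        using C by (simp add: ennreal_mult mult_ac)
      finally show ?thesis by (simp add: mult_left_mono)
    qed
    define u where "u j z = weighted_density a q (G j) z" for j z
    have [measurable]: "u j \<in> borel_measurable borel" for j
      unfolding u_def by (intro measurable_weighted_integrand holG)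
    have lim: "(\<lambda>j. u j z) \<longlonglongrightarrow> weighted_density a q F z" for z
    proof (cases "z \<in> disc")
      case True
      have "(\<lambda>j. 1 / (2::real) ^ Suc j) \<longlonglongrightarrow> 0"
        by (intro LIMSEQ_Suc) (simp add: LIMSEQ_divide_realpow_zero)
      then have "\<rho> \<longlonglongrightarrow> 1 - 0"
        unfolding \<rho>_def[abs_def] by (intro tendsto_diff tendsto_const)
      then have "(\<lambda>j. of_real (\<rho> j) * z) \<longlonglongrightarrow> of_real (1 - 0) * z"
        by (intro tendsto_intros)
      moreover have "isCont F z"
        using F True by (metis open_ball holomorphic_on_imp_continuous_on continuous_on_eq_continuous_at)
      ultimately have "(\<lambda>j. G j z) \<longlonglongrightarrow> F z"
        unfolding G_def using isCont_tendsto_compose[of z F] by simp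
      then have "(\<lambda>j. ennreal (cmod (G j z) powr q * (1 - cmod z) powr a)) \<longlonglongrightarrow> ennreal (cmod (F z) powr q * (1 - cmod z) powr a)"
        using q by (intro tendsto_ennrealI tendsto_mult tendsto_powr' tendsto_norm tendsto_const) auto
      then show ?thesis using True by (simp add: u_def)
    qed (simp add: u_def)
    have "weighted_int a q F = (\<integral>\<^sup>+z. liminf (\<lambda>j. u j z) \<partial>lborel)"
      unfolding weighted_int_def by (intro nn_integral_cong) (simp add: lim_imp_Liminf[OF _ lim])
    also have "\<dots> \<le> liminf (\<lambda>j. \<integral>\<^sup>+z. u j z \<partial>lborel)"
      by (intro nn_integral_liminf) measurable
    also have "\<dots> = liminf (\<lambda>j. weighted_int a q (G j))"
      by (simp add: u_def weighted_int_def)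
    also have "\<dots> \<le> liminf (\<lambda>j::nat. ennreal (4 * C) * weighted_int (q + a) q (deriv F))"
      by (intro Liminf_mono always_eventually allI le)
    also have "\<dots> = ennreal (4 * C) * weighted_int (q + a) q (deriv F)"
      by (simp add: Liminf_const)
    finally show ?thesis .
  qed
  then show ?thesis using C by (intro that[of "4 * C"]) auto
qed

section \<open>Iterated integration\<close>

text \<open>On the convex disc \<open>f\<close> has a primitive \<open>g\<close>, and the integral
  along the segment from 0 to \<open>z\<close> is \<open>g z - g 0\<close>; all three claims
  follow.\<close>

lemma integ_op_disc:
  assumes f: "f holomorphic_on disc"
  shows holomorphic_integ_op: "integ_op f holomorphic_on disc"
    and deriv_integ_op: "z \<in> disc \<Longrightarrow> deriv (integ_op f) z = f z"
    and integ_op_0: "integ_op f 0 = 0"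
proof -
  obtain g where g: "\<And>x. x \<in> disc \<Longrightarrow> (g has_field_derivative f x) (at x within disc)"
    using holomorphic_convex_primitive'[OF _ _ f] by auto
  have eq: "integ_op f z = g z - g 0" if "z \<in> disc" for z
  proof -
    have "closed_segment 0 z \<subseteq> disc"
      using that by (intro closed_segment_subset) auto
    then have "(f has_contour_integral (g (pathfinish (linepath 0 z)) - g (pathstart (linepath 0 z)))) (linepath 0 z)"
      by (intro contour_integral_primitive[OF g]) auto
    then show ?thesis by (simp add: integ_op_def contour_integral_unique)
  qed
  have der: "(integ_op f has_field_derivative f z) (at z)" if z: "z \<in> disc" for z
  proof -
    have "((\<lambda>z. g z - g 0) has_field_derivative f z) (at z)"
      using g[OF z] z by (auto intro!: derivative_eq_intros simp: at_within_open[OF z])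
    then show ?thesis
      by (rule has_field_derivative_transform_within_open[where S = disc]) (use z eq in auto)
  qed
  show "integ_op f holomorphic_on disc"
    using der by (intro derivative_intros holomorphic_onI) (meson field_differentiable_at_within field_differentiable_def)
  show "deriv (integ_op f) z = f z" if "z \<in> disc"
    using der[OF that] by (rule DERIV_imp_deriv)
  show "integ_op f 0 = 0" using eq[of 0] by simp
qed

lemma holomorphic_integ_op_funpow:
  "f holomorphic_on disc \<Longrightarrow> (integ_op ^^ n) f holomorphic_on disc"
  by (induction n) (auto intro: holomorphic_integ_op)

lemma higher_deriv_integ_op_funpow:
  assumes f: "f holomorphic_on disc" and z: "z \<in> disc"
  shows "(deriv ^^ n) ((integ_op ^^ n) f) z = f z"
  using z
proof (induction n arbitrary: z)
  case (Suc n)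
  let ?G = "(integ_op ^^ n) f"
  have G: "?G holomorphic_on disc" by (rule holomorphic_integ_op_funpow[OF f])
  have "(deriv ^^ n) (deriv (integ_op ?G)) z = (deriv ^^ n) ?G z"
    by (rule higher_deriv_transform_within_open[where S = disc])
       (use G Suc.prems in \<open>auto intro: holomorphic_deriv holomorphic_integ_op deriv_integ_op\<close>)
  then show ?case using Suc by (simp add: funpow_swap1)
qed simp

lemma weighted_int_integ_op_funpow_le:
  assumes q: "0 < q"
  obtains C where "0 < C" "\<And>f. f holomorphic_on disc \<Longrightarrow>
     weighted_int 0 q ((integ_op ^^ n) f) \<le> ennreal C * weighted_int (real n * q) q f"
proof -
  \<comment> \<open>The weight \<open>a\<close> is generalised because the outermost integration
    raises it to \<open>q + a\<close> before the induction hypothesis is applied to the inner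
    ones.\<close>
  have "\<exists>C>0. \<forall>f. f holomorphic_on disc \<longrightarrow>
     weighted_int a q ((integ_op ^^ n) f) \<le> ennreal C * weighted_int (real n * q + a) q f" if "0 \<le> a" for a
    using that
  proof (induction n arbitrary: a)
    case 0
    show ?case by (intro exI[of _ 1]) auto
  next
    case (Suc n)
    obtain C where C: "0 < C" "\<And>F. F holomorphic_on disc \<Longrightarrow> F 0 = 0 \<Longrightarrow>
       weighted_int a q F \<le> ennreal C * weighted_int (q + a) q (deriv F)"
      by (rule weighted_int_le_deriv[OF q Suc.prems]) blast
    obtain D where D: "0 < D" "\<And>f. f holomorphic_on disc \<Longrightarrow>
       weighted_int (q + a) q ((integ_op ^^ n) f) \<le> ennreal D * weighted_int (real n * q + (q + a)) q f"
      using Suc.IH[of "q + a"] Suc.prems q by auto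
    have "weighted_int a q ((integ_op ^^ Suc n) f) \<le> ennreal (C * D) * weighted_int (real (Suc n) * q + a) q f"
      if f: "f holomorphic_on disc" for f
    proof -
      let ?G = "(integ_op ^^ n) f"
      have G: "?G holomorphic_on disc" by (rule holomorphic_integ_op_funpow[OF f])
      have "weighted_int a q (integ_op ?G) \<le> ennreal C * weighted_int (q + a) q (deriv (integ_op ?G))"
        by (intro C holomorphic_integ_op integ_op_0 G)
      also have "weighted_int (q + a) q (deriv (integ_op ?G)) = weighted_int (q + a) q ?G"
        by (intro weighted_int_cong deriv_integ_op G)
      also have "ennreal C * \<dots> \<le> ennreal C * (ennreal D * weighted_int (real n * q + (q + a)) q f)"
        by (intro mult_left_mono D f) auto
      also have "\<dots> = ennreal (C * D) * weighted_int (real (Suc n) * q + a) q f"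
        using C D by (simp add: ennreal_mult mult.assoc algebra_simps)
      finally show ?thesis by simp
    qed
    then show ?case using C D by (intro exI[of _ "C * D"]) auto
  qed
  from this[of 0] show ?thesis using that by auto
qed

section \<open>Bergman norms and peaking functions\<close>


lemma bergman_int_eq: "bergman_int p f = weighted_int 0 p f / ennreal pi"
  unfolding bergman_int_def weighted_int_def
  by (intro arg_cong2[where f = "(/)"] nn_integral_cong) (auto simp: indicator_def)

lemma bergman_iff: "f \<in> bergman p \<longleftrightarrow> f holomorphic_on disc \<and> weighted_int 0 p f < \<infinity>"
  by (auto simp: bergman_def bergman_int_eq ennreal_divide_eq_top_iff simp flip: less_top)

lemma bergman_holomorphic: "f \<in> bergman p \<Longrightarrow> f holomorphic_on disc"
  by (simp add: bergman_def)

lemma bergman_norm_nonneg: "0 \<le> bergman_norm p f"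
  by (simp add: bergman_norm_def)

text \<open>The factor \<open>pi\<close> undoes the normalisation of the area measure; membership
  makes the integral finite, so \<open>enn2real\<close> loses nothing.\<close>

lemma weighted_int_eq_bergman_norm:
  assumes "0 < p" "f \<in> bergman p"
  shows "weighted_int 0 p f = ennreal (pi * bergman_norm p f powr p)"
proof -
  obtain M where M: "weighted_int 0 p f = ennreal M" "0 \<le> M"
    using assms by (metis bergman_iff ennreal_cases infinity_ennreal_def less_irrefl)
  then show ?thesis
    using assms by (simp add: bergman_norm_def bergman_int_eq divide_ennreal powr_powr)
qed

lemma bergman_norm_le:
  assumes "0 < p" "f holomorphic_on disc" "weighted_int 0 p f \<le> ennreal (pi * M powr p)" "0 \<le> M"
  shows "f \<in> bergman p" "bergman_norm p f \<le> M"
proof -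
  show f: "f \<in> bergman p"
    using assms by (auto simp: bergman_iff intro: le_less_trans)
  have "ennreal (pi * bergman_norm p f powr p) \<le> ennreal (pi * M powr p)"
    using weighted_int_eq_bergman_norm[OF assms(1) f] assms by simp
  then have "bergman_norm p f powr p \<le> M powr p"
    by (subst (asm) ennreal_le_iff) auto
  then have "(bergman_norm p f powr p) powr (1 / p) \<le> (M powr p) powr (1 / p)"
    by (rule powr_mono2[rotated 2]) (use assms in auto)
  then show "bergman_norm p f \<le> M"
    using assms bergman_norm_nonneg[of p f] by (simp add: powr_powr)
qed

text \<open>The growth estimate in norm form. It serves for \<open>k = 0\<close> in the normal
  families argument, for all \<open>k\<close> on the test functions in \<open>A^p\<close>, and for
  \<open>k = n\<close> on the images in \<open>A^q\<close>.\<close>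

lemma deriv_bergman_norm_le:
  assumes s: "0 < s"
  obtains C where "0 < C" "\<And>f z. f \<in> bergman s \<Longrightarrow> z \<in> disc \<Longrightarrow>
    cmod ((deriv ^^ k) f z) * (1 - cmod z) powr (real k + 2 / s) \<le> C * bergman_norm s f"
proof -
  obtain C where C: "0 < C" "\<And>f z. f holomorphic_on disc \<Longrightarrow> z \<in> disc \<Longrightarrow>
    ennreal (cmod ((deriv ^^ k) f z) powr s * (1 - cmod z) powr (real k * s + 2)) \<le> ennreal C * weighted_int 0 s f"
    by (rule deriv_pointwise_le[OF s, of k]) blast
  have "cmod ((deriv ^^ k) f z) * (1 - cmod z) powr (real k + 2 / s) \<le> (C * pi) powr (1 / s) * bergman_norm s f"
    if f: "f \<in> bergman s" and z: "z \<in> disc" for f z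
  proof -
    have "ennreal (cmod ((deriv ^^ k) f z) powr s * (1 - cmod z) powr (real k * s + 2))
       \<le> ennreal C * ennreal (pi * bergman_norm s f powr s)"
      using C(2)[OF bergman_holomorphic[OF f] z] weighted_int_eq_bergman_norm[OF s f] by simp
    also have "\<dots> = ennreal (C * (pi * bergman_norm s f powr s))"
      using C by (intro ennreal_mult[symmetric]) auto
    finally have "cmod ((deriv ^^ k) f z) powr s * (1 - cmod z) powr (real k * s + 2) \<le> C * (pi * bergman_norm s f powr s)"
      using C by (subst (asm) ennreal_le_iff) auto
    then have "(cmod ((deriv ^^ k) f z) powr s * (1 - cmod z) powr (real k * s + 2)) powr (1 / s)
       \<le> (C * pi * bergman_norm s f powr s) powr (1 / s)"
      using s by (intro powr_mono2) (auto simp: mult.assoc)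
    moreover have "(real k * s + 2) / s = real k + 2 / s"
      using s by (simp add: field_simps)
    ultimately show ?thesis
      using s bergman_norm_nonneg[of s f] by (simp add: powr_mult powr_powr)
  qed
  then show ?thesis using C by (intro that[of "(C * pi) powr (1 / s)"]) auto
qed

text \<open>A substitute for Minkowski's inequality that holds for exponents below 1 as well:
  compare with the larger of the two moduli.\<close>

lemma powr_diff_le:
  assumes "0 < p"
  shows "cmod (x - y) powr p \<le> 2 powr p * (cmod x powr p + cmod y powr p)"
proof -
  have "cmod (x - y) powr p \<le> (2 * max (cmod x) (cmod y)) powr p"
    using assms norm_triangle_ineq4[of x y] by (intro powr_mono2) auto
  also have "\<dots> = 2 powr p * max (cmod x) (cmod y) powr p"
    by (rule powr_mult)
  also have "max (cmod x) (cmod y) powr p \<le> cmod x powr p + cmod y powr p"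
    by (cases "cmod x \<le> cmod y") (auto simp: max_def)
  finally show ?thesis by (simp add: mult_left_mono)
qed

lemma weighted_int_diff_le:
  assumes p: "0 < p" and f: "f holomorphic_on disc" and g: "g holomorphic_on disc"
  shows "weighted_int a p (\<lambda>z. f z - g z) \<le> ennreal (2 powr p) * (weighted_int a p f + weighted_int a p g)"
proof -
  let ?A = "\<lambda>z. ennreal (cmod (f z) powr p * (1 - cmod z) powr a)"
  let ?B = "\<lambda>z. ennreal (cmod (g z) powr p * (1 - cmod z) powr a)"
  have [measurable]: "(\<lambda>z. ?A z * indicator disc z) \<in> borel_measurable borel"
    "(\<lambda>z. ?B z * indicator disc z) \<in> borel_measurable borel"
    by (intro measurable_weighted_integrand f g)+
  have "weighted_int a p (\<lambda>z. f z - g z) \<le> (\<integral>\<^sup>+z. ennreal (2 powr p) *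
      (?A z * indicator disc z
        + ?B z * indicator disc z) \<partial>lborel)"
    unfolding weighted_int_def
  proof (intro nn_integral_mono)
    fix z
    have "cmod (f z - g z) powr p * (1 - cmod z) powr a
      \<le> 2 powr p * (cmod (f z) powr p * (1 - cmod z) powr a + cmod (g z) powr p * (1 - cmod z) powr a)"
      using mult_right_mono[OF powr_diff_le[OF p, of "f z" "g z"], of "(1 - cmod z) powr a"]
      by (simp add: algebra_simps)
    then have "ennreal (cmod (f z - g z) powr p * (1 - cmod z) powr a)
      \<le> ennreal (2 powr p * (cmod (f z) powr p * (1 - cmod z) powr a + cmod (g z) powr p * (1 - cmod z) powr a))"
      by (rule ennreal_leI)
    also have "\<dots> = ennreal (2 powr p) * (?A z + ?B z)"
      by (subst ennreal_mult, simp, simp, subst ennreal_plus, auto)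
    finally show "weighted_density a p (\<lambda>z. f z - g z) z
      \<le> ennreal (2 powr p) * (?A z * indicator disc z
        + ?B z * indicator disc z)"
      by (cases "z \<in> disc") auto
  qed
  also have "\<dots> = ennreal (2 powr p) * (weighted_int a p f + weighted_int a p g)"
    unfolding weighted_int_def by (simp add: nn_integral_cmult nn_integral_add)
  finally show ?thesis .
qed

lemma bergman_diff:
  assumes p: "0 < p" and f: "f \<in> bergman p" and g: "g \<in> bergman p"
  shows "(\<lambda>z. f z - g z) \<in> bergman p"
proof -
  have "weighted_int 0 p f + weighted_int 0 p g < \<infinity>"
    using f g by (simp add: bergman_iff)
  then have "ennreal (2 powr p) * (weighted_int 0 p f + weighted_int 0 p g) < \<infinity>"
    by (simp only: infinity_ennreal_def ennreal_mult_less_top) simp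
  then have "weighted_int 0 p (\<lambda>z. f z - g z) < \<infinity>"
    using weighted_int_diff_le[OF p bergman_holomorphic[OF f] bergman_holomorphic[OF g]] le_less_trans by blast
  then show ?thesis
    using f g by (simp add: bergman_iff holomorphic_on_diff)
qed

section \<open>Kernel estimates and test functions\<close>

text \<open>The difference of the squared moduli is \<open>(1 - |a|^2) * (1 - |z|^2)\<close>; this
  is the statement that a disc automorphism has modulus at most 1.\<close>

lemma norm_diff_le_norm_one_minus_cnj_mult:
  assumes "cmod a \<le> 1" "cmod z \<le> 1"
  shows "cmod (z - a) \<le> cmod (1 - cnj a * z)"
proof -
  have "complex_of_real ((cmod (1 - cnj a * z))\<^sup>2 - (cmod (z - a))\<^sup>2) = complex_of_real ((1 - (cmod a)\<^sup>2) * (1 - (cmod z)\<^sup>2))"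
    by (simp add: complex_norm_square of_real_diff of_real_mult del: of_real_power) (simp add: algebra_simps)
  then have "(cmod (1 - cnj a * z))\<^sup>2 - (cmod (z - a))\<^sup>2 = (1 - (cmod a)\<^sup>2) * (1 - (cmod z)\<^sup>2)"
    by (simp only: of_real_eq_iff)
  also have "\<dots> \<ge> 0"
    using assms by (intro mult_nonneg_nonneg) (auto simp: power_le_one)
  finally show ?thesis
    using power2_le_imp_le[of "cmod (z - a)" "cmod (1 - cnj a * z)"] by simp
qed

lemma one_minus_norm_le_norm_one_minus_cnj_mult:
  assumes "cmod z \<le> 1"
  shows "1 - cmod a \<le> cmod (1 - cnj a * z)"
proof -
  have "1 - cmod (cnj a * z) \<le> cmod (1 - cnj a * z)"
    using norm_triangle_ineq2[of 1 "cnj a * z"] by simp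
  moreover have "cmod a * cmod z \<le> cmod a * 1"
    using assms by (intro mult_left_mono) auto
  ultimately show ?thesis by (simp add: norm_mult)
qed

lemma ex_dyadic:
  fixes d u :: real
  assumes "0 < d" "d \<le> u"
  obtains j :: nat where "2 ^ j * d \<le> u" "u < 2 ^ Suc j * d"
proof -
  obtain m where m: "u / d < 2 ^ m" using real_arch_pow[of 2 "u / d"] by auto
  define j where "j = (LEAST m. u / d < 2 ^ m)"
  have j: "u / d < 2 ^ j" unfolding j_def by (rule LeastI[of _ m]) (rule m)
  have "j \<noteq> 0"
  proof
    assume "j = 0" with j show False using assms by (simp add: field_simps)
  qed
  then obtain i where i: "j = Suc i" by (cases j) auto
  have "\<not> u / d < 2 ^ i"
    using i unfolding j_def by (metis lessI not_less_Least)
  then show ?thesis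
    using j assms unfolding i by (intro that[of i]) (auto simp: field_simps)
qed

text \<open>A Forelli--Rudin estimate: the discs \<open>|1 - cnj a * z| < 2^(j+1) * (1 - |a|)\<close> are centred at
  \<open>1 / cnj a\<close>, and their areas grow like \<open>4^j\<close>.\<close>

lemma nn_integral_kernel_le:
  assumes s: "4 \<le> s"
  obtains C where "0 < C" "\<And>a. a \<in> disc \<Longrightarrow>
    (\<integral>\<^sup>+z\<in>disc. ennreal (cmod (1 - cnj a * z) powr (- s)) \<partial>lborel) \<le> ennreal (C * (1 - cmod a) powr (2 - s))"
proof -
  define C where "C = 2 powr s * pi + 32 * pi"
  have C: "0 < C" unfolding C_def by (intro add_pos_pos mult_pos_pos) auto
  have "(\<integral>\<^sup>+z\<in>disc. ennreal (cmod (1 - cnj a * z) powr (- s)) \<partial>lborel) \<le> ennreal (C * (1 - cmod a) powr (2 - s))"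
    if a: "a \<in> disc" for a
  proof (cases "cmod a < 1 / 2")
    \<comment> \<open>Near \<open>a = 0\<close> the centre \<open>1 / cnj a\<close> is far away or
      undefined, but there the kernel is simply bounded by \<open>2 powr s\<close>.\<close>
    case True
    have "(\<integral>\<^sup>+z\<in>disc. ennreal (cmod (1 - cnj a * z) powr (- s)) \<partial>lborel)
       \<le> (\<integral>\<^sup>+z. ennreal (2 powr s) * indicator disc z \<partial>lborel)"
    proof (intro nn_integral_mono)
      fix z
      show "ennreal (cmod (1 - cnj a * z) powr (- s)) * indicator disc z \<le> ennreal (2 powr s) * indicator disc z"
      proof (cases "z \<in> disc")
        case z: True
        have "1 / 2 \<le> cmod (1 - cnj a * z)"
          using one_minus_norm_le_norm_one_minus_cnj_mult[of z a] True z by simp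
        then have "cmod (1 - cnj a * z) powr (- s) \<le> (1 / 2) powr (- s)"
          using s by (intro powr_mono2') auto
        also have "\<dots> = 2 powr s" by (simp add: powr_divide powr_minus)
        finally show ?thesis by (intro mult_right_mono ennreal_leI) auto
      qed simp
    qed
    also have "\<dots> = ennreal (2 powr s) * ennreal (pi * 1\<^sup>2)"
      by (subst nn_integral_cmult_indicator) (auto simp: emeasure_complex_ball)
    also have "\<dots> = ennreal (2 powr s * pi * 1)"
      by (simp add: ennreal_mult[symmetric])
    also have "\<dots> \<le> ennreal (C * (1 - cmod a) powr (2 - s))"
    proof (intro ennreal_leI mult_mono)
      have "1 powr (2 - s) \<le> (1 - cmod a) powr (2 - s)"
        using a s by (intro powr_mono2') auto
      then show "1 \<le> (1 - cmod a) powr (2 - s)" by simp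
    qed (auto simp: C_def)
    finally show ?thesis .
  next
    case False
    define d where "d = 1 - cmod a"
    have d: "0 < d" using a by (simp add: d_def)
    have a0: "a \<noteq> 0" using False by auto
    \<comment> \<open>The distance of \<open>z\<close> from \<open>1 / cnj a\<close> is
      \<open>|1 - cnj a * z| / |a|\<close>; since \<open>|a| \<ge> 1 / 2\<close>, doubling the
      dyadic radius suffices.\<close>
    let ?B = "\<lambda>j::nat. ball (1 / cnj a) (2 * (2 ^ Suc j * d))"
    have "(\<integral>\<^sup>+z\<in>disc. ennreal (cmod (1 - cnj a * z) powr (- s)) \<partial>lborel)
      \<le> (\<integral>\<^sup>+z. (\<Sum>j. ennreal ((2 ^ j * d) powr (- s)) * indicator (?B j) z) \<partial>lborel)"
    proof (intro nn_integral_mono)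
      fix z
      show "ennreal (cmod (1 - cnj a * z) powr (- s)) * indicator disc z
        \<le> (\<Sum>j. ennreal ((2 ^ j * d) powr (- s)) * indicator (?B j) z)"
      proof (cases "z \<in> disc")
        case z: True
        obtain j where j: "2 ^ j * d \<le> cmod (1 - cnj a * z)" "cmod (1 - cnj a * z) < 2 ^ Suc j * d"
          using ex_dyadic[OF d, of "cmod (1 - cnj a * z)"] one_minus_norm_le_norm_one_minus_cnj_mult[of z a] z
          unfolding d_def by auto
        have "1 / cnj a - z = (1 - cnj a * z) / cnj a" using a0 by (simp add: field_simps)
        then have "cmod (1 / cnj a - z) = cmod (1 - cnj a * z) / cmod a"
          by (simp add: norm_divide)
        also have "\<dots> \<le> cmod (1 - cnj a * z) / (1 / 2)"
          using False by (intro divide_left_mono) auto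
        also have "\<dots> < 2 * (2 ^ Suc j * d)" using j by (simp add: mult_ac)
        finally have zB: "z \<in> ?B j" by (simp add: dist_norm)
        have "cmod (1 - cnj a * z) powr (- s) \<le> (2 ^ j * d) powr (- s)"
          using j d s by (intro powr_mono2') auto
        then have "ennreal (cmod (1 - cnj a * z) powr (- s)) * indicator disc z
           \<le> (\<Sum>i\<in>{j}. ennreal ((2 ^ i * d) powr (- s)) * indicator (?B i) z)"
          using z zB by (simp add: ennreal_leI)
        also have "\<dots> \<le> (\<Sum>j. ennreal ((2 ^ j * d) powr (- s)) * indicator (?B j) z)"
          by (intro sum_le_suminf) auto
        finally show ?thesis .
      qed simp
    qed
    also have "\<dots> = (\<Sum>j. \<integral>\<^sup>+z. ennreal ((2 ^ j * d) powr (- s)) * indicator (?B j) z \<partial>lborel)"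
      by (intro nn_integral_suminf) measurable
    also have "\<dots> \<le> (\<Sum>j. ennreal (16 * pi * d powr (2 - s) * (1 / 2) ^ j))"
    proof (intro suminf_le)
      fix j :: nat
      have "(\<integral>\<^sup>+z. ennreal ((2 ^ j * d) powr (- s)) * indicator (?B j) z \<partial>lborel)
         = ennreal ((2 ^ j * d) powr (- s)) * ennreal (pi * (2 * (2 ^ Suc j * d))\<^sup>2)"
        using d by (subst nn_integral_cmult_indicator) (auto simp: emeasure_complex_ball)
      also have "\<dots> = ennreal ((2 ^ j * d) powr (- s) * (pi * (2 * (2 ^ Suc j * d))\<^sup>2))"
        by (intro ennreal_mult[symmetric]) auto
      also have "(2 ^ j * d) powr (- s) * (pi * (2 * (2 ^ Suc j * d))\<^sup>2)
          = 16 * pi * ((2 ^ j * d) powr (- s) * (2 ^ j * d) powr 2)"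
        using d by (simp add: power2_eq_square)
      also have "(2 ^ j * d) powr (- s) * (2 ^ j * d) powr 2 = (2 ^ j * d) powr (2 - s)"
        by (simp add: powr_add[symmetric] del: powr_numeral)
      also have "\<dots> = (2 ^ j) powr (2 - s) * d powr (2 - s)"
        by (rule powr_mult)
      also have "16 * pi * \<dots> \<le> 16 * pi * d powr (2 - s) * (1 / 2) ^ j"
      proof -
        \<comment> \<open>\<open>4 \<le> s\<close> puts \<open>2 - s\<close> below -1, so the decay
          of the kernel beats the growth of the areas and the series is dominated by a geometric one
          of ratio \<open>1 / 2\<close>.\<close>
        have "(2 ^ j :: real) powr (2 - s) \<le> (2 ^ j) powr (- 1)"
          using s by (intro powr_mono) auto
        also have "\<dots> = (1 / 2) ^ j" by (subst powr_minus) (simp add: power_one_over inverse_eq_divide)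
        finally have "(2 ^ j :: real) powr (2 - s) \<le> (1 / 2) ^ j" .
        then have "(2 ^ j) powr (2 - s) * (16 * pi * d powr (2 - s)) \<le> (1 / 2) ^ j * (16 * pi * d powr (2 - s))"
          by (intro mult_right_mono) auto
        then show ?thesis by (simp only: mult_ac)
      qed
      finally show "(\<integral>\<^sup>+z. ennreal ((2 ^ j * d) powr (- s)) * indicator (?B j) z \<partial>lborel)
          \<le> ennreal (16 * pi * d powr (2 - s) * (1 / 2) ^ j)"
        by (simp add: ennreal_leI)
    qed auto
    also have "\<dots> = ennreal (\<Sum>j. 16 * pi * d powr (2 - s) * (1 / 2) ^ j)"
      by (intro suminf_ennreal2 summable_mult summable_geometric) auto
    also have "(\<Sum>j. 16 * pi * d powr (2 - s) * (1 / 2) ^ j) = 32 * pi * d powr (2 - s)"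
      by (subst suminf_mult) (auto simp: suminf_geometric)
    also have "ennreal \<dots> \<le> ennreal (C * d powr (2 - s))"
      by (intro ennreal_leI mult_right_mono) (auto simp: C_def)
    finally show ?thesis by (simp add: d_def)
  qed
  then show ?thesis using C by (intro that[of C])
qed


text \<open>The peaking functions are \<open>c * (1 - |a|)^(N - 2/p) * (z - a)^k / (1 - cnj a * z)^(N + k)\<close> with
  \<open>N * p \<ge> 4\<close>.\<close>

lemma peaking_functions:
  fixes k :: nat
  assumes p: "0 < p"
  obtains T :: "complex \<Rightarrow> complex \<Rightarrow> complex" and c \<beta> B N where
    "0 < (c::real)" "0 < (\<beta>::real)"
    "\<And>a. a \<in> disc \<Longrightarrow> T a \<in> bergman p"
    "\<And>a. a \<in> disc \<Longrightarrow> bergman_norm p (T a) \<le> 1"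
    "\<And>a i. a \<in> disc \<Longrightarrow> i < k \<Longrightarrow> (deriv ^^ i) (T a) a = 0"
    "\<And>a. a \<in> disc \<Longrightarrow> c * (1 - cmod a) powr (- (real k + 2 / p)) \<le> cmod ((deriv ^^ k) (T a) a)"
    "\<And>a z. a \<in> disc \<Longrightarrow> z \<in> disc \<Longrightarrow> cmod (T a z) \<le> B * (1 - cmod a) powr \<beta> / (1 - cmod z) ^ N"
proof -
  \<comment> \<open>Large enough for the exponent \<open>s = N * p\<close> to be admissible in the
    kernel estimate.\<close>
  define N where "N = nat \<lceil>4 / p\<rceil>"
  define s where "s = real N * p"
  have "4 / p \<le> real N" unfolding N_def by (rule real_nat_ceiling_ge)
  then have s: "4 \<le> s" using p by (simp add: s_def field_simps)
  \<comment> \<open>\<open>\<beta> * p = s - 2\<close> compensates the power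
    \<open>(1 - |a|)^(2 - s)\<close> of the kernel integral, so the norms are bounded uniformly in
    \<open>a\<close>.\<close>
  define \<beta> where "\<beta> = real N - 2 / p"
  have \<beta>p: "\<beta> * p = s - 2" using p by (simp add: \<beta>_def s_def field_simps)
  then have "0 < \<beta> * p" using s by simp
  then have \<beta>: "0 < \<beta>" using p by (simp add: zero_less_mult_iff)
  obtain C where C: "0 < C" "\<And>a. a \<in> disc \<Longrightarrow>
    (\<integral>\<^sup>+z\<in>disc. ennreal (cmod (1 - cnj a * z) powr (- s)) \<partial>lborel) \<le> ennreal (C * (1 - cmod a) powr (2 - s))"
    by (rule nn_integral_kernel_le[OF s]) blast
  \<comment> \<open>\<open>c powr p = pi / C\<close> cancels the constant of the kernel estimate and
    makes the norm at most 1.\<close>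
  define c where "c = (pi / C) powr (1 / p)"
  have c: "0 < c" "c powr p = pi / C" using C p by (auto simp: c_def powr_powr)
  define \<gamma> where "\<gamma> a = c * (1 - cmod a) powr \<beta>" for a
  define h where "h a z = of_real (\<gamma> a) / (1 - cnj a * z) ^ (N + k)" for a z
  \<comment> \<open>The factor \<open>(z - a)^k / (1 - cnj a * z)^k\<close> has modulus at most 1:
    it creates the zero at \<open>a\<close> without spoiling the size estimate.\<close>
  define T where "T a z = (z - a) ^ k * h a z" for a z
  have nz: "1 - cnj a * z \<noteq> 0" if "a \<in> disc" "z \<in> disc" for a z
    using one_minus_norm_le_norm_one_minus_cnj_mult[of z a] that by auto
  have hh: "h a holomorphic_on disc" if "a \<in> disc" for a
    unfolding h_def using nz[OF that] by (intro holomorphic_intros) auto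
  have hT: "T a holomorphic_on disc" if "a \<in> disc" for a
    unfolding T_def using hh[OF that] by (intro holomorphic_intros)
  have \<gamma>0: "0 \<le> \<gamma> a" for a using c by (simp add: \<gamma>_def)
  have Tle: "cmod (T a z) \<le> \<gamma> a / cmod (1 - cnj a * z) ^ N" if a: "a \<in> disc" and z: "z \<in> disc" for a z
  proof -
    let ?u = "cmod (1 - cnj a * z)"
    have u: "0 < ?u" using nz[OF a z] by simp
    have "cmod (T a z) = cmod (z - a) ^ k * \<gamma> a / ?u ^ (N + k)"
      using \<gamma>0 by (simp add: T_def h_def norm_mult norm_power norm_divide)
    also have "\<dots> \<le> ?u ^ k * \<gamma> a / ?u ^ (N + k)"
      using \<gamma>0 a z by (intro divide_right_mono mult_right_mono power_mono norm_diff_le_norm_one_minus_cnj_mult) auto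
    also have "\<dots> = \<gamma> a / ?u ^ N"
      using u by (simp add: power_add)
    finally show ?thesis .
  qed
  have wT: "weighted_int 0 p (T a) \<le> ennreal (pi * 1 powr p)" if a: "a \<in> disc" for a
  proof -
    have d: "0 < 1 - cmod a" using a by simp
    have "weighted_int 0 p (T a) \<le> (\<integral>\<^sup>+z. ennreal (\<gamma> a powr p) * (ennreal (cmod (1 - cnj a * z) powr (- s)) * indicator disc z) \<partial>lborel)"
      unfolding weighted_int_def
    proof (intro nn_integral_mono)
      fix z
      show "weighted_density 0 p (T a) z
        \<le> ennreal (\<gamma> a powr p) * (ennreal (cmod (1 - cnj a * z) powr (- s)) * indicator disc z)"
      proof (cases "z \<in> disc")
        case z: True
        let ?u = "cmod (1 - cnj a * z)"
        have u: "0 < ?u" using nz[OF a z] by simp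
        have "cmod (T a z) powr p \<le> (\<gamma> a / ?u ^ N) powr p"
          using Tle[OF a z] p by (intro powr_mono2) auto
        also have "\<dots> = \<gamma> a powr p * ?u powr (- s)"
        proof -
          have "(?u ^ N) powr p = ?u powr s"
            using u by (simp add: s_def powr_powr flip: powr_realpow)
          then show ?thesis unfolding powr_divide by (simp add: powr_minus divide_inverse)
        qed
        finally have "ennreal (cmod (T a z) powr p) \<le> ennreal (\<gamma> a powr p * ?u powr (- s))"
          by (rule ennreal_leI)
        also have "\<dots> = ennreal (\<gamma> a powr p) * ennreal (?u powr (- s))"
          by (intro ennreal_mult) auto
        finally show ?thesis using z by simp
      qed simp
    qed
    also have "\<dots> = ennreal (\<gamma> a powr p) * (\<integral>\<^sup>+z\<in>disc. ennreal (cmod (1 - cnj a * z) powr (- s)) \<partial>lborel)"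
      by (intro nn_integral_cmult) measurable
    also have "\<dots> \<le> ennreal (\<gamma> a powr p) * ennreal (C * (1 - cmod a) powr (2 - s))"
      by (intro mult_left_mono C a) auto
    also have "\<dots> = ennreal (\<gamma> a powr p * (C * (1 - cmod a) powr (2 - s)))"
      using C by (intro ennreal_mult[symmetric]) auto
    also have "\<gamma> a powr p * (C * (1 - cmod a) powr (2 - s)) = pi * ((1 - cmod a) powr (s - 2) * (1 - cmod a) powr (2 - s))"
      using c C by (simp add: \<gamma>_def powr_mult powr_powr \<beta>p)
    also have "\<dots> = pi * 1 powr p"
      using d by (simp add: powr_add[symmetric])
    finally show ?thesis .
  qed
  have pow0: "(deriv ^^ m) (\<lambda>w. (w - a) ^ k) a = (if m = k then fact k else 0)" if "m \<le> k" for m and a :: complex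
    using that by (subst higher_deriv_power) (auto simp: pochhammer_fact)
  \<comment> \<open>In the Leibniz sum at \<open>a\<close> only the term that differentiates
    \<open>(w - a) ^ k\<close> exactly \<open>k\<close> times survives; it is absent for
    \<open>i < k\<close> and equals \<open>fact k * h a a\<close> for \<open>i = k\<close>.\<close>
  have dT: "(deriv ^^ i) (T a) a = (\<Sum>m = 0..i. of_nat (i choose m) * (deriv ^^ m) (\<lambda>w. (w - a) ^ k) a * (deriv ^^ (i - m)) (h a) a)"
    if "a \<in> disc" for a i
    unfolding T_def[abs_def] using that hh[OF that]
    by (intro higher_deriv_mult[where S = disc] holomorphic_intros) auto
  have T0: "(deriv ^^ i) (T a) a = 0" if "a \<in> disc" "i < k" for a i
    unfolding dT[OF that(1)] using that by (intro sum.neutral) (auto simp: pow0)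
  have Tk: "(deriv ^^ k) (T a) a = fact k * h a a" if "a \<in> disc" for a
  proof -
    have "(deriv ^^ k) (T a) a = (\<Sum>m = 0..k. if m = k then fact k * h a a else 0)"
      unfolding dT[OF that] by (intro sum.cong) (auto simp: pow0)
    then show ?thesis by simp
  qed
  have lower: "c / 2 ^ (N + k) * (1 - cmod a) powr (- (real k + 2 / p)) \<le> cmod ((deriv ^^ k) (T a) a)" if a: "a \<in> disc" for a
  proof -
    define d where "d = 1 - cmod a"
    have d: "0 < d" "d \<le> 1" using a by (auto simp: d_def)
    have "1 - cnj a * a = of_real (1 - (cmod a)\<^sup>2)"
      by (simp add: complex_norm_square[symmetric] mult.commute)
    also have "1 - (cmod a)\<^sup>2 = d * (1 + cmod a)"
      by (simp add: d_def power2_eq_square algebra_simps)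
    finally have "cmod (1 - cnj a * a) = d * (1 + cmod a)"
      using d by (simp only: norm_of_real) simp
    moreover have "d * (1 + cmod a) \<le> 2 * d" using mult_left_mono[of "1 + cmod a" 2 d] d a by (simp add: mult.commute)
    ultimately have u: "cmod (1 - cnj a * a) \<le> 2 * d" by simp
    have u0: "0 < cmod (1 - cnj a * a)" using nz[OF a a] by simp
    have "c / 2 ^ (N + k) * d powr (- (real k + 2 / p)) = c * d powr \<beta> / (2 * d) ^ (N + k)"
    proof -
      have "d powr (- (real k + 2 / p)) = d powr (\<beta> - real (N + k))"
        by (intro arg_cong2[of _ _ _ _ "(powr)"]) (auto simp: \<beta>_def)
      also have "\<dots> = d powr \<beta> / d ^ (N + k)" using d by (simp only: powr_diff powr_realpow)
      finally show ?thesis by (simp add: power_mult_distrib)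
    qed
    also have "\<dots> \<le> \<gamma> a / cmod (1 - cnj a * a) ^ (N + k)"
      unfolding \<gamma>_def d_def[symmetric] using u u0 c d by (intro divide_left_mono power_mono mult_pos_pos zero_less_power) auto
    also have "\<dots> = 1 * cmod (h a a)"
      using \<gamma>0 by (simp add: h_def norm_divide norm_power)
    also have "\<dots> \<le> fact k * cmod (h a a)"
      by (intro mult_right_mono) auto
    finally show ?thesis by (simp add: Tk[OF a] norm_mult d_def)
  qed
  \<comment> \<open>At fixed \<open>z\<close> this decays like \<open>(1 - |a|)^\<beta>\<close>, so
    \<open>T a\<close> tends to 0 locally uniformly as \<open>a\<close> approaches the circle;
    compactness is tested with this.\<close>
  have upper: "cmod (T a z) \<le> c * (1 - cmod a) powr \<beta> / (1 - cmod z) ^ N" if a: "a \<in> disc" and z: "z \<in> disc" for a z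
  proof -
    have "1 - cmod z \<le> cmod (1 - cnj a * z)"
      using one_minus_norm_le_norm_one_minus_cnj_mult[of "cnj a" "cnj z"] a by (simp add: mult.commute)
    then have "\<gamma> a / cmod (1 - cnj a * z) ^ N \<le> \<gamma> a / (1 - cmod z) ^ N"
      using \<gamma>0 z nz[OF a z] by (intro divide_left_mono power_mono mult_pos_pos) auto
    then show ?thesis using Tle[OF a z] by (simp add: \<gamma>_def)
  qed
  show ?thesis
  proof (rule that[of "c / 2 ^ (N + k)" \<beta> T c N])
    show "T a \<in> bergman p" "bergman_norm p (T a) \<le> 1" if "a \<in> disc" for a
      using bergman_norm_le[OF p hT[OF that] wT[OF that]] by auto
  qed (use c \<beta> T0 lower upper in auto)
qed

section \<open>The operator and the recovery of its symbols\<close>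

definition Ig_integrand :: "nat \<Rightarrow> (nat \<Rightarrow> complex \<Rightarrow> complex) \<Rightarrow> (complex \<Rightarrow> complex) \<Rightarrow> complex \<Rightarrow> complex" where
  "Ig_integrand n g f z = (\<Sum>k<n. (deriv ^^ k) f z * g k z)"

lemma Ig_eq: "Ig n g f = (integ_op ^^ n) (Ig_integrand n g f)"
  by (simp add: Ig_def Ig_integrand_def[abs_def])

lemma holomorphic_Ig_integrand:
  assumes "\<forall>k<n. g k holomorphic_on disc" "f holomorphic_on disc"
  shows "Ig_integrand n g f holomorphic_on disc"
  unfolding Ig_integrand_def[abs_def] using assms
  by (intro holomorphic_on_sum holomorphic_on_mult holomorphic_higher_deriv) auto

lemma holomorphic_Ig:
  assumes "\<forall>k<n. g k holomorphic_on disc" "f holomorphic_on disc"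
  shows "Ig n g f holomorphic_on disc"
  unfolding Ig_eq by (intro holomorphic_integ_op_funpow holomorphic_Ig_integrand assms)

lemma higher_deriv_Ig:
  assumes "\<forall>k<n. g k holomorphic_on disc" "f holomorphic_on disc" "z \<in> disc"
  shows "(deriv ^^ n) (Ig n g f) z = Ig_integrand n g f z"
  unfolding Ig_eq by (intro higher_deriv_integ_op_funpow holomorphic_Ig_integrand assms)

text \<open>For \<open>k < n\<close> this is \<open>(n + 2/q) - (k + 2/p)\<close>, the growth
  exponent of \<open>n\<close>-th derivatives in \<open>A^q\<close> minus that of
  \<open>k\<close>-th derivatives in \<open>A^p\<close>. It may be negative.\<close>

definition symbol_exp :: "nat \<Rightarrow> real \<Rightarrow> real \<Rightarrow> nat \<Rightarrow> real" where
  "symbol_exp n p q k = real (n - k) - 2 / p + 2 / q"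

text \<open>Testing on functions that vanish to order \<open>k\<close> at \<open>a\<close> isolates \<open>g k\<close> up to the terms with larger
  index, so the conditions on the \<open>g k\<close> follow by downward induction on \<open>k\<close>.\<close>

lemma symbol_recovery:
  fixes k n :: nat
  assumes p: "0 < p" and k: "k < n"
  obtains T :: "complex \<Rightarrow> complex \<Rightarrow> complex" and c \<beta> B N D where
    "0 < (c::real)" "0 < (\<beta>::real)"
    "\<And>a. a \<in> disc \<Longrightarrow> T a \<in> bergman p"
    "\<And>a. a \<in> disc \<Longrightarrow> bergman_norm p (T a) \<le> 1"
    "\<And>a z. a \<in> disc \<Longrightarrow> z \<in> disc \<Longrightarrow> cmod (T a z) \<le> B * (1 - cmod a) powr \<beta> / (1 - cmod z) ^ N"
    "\<And>g q a. a \<in> disc \<Longrightarrow> c * (cmod (g k a) * (1 - cmod a) powr symbol_exp n p q k)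
       \<le> cmod (Ig_integrand n g (T a) a) * (1 - cmod a) powr (real n + 2 / q)
         + (\<Sum>i\<in>{k<..<n}. D i * (cmod (g i a) * (1 - cmod a) powr symbol_exp n p q i))"
proof -
  obtain T :: "complex \<Rightarrow> complex \<Rightarrow> complex" and c \<beta> B N where
    c: "0 < (c::real)" "0 < (\<beta>::real)" and
    T: "\<And>a. a \<in> disc \<Longrightarrow> T a \<in> bergman p"
    "\<And>a. a \<in> disc \<Longrightarrow> bergman_norm p (T a) \<le> 1"
    "\<And>a i. a \<in> disc \<Longrightarrow> i < k \<Longrightarrow> (deriv ^^ i) (T a) a = 0"
    "\<And>a. a \<in> disc \<Longrightarrow> c * (1 - cmod a) powr (- (real k + 2 / p)) \<le> cmod ((deriv ^^ k) (T a) a)"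
    "\<And>a z. a \<in> disc \<Longrightarrow> z \<in> disc \<Longrightarrow> cmod (T a z) \<le> B * (1 - cmod a) powr \<beta> / (1 - cmod z) ^ N"
    by (rule peaking_functions[OF p, of k]) blast
  have "\<exists>D. 0 < D \<and> (\<forall>f z. f \<in> bergman p \<longrightarrow> z \<in> disc \<longrightarrow>
    cmod ((deriv ^^ i) f z) * (1 - cmod z) powr (real i + 2 / p) \<le> D * bergman_norm p f)" for i
    by (rule deriv_bergman_norm_le[OF p, of i]) blast
  then obtain D where D: "\<And>i. 0 < D i" "\<And>i f z. f \<in> bergman p \<Longrightarrow> z \<in> disc \<Longrightarrow>
    cmod ((deriv ^^ i) f z) * (1 - cmod z) powr (real i + 2 / p) \<le> D i * bergman_norm p f"
    by metis
  \<comment> \<open>\<open>T\<close>, \<open>c\<close> and \<open>D\<close> are fixed before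
    \<open>g\<close> and \<open>q\<close>: they come from the growth in \<open>A^p\<close>
    alone.\<close>
  have "c * (cmod (g k a) * (1 - cmod a) powr symbol_exp n p q k)
       \<le> cmod (Ig_integrand n g (T a) a) * (1 - cmod a) powr (real n + 2 / q)
         + (\<Sum>i\<in>{k<..<n}. D i * (cmod (g i a) * (1 - cmod a) powr symbol_exp n p q i))"
    if a: "a \<in> disc" for g :: "nat \<Rightarrow> complex \<Rightarrow> complex" and q a
  proof -
    define d where "d = 1 - cmod a"
    have d: "0 < d" using a by (simp add: d_def)
    define w where "w = d powr (real n + 2 / q)"
    have w: "0 < w" using d by (simp add: w_def)
    have ex: "d powr symbol_exp n p q i = d powr (- (real i + 2 / p)) * w" if "i < n" for i
      using that d by (simp add: w_def symbol_exp_def of_nat_diff flip: powr_add) (simp add: algebra_simps)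
    have up: "cmod ((deriv ^^ i) (T a) a) \<le> D i * d powr (- (real i + 2 / p))" for i
    proof -
      have "cmod ((deriv ^^ i) (T a) a) * d powr (real i + 2 / p) \<le> D i * bergman_norm p (T a)"
        unfolding d_def by (rule D(2)[OF T(1)[OF a] a])
      also have "\<dots> \<le> D i * 1" using D(1)[of i] T(2)[OF a] by (intro mult_left_mono) auto
      finally have "cmod ((deriv ^^ i) (T a) a) * d powr (real i + 2 / p) * d powr (- (real i + 2 / p)) \<le> D i * 1 * d powr (- (real i + 2 / p))"
        by (rule mult_right_mono) simp
      moreover have "d powr (real i + 2 / p) * d powr (- (real i + 2 / p)) = 1"
        using d by (subst powr_add[symmetric]) simp
      ultimately show ?thesis by (simp only: mult.assoc mult_1_right)
    qed
    \<comment> \<open>Indices below \<open>k\<close> drop out by the zero of \<open>T a\<close> at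
      \<open>a\<close>; those above \<open>k\<close> are moved to the other side and estimated by
      the growth of derivatives in the unit ball.\<close>
    have split: "{..<n} = insert k {k<..<n} \<union> {..<k}" using k by auto
    have "Ig_integrand n g (T a) a = (\<Sum>i\<in>insert k {k<..<n}. (deriv ^^ i) (T a) a * g i a) + (\<Sum>i<k. (deriv ^^ i) (T a) a * g i a)"
      unfolding Ig_integrand_def split by (rule sum.union_disjoint) auto
    also have "(\<Sum>i<k. (deriv ^^ i) (T a) a * g i a) = 0"
      using T(3)[OF a] by (intro sum.neutral) auto
    finally have "(deriv ^^ k) (T a) a * g k a = Ig_integrand n g (T a) a - (\<Sum>i\<in>{k<..<n}. (deriv ^^ i) (T a) a * g i a)"
      by simp
    then have "cmod ((deriv ^^ k) (T a) a * g k a) \<le> cmod (Ig_integrand n g (T a) a) + cmod (\<Sum>i\<in>{k<..<n}. (deriv ^^ i) (T a) a * g i a)"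
      by (metis norm_triangle_ineq4)
    also have "cmod (\<Sum>i\<in>{k<..<n}. (deriv ^^ i) (T a) a * g i a) \<le> (\<Sum>i\<in>{k<..<n}. cmod ((deriv ^^ i) (T a) a) * cmod (g i a))"
      by (rule order_trans[OF norm_sum]) (simp add: norm_mult)
    also have "\<dots> \<le> (\<Sum>i\<in>{k<..<n}. D i * d powr (- (real i + 2 / p)) * cmod (g i a))"
      by (intro sum_mono mult_right_mono up) auto
    finally have le: "cmod ((deriv ^^ k) (T a) a) * cmod (g k a)
        \<le> cmod (Ig_integrand n g (T a) a) + (\<Sum>i\<in>{k<..<n}. D i * d powr (- (real i + 2 / p)) * cmod (g i a))"
      by (simp add: norm_mult)
    have "c * d powr (- (real k + 2 / p)) * cmod (g k a) \<le> cmod ((deriv ^^ k) (T a) a) * cmod (g k a)"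
      using T(4)[OF a] by (intro mult_right_mono) (auto simp: d_def)
    also note le
    finally have "(c * d powr (- (real k + 2 / p)) * cmod (g k a)) * w
       \<le> (cmod (Ig_integrand n g (T a) a) + (\<Sum>i\<in>{k<..<n}. D i * d powr (- (real i + 2 / p)) * cmod (g i a))) * w"
      using w by (intro mult_right_mono) auto
    also have "\<dots> = cmod (Ig_integrand n g (T a) a) * w + (\<Sum>i\<in>{k<..<n}. D i * (cmod (g i a) * d powr symbol_exp n p q i))"
    proof -
      have "(\<Sum>i\<in>{k<..<n}. D i * d powr (- (real i + 2 / p)) * cmod (g i a)) * w
          = (\<Sum>i\<in>{k<..<n}. D i * (cmod (g i a) * d powr symbol_exp n p q i))"
        unfolding sum_distrib_right by (intro sum.cong) (auto simp: ex mult_ac)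
      then show ?thesis by (simp only: distrib_right)
    qed
    finally show ?thesis using ex[OF k] by (simp add: d_def[symmetric] w_def mult_ac)
  qed
  then show ?thesis by (intro that[of c \<beta> T B N D] c T)
qed

section \<open>Boundedness\<close>


text \<open>Comparison with the largest term, which works for every positive exponent.\<close>

lemma powr_norm_sum_le:
  fixes x :: "nat \<Rightarrow> complex"
  assumes q: "0 < q"
  shows "cmod (\<Sum>k<n. x k) powr q \<le> real n powr q * (\<Sum>k<n. cmod (x k) powr q)"
proof (cases "n = 0")
  case False
  define M where "M = Max ((\<lambda>k. cmod (x k)) ` {..<n})"
  have le: "cmod (x k) \<le> M" if "k < n" for k
    unfolding M_def using that by (intro Max_ge) auto
  have "M \<in> (\<lambda>k. cmod (x k)) ` {..<n}"
    unfolding M_def using False by (intro Max_in) auto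
  then obtain m where m: "m < n" "M = cmod (x m)" by auto
  have "cmod (\<Sum>k<n. x k) \<le> (\<Sum>k<n. cmod (x k))" by (rule norm_sum)
  also have "\<dots> \<le> (\<Sum>k<n. M)" using le by (intro sum_mono) auto
  finally have "cmod (\<Sum>k<n. x k) powr q \<le> (real n * M) powr q"
    using q by (intro powr_mono2) auto
  also have "\<dots> = real n powr q * M powr q" by (rule powr_mult)
  also have "M powr q \<le> (\<Sum>k<n. cmod (x k) powr q)"
    unfolding m(2) using m(1) by (intro member_le_sum[of m "{..<n}" "\<lambda>k. cmod (x k) powr q"]) auto
  finally show ?thesis by (simp add: mult_left_mono)
qed simp

lemma weighted_int_Ig_le:
  assumes q: "0 < q"
  obtains C where "0 < C" "\<And>g f. \<forall>k<n. g k holomorphic_on disc \<Longrightarrow> f holomorphic_on disc \<Longrightarrow>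
     weighted_int 0 q (Ig n g f) \<le> ennreal C * (\<Sum>k<n. weighted_int (real n * q) q (\<lambda>z. (deriv ^^ k) f z * g k z))"
proof -
  obtain C where C: "0 < C" "\<And>f. f holomorphic_on disc \<Longrightarrow>
     weighted_int 0 q ((integ_op ^^ n) f) \<le> ennreal C * weighted_int (real n * q) q f"
    by (rule weighted_int_integ_op_funpow_le[OF q, of n]) blast
  \<comment> \<open>\<open>real n powr q\<close> is 0 for \<open>n = 0\<close>; the added 1 keeps
    the constant positive.\<close>
  have "weighted_int 0 q (Ig n g f) \<le> ennreal (C * (real n powr q + 1)) * (\<Sum>k<n. weighted_int (real n * q) q (\<lambda>z. (deriv ^^ k) f z * g k z))"
    if g: "\<forall>k<n. g k holomorphic_on disc" and f: "f holomorphic_on disc" for g f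
  proof -
    define u where "u k z = (deriv ^^ k) f z * g k z" for k z
    let ?A = "\<lambda>k z. weighted_density (real n * q) q (u k) z"
    have hu: "u k holomorphic_on disc" if "k < n" for k
      unfolding u_def[abs_def] using g f that by (intro holomorphic_on_mult holomorphic_higher_deriv) auto
    have meas: "(\<lambda>z. ?A k z) \<in> borel_measurable lborel" if "k < n" for k
      using measurable_weighted_integrand[OF hu[OF that]] by simp
    have "weighted_int (real n * q) q (Ig_integrand n g f)
      \<le> (\<integral>\<^sup>+z. ennreal (real n powr q) * (\<Sum>k<n. ?A k z) \<partial>lborel)"
      unfolding weighted_int_def
    proof (intro nn_integral_mono)
      fix z
      show "weighted_density (real n * q) q (Ig_integrand n g f) z
        \<le> ennreal (real n powr q) * (\<Sum>k<n. ?A k z)"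
      proof (cases "z \<in> disc")
        case True
        have "cmod (Ig_integrand n g f z) powr q * (1 - cmod z) powr (real n * q)
            \<le> (real n powr q * (\<Sum>k<n. cmod (u k z) powr q)) * (1 - cmod z) powr (real n * q)"
          unfolding Ig_integrand_def u_def by (intro mult_right_mono powr_norm_sum_le q) auto
        also have "\<dots> = real n powr q * (\<Sum>k<n. cmod (u k z) powr q * (1 - cmod z) powr (real n * q))"
          by (simp add: sum_distrib_right)
        finally have "ennreal (cmod (Ig_integrand n g f z) powr q * (1 - cmod z) powr (real n * q))
            \<le> ennreal (real n powr q * (\<Sum>k<n. cmod (u k z) powr q * (1 - cmod z) powr (real n * q)))"
          by (rule ennreal_leI)
        also have "\<dots> = ennreal (real n powr q) * ennreal (\<Sum>k<n. cmod (u k z) powr q * (1 - cmod z) powr (real n * q))"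
          by (intro ennreal_mult sum_nonneg) auto
        finally show ?thesis using True by (simp add: sum_ennreal)
      qed simp
    qed
    also have "\<dots> = ennreal (real n powr q) * (\<integral>\<^sup>+z. (\<Sum>k<n. ?A k z) \<partial>lborel)"
      by (intro nn_integral_cmult borel_measurable_sum meas) auto
    also have "(\<integral>\<^sup>+z. (\<Sum>k<n. ?A k z) \<partial>lborel)
       = (\<Sum>k<n. weighted_int (real n * q) q (u k))"
      unfolding weighted_int_def by (intro nn_integral_sum meas) auto
    finally have "weighted_int (real n * q) q (Ig_integrand n g f) \<le> ennreal (real n powr q) * (\<Sum>k<n. weighted_int (real n * q) q (u k))" .
    also have "\<dots> \<le> ennreal (real n powr q + 1) * (\<Sum>k<n. weighted_int (real n * q) q (u k))"
      by (intro mult_right_mono ennreal_leI) auto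
    finally have "weighted_int 0 q (Ig n g f) \<le> ennreal C * (ennreal (real n powr q + 1) * (\<Sum>k<n. weighted_int (real n * q) q (u k)))"
      unfolding Ig_eq by (intro order_trans[OF C(2)] holomorphic_Ig_integrand g f mult_left_mono) auto
    also have "\<dots> = ennreal (C * (real n powr q + 1)) * (\<Sum>k<n. weighted_int (real n * q) q (u k))"
      using C by (subst ennreal_mult) (auto simp: mult.assoc)
    finally show ?thesis by (simp add: u_def[abs_def])
  qed
  then show ?thesis using C by (intro that[of "C * (real n powr q + 1)"]) (auto intro!: mult_pos_pos add_nonneg_pos)
qed

text \<open>The weight \<open>d^(n * q)\<close> splits into the part that belongs to the condition
  on \<open>g k\<close> and the part that belongs to the embedding of \<open>k\<close>-th
  derivatives into weighted \<open>L^q\<close>.\<close>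

lemma symbol_exp_weight:
  assumes "0 < p" "0 < q" "k < n" "0 < d"
  shows "(x * y) powr q * d powr (real n * q)
    = (y * d powr symbol_exp n p q k) powr q * (x powr q * d powr (real k * q + 2 * q / p - 2))"
proof -
  have "real n * q = symbol_exp n p q k * q + (real k * q + 2 * q / p - 2)"
    using assms by (simp add: symbol_exp_def of_nat_diff field_simps)
  then have "d powr (real n * q) = (d powr symbol_exp n p q k) powr q * d powr (real k * q + 2 * q / p - 2)"
    by (simp only: powr_powr powr_add)
  then show ?thesis by (simp add: powr_mult mult_ac)
qed

text \<open>In each summand the weighted symbol is replaced by its bound \<open>C k\<close>, which
  leaves the embedding estimate for the \<open>k\<close>-th derivative; the result is homogeneous of
  degree \<open>q\<close> in the norm of \<open>f\<close>.\<close>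

lemma bounded_operator_Ig_suff:
  assumes p: "0 < p" and pq: "p \<le> q" and g: "\<forall>k<n. g k holomorphic_on disc"
    and bd: "\<forall>k<n. \<exists>C. \<forall>z\<in>disc. cmod (g k z) * (1 - cmod z) powr symbol_exp n p q k \<le> C"
  shows "bounded_operator p q (Ig n g)"
proof -
  let ?E = "\<lambda>k. (real k * q + 2 * q / p - 2)"
  have q: "0 < q" using p pq by simp
  obtain C where C: "\<And>k z. k < n \<Longrightarrow> z \<in> disc \<Longrightarrow> cmod (g k z) * (1 - cmod z) powr symbol_exp n p q k \<le> C k"
    using bd by metis
  obtain A where A: "0 < A" "\<And>g f. \<forall>k<n. g k holomorphic_on disc \<Longrightarrow> f holomorphic_on disc \<Longrightarrow>
     weighted_int 0 q (Ig n g f) \<le> ennreal A * (\<Sum>k<n. weighted_int (real n * q) q (\<lambda>z. (deriv ^^ k) f z * g k z))"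
    by (rule weighted_int_Ig_le[OF q, of n]) blast
  have "\<exists>D>0. \<forall>f M. f holomorphic_on disc \<longrightarrow> 0 \<le> M \<longrightarrow> weighted_int 0 p f \<le> ennreal M \<longrightarrow>
    weighted_int (?E k) q ((deriv ^^ k) f) \<le> ennreal (D * M powr (q / p))" for k
    by (rule weighted_int_deriv_embed[OF p pq, of k]) blast
  then obtain D where D: "\<And>k. 0 < D k" "\<And>k f M. f holomorphic_on disc \<Longrightarrow> 0 \<le> M \<Longrightarrow> weighted_int 0 p f \<le> ennreal M \<Longrightarrow>
    weighted_int (?E k) q ((deriv ^^ k) f) \<le> ennreal (D k * M powr (q / p))"
    by metis
  define E where "E = A * (\<Sum>k<n. C k powr q * D k)"
  have E: "0 \<le> E" unfolding E_def using A D(1) by (intro mult_nonneg_nonneg sum_nonneg) (auto intro: less_imp_le)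
  \<comment> \<open>Solves \<open>pi * (K * N) powr q = E * R\<close> for
    \<open>R = (pi * N powr p) powr (q / p)\<close>, where \<open>N\<close> is the norm of
    \<open>f\<close>.\<close>
  define K where "K = (E * pi powr (q / p) / pi) powr (1 / q)"
  have K: "0 \<le> K" "K powr q = E * pi powr (q / p) / pi" using E q by (auto simp: K_def powr_powr)
  have main: "Ig n g f \<in> bergman q" "bergman_norm q (Ig n g f) \<le> K * bergman_norm p f" if f: "f \<in> bergman p" for f
  proof -
    define N where "N = bergman_norm p f"
    have N: "0 \<le> N" by (simp add: N_def bergman_norm_nonneg)
    have hf: "f holomorphic_on disc" by (rule bergman_holomorphic[OF f])
    have wf: "weighted_int 0 p f \<le> ennreal (pi * N powr p)"
      using weighted_int_eq_bergman_norm[OF p f] by (simp add: N_def)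
    define R where "R = (pi * N powr p) powr (q / p)"
    have R: "0 \<le> R" "R = pi powr (q / p) * N powr q"
      using p by (auto simp: R_def powr_mult powr_powr)
    have term_le: "weighted_int (real n * q) q (\<lambda>z. (deriv ^^ k) f z * g k z) \<le> ennreal (C k powr q * D k * R)" if k: "k < n" for k
    proof -
      have hd: "(deriv ^^ k) f holomorphic_on disc" by (intro holomorphic_higher_deriv hf) auto
      have "cmod ((deriv ^^ k) f z * g k z) powr q * (1 - cmod z) powr (real n * q)
         \<le> C k powr q * (cmod ((deriv ^^ k) f z) powr q * (1 - cmod z) powr ?E k)" if z: "z \<in> disc" for z
      proof -
        have d: "0 < 1 - cmod z" using z by simp
        have "cmod ((deriv ^^ k) f z * g k z) powr q * (1 - cmod z) powr (real n * q)
           = (cmod (g k z) * (1 - cmod z) powr symbol_exp n p q k) powr q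
              * (cmod ((deriv ^^ k) f z) powr q * (1 - cmod z) powr ?E k)"
          unfolding norm_mult by (rule symbol_exp_weight[OF p q k d])
        also have "\<dots> \<le> C k powr q * (cmod ((deriv ^^ k) f z) powr q * (1 - cmod z) powr ?E k)"
          using q by (intro mult_right_mono powr_mono2 C k z) auto
        finally show ?thesis .
      qed
      then have "weighted_int (real n * q) q (\<lambda>z. (deriv ^^ k) f z * g k z)
          \<le> ennreal (C k powr q) * weighted_int (?E k) q ((deriv ^^ k) f)"
        using weighted_int_le_split[of "C k powr q" 0 "(deriv ^^ k) f" "\<lambda>z. (deriv ^^ k) f z * g k z" q "real n * q" q "?E k", OF _ _ hd]
        by simp
      also have "\<dots> \<le> ennreal (C k powr q) * ennreal (D k * R)"
        unfolding R_def by (intro mult_left_mono D(2) hf wf) auto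
      also have "\<dots> = ennreal (C k powr q * (D k * R))"
        using D(1)[of k] R by (intro ennreal_mult[symmetric]) auto
      finally show ?thesis by (simp add: mult.assoc)
    qed
    have nonneg: "0 \<le> C k powr q * D k * R" for k
      using D(1)[of k] R(1) by (intro mult_nonneg_nonneg) auto
    have "weighted_int 0 q (Ig n g f) \<le> ennreal A * (\<Sum>k<n. weighted_int (real n * q) q (\<lambda>z. (deriv ^^ k) f z * g k z))"
      by (rule A(2)[OF g hf])
    also have "\<dots> \<le> ennreal A * (\<Sum>k<n. ennreal (C k powr q * D k * R))"
      using term_le by (intro mult_left_mono sum_mono) auto
    also have "(\<Sum>k<n. ennreal (C k powr q * D k * R)) = ennreal (\<Sum>k<n. C k powr q * D k * R)"
      by (intro sum_ennreal nonneg)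
    also have "ennreal A * \<dots> = ennreal (A * (\<Sum>k<n. C k powr q * D k * R))"
      using A by (intro ennreal_mult[symmetric] sum_nonneg nonneg) auto
    also have "A * (\<Sum>k<n. C k powr q * D k * R) = E * R"
      by (simp add: E_def sum_distrib_right)
    also have "\<dots> = pi * (K * N) powr q"
      unfolding powr_mult K(2) R(2) by simp
    finally have le: "weighted_int 0 q (Ig n g f) \<le> ennreal (pi * (K * N) powr q)" .
    show "Ig n g f \<in> bergman q" "bergman_norm q (Ig n g f) \<le> K * bergman_norm p f"
      using bergman_norm_le[OF q holomorphic_Ig[OF g hf] le] K N by (auto simp: N_def)
  qed
  then show ?thesis unfolding bounded_operator_def by blast
qed

text \<open>The \<open>n\<close>-th derivative undoes the iterated integration, so the growth
  estimate in \<open>A^q\<close> bounds the integrand for \<open>T a\<close> at the point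
  \<open>a\<close>, uniformly in \<open>a\<close>. Induction on \<open>n - k\<close> supplies the
  bounds for the larger indices.\<close>

lemma bounded_operator_Ig_nec:
  assumes p: "0 < p" and pq: "p \<le> q" and g: "\<forall>k<n. g k holomorphic_on disc"
    and T: "bounded_operator p q (Ig n g)" and k: "k < n"
  shows "\<exists>C. \<forall>z\<in>disc. cmod (g k z) * (1 - cmod z) powr symbol_exp n p q k \<le> C"
  using k
proof (induction "n - k" arbitrary: k rule: less_induct)
  case less
  have q: "0 < q" using p pq by simp
  obtain A where A: "\<And>f. f \<in> bergman p \<Longrightarrow> Ig n g f \<in> bergman q"
    "\<And>f. f \<in> bergman p \<Longrightarrow> bergman_norm q (Ig n g f) \<le> A * bergman_norm p f"
    using T unfolding bounded_operator_def by blast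
  obtain B where B: "0 < B" "\<And>f z. f \<in> bergman q \<Longrightarrow> z \<in> disc \<Longrightarrow>
    cmod ((deriv ^^ n) f z) * (1 - cmod z) powr (real n + 2 / q) \<le> B * bergman_norm q f"
    by (rule deriv_bergman_norm_le[OF q, of n]) blast
  obtain T :: "complex \<Rightarrow> complex \<Rightarrow> complex" and c :: real and D where c: "0 < c" and
    T: "\<And>a. a \<in> disc \<Longrightarrow> T a \<in> bergman p"
    "\<And>a. a \<in> disc \<Longrightarrow> bergman_norm p (T a) \<le> 1" and
    rec: "\<And>g q a. a \<in> disc \<Longrightarrow> c * (cmod (g k a) * (1 - cmod a) powr symbol_exp n p q k)
       \<le> cmod (Ig_integrand n g (T a) a) * (1 - cmod a) powr (real n + 2 / q)
         + (\<Sum>i\<in>{k<..<n}. D i * (cmod (g i a) * (1 - cmod a) powr symbol_exp n p q i))"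
    by (rule symbol_recovery[OF p less.prems]) blast
  have "\<exists>C. \<forall>z\<in>disc. cmod (g i z) * (1 - cmod z) powr symbol_exp n p q i \<le> C" if "i \<in> {k<..<n}" for i
    using that by (intro less.hyps) auto
  then obtain C where C: "\<And>i z. i \<in> {k<..<n} \<Longrightarrow> z \<in> disc \<Longrightarrow> cmod (g i z) * (1 - cmod z) powr symbol_exp n p q i \<le> C i"
    by metis
  \<comment> \<open>Absolute values are taken because the signs of the operator bound
    \<open>A\<close> and of the coefficients \<open>D i\<close> are not known here.\<close>
  have "cmod (g k a) * (1 - cmod a) powr symbol_exp n p q k \<le> (B * \<bar>A\<bar> + (\<Sum>i\<in>{k<..<n}. \<bar>D i\<bar> * C i)) / c" if a: "a \<in> disc" for a
  proof -
    have "cmod (Ig_integrand n g (T a) a) * (1 - cmod a) powr (real n + 2 / q) \<le> B * bergman_norm q (Ig n g (T a))"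
      using B(2)[OF A(1)[OF T(1)[OF a]] a] higher_deriv_Ig[OF g bergman_holomorphic[OF T(1)[OF a]] a] by simp
    also have "\<dots> \<le> B * (\<bar>A\<bar> * 1)"
    proof -
      have "bergman_norm q (Ig n g (T a)) \<le> A * bergman_norm p (T a)" by (rule A(2)[OF T(1)[OF a]])
      also have "\<dots> \<le> \<bar>A\<bar> * 1"
        using T(2)[OF a] bergman_norm_nonneg[of p "T a"] by (intro mult_mono) auto
      finally show ?thesis using B by (intro mult_left_mono) auto
    qed
    finally have 1: "cmod (Ig_integrand n g (T a) a) * (1 - cmod a) powr (real n + 2 / q) \<le> B * \<bar>A\<bar>" by simp
    have 2: "(\<Sum>i\<in>{k<..<n}. D i * (cmod (g i a) * (1 - cmod a) powr symbol_exp n p q i)) \<le> (\<Sum>i\<in>{k<..<n}. \<bar>D i\<bar> * C i)"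
      using C a by (intro sum_mono mult_mono) auto
    show ?thesis using rec[OF a, of g q] 1 2 c by (simp add: field_simps)
  qed
  then show ?case by blast
qed

section \<open>Compactness\<close>


text \<open>Approach to the unit circle from inside, as a filter: the little-oh condition becomes
  ordinary convergence to 0 and the limit rules apply.\<close>

definition at_circle :: "complex filter" where
  "at_circle = filtercomap cmod (at_left 1)"

lemma eventually_at_circle:
  "eventually P at_circle \<longleftrightarrow> (\<exists>r<1. \<forall>z. r < cmod z \<and> cmod z < 1 \<longrightarrow> P z)"
proof
  assume "eventually P at_circle"
  then obtain Q where Q: "eventually Q (at_left 1)" "\<And>z. Q (cmod z) \<Longrightarrow> P z"
    by (auto simp: at_circle_def eventually_filtercomap)
  then obtain r where "r < 1" "\<And>y. r < y \<Longrightarrow> y < 1 \<Longrightarrow> Q y"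
    using eventually_at_left_field[of Q 1] by auto
  then show "\<exists>r<1. \<forall>z. r < cmod z \<and> cmod z < 1 \<longrightarrow> P z"
    using Q(2) by blast
next
  assume "\<exists>r<1. \<forall>z. r < cmod z \<and> cmod z < 1 \<longrightarrow> P z"
  then obtain r where r: "r < 1" "\<And>z. r < cmod z \<Longrightarrow> cmod z < 1 \<Longrightarrow> P z" by blast
  have "eventually (\<lambda>y. r < y \<and> y < 1) (at_left 1)"
    unfolding eventually_at_left_field using r(1) by blast
  then show "eventually P at_circle"
    unfolding at_circle_def eventually_filtercomap using r(2) by blast
qed

lemma eventually_disc_at_circle: "eventually (\<lambda>z. z \<in> disc) at_circle"
  unfolding eventually_at_circle by (intro exI[of _ 0]) auto

lemma vanishing_at_circle_imp_zero:
  assumes g: "g holomorphic_on disc" and lim: "((\<lambda>z. cmod (g z)) \<longlongrightarrow> 0) at_circle" and z: "z \<in> disc"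
  shows "g z = 0"
proof -
  have "cmod (g z) \<le> e" if e: "0 < e" for e
  proof -
    have "eventually (\<lambda>z. cmod (g z) < e) at_circle"
      using lim e by (auto dest: order_tendstoD)
    then obtain r where r: "r < 1" "\<And>w. r < cmod w \<Longrightarrow> cmod w < 1 \<Longrightarrow> cmod (g w) < e"
      unfolding eventually_at_circle by blast
    \<comment> \<open>A circle of radius \<open>\<rho>\<close> that encloses \<open>z\<close> and
      lies in the ring where \<open>|g| < e\<close>; the maximum principle carries the bound
      inside.\<close>
    obtain \<rho> where \<rho>: "max (max r 0) (cmod z) < \<rho>" "\<rho> < 1"
      using dense[of "max (max r 0) (cmod z)" 1] r(1) z by auto
    show ?thesis
    proof (rule maximum_modulus_frontier[of g "ball (0::complex) \<rho>"])
      show "g holomorphic_on interior (ball 0 \<rho>)"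
        using \<rho> by (intro holomorphic_on_subset[OF g]) auto
      have "continuous_on (cball 0 \<rho>) g"
        using \<rho> by (intro holomorphic_on_imp_continuous_on holomorphic_on_subset[OF g]) auto
      then show "continuous_on (closure (ball 0 \<rho>)) g" using \<rho> by (simp add: closure_ball)
      fix w :: complex assume "w \<in> frontier (ball 0 \<rho>)"
      then have "cmod w = \<rho>" using \<rho> by (simp add: frontier_ball)
      then show "cmod (g w) \<le> e" using r(2)[of w] \<rho> by simp
    qed (use \<rho> in auto)
  qed
  then have "cmod (g z) \<le> 0" by (rule field_le_epsilon) simp
  then show ?thesis by simp
qed

lemma tendsto_at_circle_imp_bounded:
  assumes g: "g holomorphic_on disc" and lim: "((\<lambda>z. cmod (g z) * (1 - cmod z) powr a) \<longlongrightarrow> 0) at_circle"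
  shows "\<exists>C. \<forall>z\<in>disc. cmod (g z) * (1 - cmod z) powr a \<le> C"
proof -
  let ?h = "\<lambda>z. cmod (g z) * (1 - cmod z) powr a"
  have "eventually (\<lambda>z. ?h z < 1) at_circle"
    using lim by (rule order_tendstoD) simp
  then obtain r where r: "r < 1" "\<And>w. r < cmod w \<Longrightarrow> cmod w < 1 \<Longrightarrow> ?h w < 1"
    unfolding eventually_at_circle by blast
  have "continuous_on (cball 0 r) g"
    using r by (intro holomorphic_on_imp_continuous_on holomorphic_on_subset[OF g]) auto
  then have "continuous_on (cball 0 r) ?h"
    using r by (intro continuous_intros) auto
  then have "bounded (?h ` cball 0 r)"
    by (intro compact_imp_bounded compact_continuous_image) auto
  then obtain B where B: "\<And>z. z \<in> cball 0 r \<Longrightarrow> norm (?h z) \<le> B"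
    unfolding bounded_iff by (metis (no_types, lifting) imageI)
  have "?h z \<le> max 1 B" if "z \<in> disc" for z
  proof (cases "cmod z \<le> r")
    case True
    then have "norm (?h z) \<le> B" by (intro B) auto
    then show ?thesis by simp
  next
    case False
    then show ?thesis using r(2)[of z] that by simp
  qed
  then show ?thesis by blast
qed

text \<open>The disc is split at a radius \<open>r\<close>. Outside, the weighted symbol is small
  and the embedding bounds the rest uniformly in \<open>j\<close>; inside, the symbol is bounded and
  the derivatives of \<open>u j\<close> are uniformly small for large \<open>j\<close>.\<close>

lemma weighted_int_Ig_tendsto_0:
  fixes u :: "nat \<Rightarrow> complex \<Rightarrow> complex"
  assumes p: "0 < p" and pq: "p \<le> q" and g: "\<forall>k<n. g k holomorphic_on disc"
    and lim: "\<forall>k<n. ((\<lambda>z. cmod (g k z) * (1 - cmod z) powr symbol_exp n p q k) \<longlongrightarrow> 0) at_circle"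
    and u: "\<And>j. u j holomorphic_on disc" "\<And>j. weighted_int 0 p (u j) \<le> ennreal M" and M: "0 \<le> M"
    and unif: "\<And>k r. r < 1 \<Longrightarrow> uniform_limit (cball 0 r) (\<lambda>j. (deriv ^^ k) (u j)) (\<lambda>_. 0) sequentially"
    and e: "0 < e"
  shows "eventually (\<lambda>j. weighted_int 0 q (Ig n g (u j)) \<le> ennreal e) sequentially"
proof -
  have q: "0 < q" using p pq by simp
  obtain A where A: "0 < A" "\<And>g f. \<forall>k<n. g k holomorphic_on disc \<Longrightarrow> f holomorphic_on disc \<Longrightarrow>
     weighted_int 0 q (Ig n g f) \<le> ennreal A * (\<Sum>k<n. weighted_int (real n * q) q (\<lambda>z. (deriv ^^ k) f z * g k z))"
    by (rule weighted_int_Ig_le[OF q, of n]) blast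
  \<comment> \<open>The share of one summand; \<open>n + 1\<close> avoids a division by
    zero.\<close>
  define e' where "e' = e / (A * (real n + 1))"
  have e': "0 < e'" using e A by (auto simp: e'_def intro!: divide_pos_pos mult_pos_pos)
  have small: "eventually (\<lambda>j. weighted_int (real n * q) q (\<lambda>z. (deriv ^^ k) (u j) z * g k z) \<le> ennreal e') sequentially"
    if k: "k < n" for k
  proof -
    obtain D where D: "0 < D" "\<And>f M. f holomorphic_on disc \<Longrightarrow> 0 \<le> M \<Longrightarrow> weighted_int 0 p f \<le> ennreal M \<Longrightarrow>
      weighted_int (real k * q + 2 * q / p - 2) q ((deriv ^^ k) f) \<le> ennreal (D * M powr (q / p))"
      by (rule weighted_int_deriv_embed[OF p pq, of k]) blast
    \<comment> \<open>The uniform embedding bound, enlarged by 1 so that it can be divided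
      by.\<close>
    define K where "K = D * M powr (q / p) + 1"
    have K: "0 < K" using D by (simp add: K_def add_nonneg_pos)
    \<comment> \<open>\<open>\<epsilon> powr q * K = e' / 2\<close> settles the outer ring;
      \<open>\<eta>\<close> below is fixed by \<open>(\<eta> * B) powr q * pi = e' / 2\<close> for
      the inner disc.\<close>
    define \<epsilon> where "\<epsilon> = (e' / (2 * K)) powr (1 / q)"
    have \<epsilon>: "0 < \<epsilon>" "\<epsilon> powr q = e' / (2 * K)" using e' K q by (auto simp: \<epsilon>_def powr_powr)
    have "eventually (\<lambda>z. cmod (g k z) * (1 - cmod z) powr symbol_exp n p q k < \<epsilon>) at_circle"
      using lim k \<epsilon> by (auto dest: order_tendstoD)
    then obtain r where r: "r < 1" "\<And>z. r < cmod z \<Longrightarrow> cmod z < 1 \<Longrightarrow> cmod (g k z) * (1 - cmod z) powr symbol_exp n p q k < \<epsilon>"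
      unfolding eventually_at_circle by blast
    have hg: "g k holomorphic_on disc" using g k by blast
    have "continuous_on (cball 0 r) (g k)"
      using r by (intro holomorphic_on_imp_continuous_on holomorphic_on_subset[OF hg]) auto
    then have "bounded (g k ` cball 0 r)"
      by (intro compact_imp_bounded compact_continuous_image) auto
    then obtain B0 where B0: "\<And>z. z \<in> cball 0 r \<Longrightarrow> cmod (g k z) \<le> B0"
      unfolding bounded_iff by (metis imageI)
    define B where "B = max B0 1"
    have B: "0 < B" "\<And>z. z \<in> cball 0 r \<Longrightarrow> cmod (g k z) \<le> B"
      using B0 by (auto simp: B_def le_max_iff_disj)
    define \<eta> where "\<eta> = (e' / (2 * pi)) powr (1 / q) / B"
    have \<eta>: "0 < \<eta>" "(\<eta> * B) powr q = e' / (2 * pi)" using e' B q by (auto simp: \<eta>_def powr_powr)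
    have "eventually (\<lambda>j. \<forall>z\<in>cball 0 r. dist ((deriv ^^ k) (u j) z) 0 < \<eta>) sequentially"
      using unif[OF r(1), of k] \<eta>(1) by (rule uniform_limitD)
    then show ?thesis
    proof eventually_elim
      case (elim j)
      have hd: "(deriv ^^ k) (u j) holomorphic_on disc" by (intro holomorphic_higher_deriv u) auto
      have "weighted_int (real n * q) q (\<lambda>z. (deriv ^^ k) (u j) z * g k z)
         \<le> ennreal (\<epsilon> powr q) * weighted_int (real k * q + 2 * q / p - 2) q ((deriv ^^ k) (u j)) + ennreal ((\<eta> * B) powr q * pi)"
      proof (rule weighted_int_le_split[OF _ _ hd])
        fix z assume z: "z \<in> disc"
        then have d: "0 < 1 - cmod z" by simp
        show "cmod ((deriv ^^ k) (u j) z * g k z) powr q * (1 - cmod z) powr (real n * q)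
          \<le> \<epsilon> powr q * (cmod ((deriv ^^ k) (u j) z) powr q * (1 - cmod z) powr (real k * q + 2 * q / p - 2)) + (\<eta> * B) powr q"
        proof (cases "cmod z \<le> r")
          case True
          then have zr: "z \<in> cball 0 r" by simp
          have "cmod ((deriv ^^ k) (u j) z * g k z) powr q * (1 - cmod z) powr (real n * q) \<le> (\<eta> * B) powr q * 1"
          proof (rule mult_mono)
            have "cmod ((deriv ^^ k) (u j) z) \<le> \<eta>" using elim zr by (auto intro: less_imp_le)
            then show "cmod ((deriv ^^ k) (u j) z * g k z) powr q \<le> (\<eta> * B) powr q"
              unfolding norm_mult using q B zr \<eta> by (intro powr_mono2 mult_mono) auto
            show "(1 - cmod z) powr (real n * q) \<le> 1" using d q by (intro powr_le1) auto
          qed auto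
          then show ?thesis by (simp add: add_increasing)
        next
          case False
          have "cmod ((deriv ^^ k) (u j) z * g k z) powr q * (1 - cmod z) powr (real n * q)
             = (cmod (g k z) * (1 - cmod z) powr symbol_exp n p q k) powr q
                * (cmod ((deriv ^^ k) (u j) z) powr q * (1 - cmod z) powr (real k * q + 2 * q / p - 2))"
            unfolding norm_mult by (rule symbol_exp_weight[OF p q k d])
          also have "\<dots> \<le> \<epsilon> powr q * (cmod ((deriv ^^ k) (u j) z) powr q * (1 - cmod z) powr (real k * q + 2 * q / p - 2))"
            using q r(2)[of z] False z by (intro mult_right_mono powr_mono2) auto
          finally show ?thesis by (simp add: add_increasing2)
        qed
      qed auto
      also have "ennreal (\<epsilon> powr q) * weighted_int (real k * q + 2 * q / p - 2) q ((deriv ^^ k) (u j)) \<le> ennreal (\<epsilon> powr q) * ennreal K"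
      proof (intro mult_left_mono)
        have "weighted_int (real k * q + 2 * q / p - 2) q ((deriv ^^ k) (u j)) \<le> ennreal (D * M powr (q / p))"
          by (intro D(2) u M)
        also have "\<dots> \<le> ennreal K" by (intro ennreal_leI) (simp add: K_def)
        finally show "weighted_int (real k * q + 2 * q / p - 2) q ((deriv ^^ k) (u j)) \<le> ennreal K" .
      qed auto
      also have "ennreal (\<epsilon> powr q) * ennreal K = ennreal (e' / 2)"
        using K \<epsilon> e' by (subst ennreal_mult[symmetric]) auto
      also have "(\<eta> * B) powr q * pi = e' / 2" unfolding \<eta>(2) by simp
      also have "ennreal (e' / 2) + ennreal (e' / 2) = ennreal e'"
        using e' by (subst ennreal_plus[symmetric]) auto
      finally show ?case by simp
    qed
  qed
  have "eventually (\<lambda>j. \<forall>k\<in>{..<n}. weighted_int (real n * q) q (\<lambda>z. (deriv ^^ k) (u j) z * g k z) \<le> ennreal e') sequentially"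
    using small by (intro eventually_ball_finite) auto
  then show ?thesis
  proof eventually_elim
    case (elim j)
    have "weighted_int 0 q (Ig n g (u j)) \<le> ennreal A * (\<Sum>k<n. weighted_int (real n * q) q (\<lambda>z. (deriv ^^ k) (u j) z * g k z))"
      by (rule A(2)[OF g u(1)])
    also have "\<dots> \<le> ennreal A * (\<Sum>k<n. ennreal e')"
      using elim by (intro mult_left_mono sum_mono) auto
    also have "(\<Sum>k<n. ennreal e') = ennreal (real n * e')"
      using e' by (subst sum_ennreal) auto
    also have "ennreal A * ennreal (real n * e') = ennreal (A * (real n * e'))"
      using A e' by (intro ennreal_mult[symmetric]) auto
    also have "\<dots> \<le> ennreal e"
    proof (rule ennreal_leI)
      have "A * (real n * e') \<le> A * ((real n + 1) * e')" using A e' by (intro mult_left_mono mult_right_mono) auto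
      also have "\<dots> = e" using A by (simp add: e'_def add_nonneg_pos less_imp_neq[symmetric])
      finally show "A * (real n * e') \<le> e" .
    qed
    finally show ?case .
  qed
qed

text \<open>Cauchy's inequality on discs of radius \<open>s = (1 - r) / 2\<close> around the points
  of \<open>cball 0 r\<close>; they stay in \<open>cball 0 (r + s)\<close>, where the convergence is
  already uniform.\<close>

lemma uniform_limit_higher_deriv_0:
  assumes u: "\<And>j. u j holomorphic_on disc"
    and unif: "\<And>r. r < 1 \<Longrightarrow> uniform_limit (cball 0 r) u (\<lambda>_. 0) sequentially"
    and r: "r < 1"
  shows "uniform_limit (cball 0 r) (\<lambda>j. (deriv ^^ k) (u j)) (\<lambda>_. 0) sequentially"
proof (rule uniform_limitI)
  fix e :: real assume e: "0 < e"
  define s where "s = (1 - r) / 2"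
  have s: "0 < s" "r + s < 1" using r by (auto simp: s_def field_simps)
  define e' where "e' = e * s ^ k / (2 * fact k)"
  have e': "0 < e'" using e s by (simp add: e'_def)
  have "eventually (\<lambda>j. \<forall>z\<in>cball 0 (r + s). dist (u j z) 0 < e') sequentially"
    using unif[OF s(2)] e' by (rule uniform_limitD)
  then show "eventually (\<lambda>j. \<forall>z\<in>cball 0 r. dist ((deriv ^^ k) (u j) z) 0 < e) sequentially"
  proof eventually_elim
    case (elim j)
    show ?case
    proof
      fix z :: complex assume z: "z \<in> cball 0 r"
      have sub: "w \<in> cball 0 (r + s)" if "w \<in> cball z s" for w
        using that z norm_triangle_sub[of w z] by (simp add: dist_norm norm_minus_commute)
      then have sub': "cball z s \<subseteq> disc" using s by fastforce
      have "cmod ((deriv ^^ k) (u j) z) \<le> fact k * e' / s ^ k"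
      proof (rule Cauchy_inequality)
        show "u j holomorphic_on ball z s"
          using sub' by (intro holomorphic_on_subset[OF u]) auto
        show "continuous_on (cball z s) (u j)"
          using sub' by (intro holomorphic_on_imp_continuous_on holomorphic_on_subset[OF u])
        show "cmod (u j x) \<le> e'" if "cmod (z - x) = s" for x
        proof -
          have "x \<in> cball 0 (r + s)" using that by (intro sub) (simp add: dist_norm)
          then show ?thesis using elim by (auto intro: less_imp_le)
        qed
      qed (use s in auto)
      also have "\<dots> = e / 2" using s by (simp add: e'_def)
      also have "\<dots> < e" using e by simp
      finally show "dist ((deriv ^^ k) (u j) z) 0 < e" by simp
    qed
  qed
qed

lemma compact_subset_disc:
  assumes "compact K" "K \<subseteq> disc"
  obtains R where "0 < R" "R < 1" "K \<subseteq> cball 0 R"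
proof (cases "K = {}")
  case False
  have "continuous_on K cmod" by (intro continuous_intros)
  then obtain x where x: "x \<in> K" "\<And>y. y \<in> K \<Longrightarrow> cmod y \<le> cmod x"
    using continuous_attains_sup[OF assms(1) False] by blast
  show ?thesis
  proof (rule that[of "max (cmod x) (1 / 2)"])
    show "K \<subseteq> cball 0 (max (cmod x) (1 / 2))" using x(2) by (auto simp: le_max_iff_disj)
  qed (use x assms(2) in auto)
qed (use that[of "1 / 2"] in auto)

text \<open>The growth estimate makes the sequence locally bounded, and Fatou's lemma keeps the
  limit in the unit ball. The convergence is stated for the differences \<open>fs (r j) - f\<close>,
  the form in which the derivatives are estimated.\<close>

lemma bergman_Montel:
  assumes p: "0 < p" and fs: "\<And>j::nat. fs j \<in> bergman p" "\<And>j. bergman_norm p (fs j) \<le> 1"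
  obtains r :: "nat \<Rightarrow> nat" and f where "strict_mono r" "f \<in> bergman p" "bergman_norm p f \<le> 1"
    "\<And>R. R < 1 \<Longrightarrow> uniform_limit (cball 0 R) (\<lambda>j z. fs (r j) z - f z) (\<lambda>_. 0) sequentially"
proof -
  obtain C where C: "0 < C" "\<And>f z. f \<in> bergman p \<Longrightarrow> z \<in> disc \<Longrightarrow>
    cmod ((deriv ^^ 0) f z) * (1 - cmod z) powr (real 0 + 2 / p) \<le> C * bergman_norm p f"
    by (rule deriv_bergman_norm_le[OF p, of 0]) blast
  have hol: "fs j holomorphic_on disc" for j by (rule bergman_holomorphic[OF fs(1)])
  have bound: "\<exists>B. \<forall>h\<in>range fs. \<forall>z\<in>K. cmod (h z) \<le> B" if K: "compact K" "K \<subseteq> disc" for K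
  proof -
    obtain R where R: "0 < R" "R < 1" "K \<subseteq> cball 0 R" by (rule compact_subset_disc[OF K])
    have "cmod (fs j z) \<le> C / (1 - R) powr (2 / p)" if z: "z \<in> K" for j z
    proof -
      have zd: "z \<in> disc" "cmod z \<le> R" using z K R by auto
      have "cmod (fs j z) * (1 - R) powr (2 / p) \<le> cmod (fs j z) * (1 - cmod z) powr (2 / p)"
        using zd R p by (intro mult_left_mono powr_mono2) auto
      also have "\<dots> \<le> C * bergman_norm p (fs j)" using C(2)[OF fs(1) zd(1)] by simp
      also have "\<dots> \<le> C * 1" using C(1) fs(2) by (intro mult_left_mono) auto
      finally show ?thesis using R by (simp add: field_simps)
    qed
    then show ?thesis by blast
  qed
  obtain f and r :: "nat \<Rightarrow> nat" where f: "f holomorphic_on disc" and r: "strict_mono r"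
    and lim: "\<And>x. x \<in> disc \<Longrightarrow> ((\<lambda>n. fs (r n) x) \<longlongrightarrow> f x) sequentially"
    and unif: "\<And>K. \<lbrakk>compact K; K \<subseteq> disc\<rbrakk> \<Longrightarrow> uniform_limit K (fs \<circ> r) f sequentially"
    by (rule Montel[of disc "range fs" fs]) (use hol bound in auto)
  define v where "v j z = weighted_density 0 p (fs (r j)) z" for j z
  have [measurable]: "v j \<in> borel_measurable borel" for j
    unfolding v_def by (intro measurable_weighted_integrand hol)
  have vlim: "(\<lambda>j. v j z) \<longlonglongrightarrow> weighted_density 0 p f z" for z
  proof (cases "z \<in> disc")
    case True
    have "(\<lambda>j. ennreal (cmod (fs (r j) z) powr p * (1 - cmod z) powr 0)) \<longlonglongrightarrow> ennreal (cmod (f z) powr p * (1 - cmod z) powr 0)"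
      using p lim[OF True] by (intro tendsto_ennrealI tendsto_mult tendsto_powr' tendsto_norm tendsto_const) auto
    then show ?thesis using True by (simp add: v_def)
  qed (simp add: v_def)
  have "weighted_int 0 p f = (\<integral>\<^sup>+z. liminf (\<lambda>j. v j z) \<partial>lborel)"
    unfolding weighted_int_def by (intro nn_integral_cong) (simp only: lim_imp_Liminf[OF trivial_limit_sequentially vlim])
  also have "\<dots> \<le> liminf (\<lambda>j. \<integral>\<^sup>+z. v j z \<partial>lborel)"
    by (intro nn_integral_liminf) measurable
  also have "\<dots> \<le> liminf (\<lambda>j::nat. ennreal (pi * 1 powr p))"
  proof (intro Liminf_mono always_eventually allI)
    fix j
    have "(\<integral>\<^sup>+z. v j z \<partial>lborel) = weighted_int 0 p (fs (r j))" by (simp add: v_def weighted_int_def)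
    also have "\<dots> = ennreal (pi * bergman_norm p (fs (r j)) powr p)"
      by (rule weighted_int_eq_bergman_norm[OF p fs(1)])
    also have "\<dots> \<le> ennreal (pi * 1 powr p)"
      using p fs(2) bergman_norm_nonneg by (intro ennreal_leI mult_left_mono powr_mono2) auto
    finally show "(\<integral>\<^sup>+z. v j z \<partial>lborel) \<le> ennreal (pi * 1 powr p)" .
  qed
  also have "\<dots> = ennreal (pi * 1 powr p)" by (simp add: Liminf_const)
  finally have fb: "f \<in> bergman p" "bergman_norm p f \<le> 1"
    using bergman_norm_le[OF p f, of 1] by auto
  have "uniform_limit (cball 0 R) (\<lambda>j z. fs (r j) z - f z) (\<lambda>_. 0) sequentially" if R: "R < 1" for R
  proof -
    have "uniform_limit (cball 0 R) (fs \<circ> r) f sequentially"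
      using R by (intro unif) auto
    then show ?thesis by (simp add: uniform_limit_iff dist_norm)
  qed
  then show ?thesis using that[OF r fb] by blast
qed

lemma integ_op_cong:
  assumes "z \<in> disc" "\<And>w. w \<in> disc \<Longrightarrow> f w = g w"
  shows "integ_op f z = integ_op g z"
proof -
  have "closed_segment 0 z \<subseteq> disc"
    using assms by (intro closed_segment_subset) auto
  then show ?thesis
    unfolding integ_op_def using assms by (intro contour_integral_cong) auto
qed

lemma integ_op_diff:
  assumes "f holomorphic_on disc" "g holomorphic_on disc" "z \<in> disc"
  shows "integ_op (\<lambda>w. f w - g w) z = integ_op f z - integ_op g z"
proof -
  have "closed_segment 0 z \<subseteq> disc"
    using assms by (intro closed_segment_subset) auto
  then have "f contour_integrable_on linepath 0 z" "g contour_integrable_on linepath 0 z"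
    using assms by (auto intro!: contour_integrable_continuous_linepath holomorphic_on_imp_continuous_on intro: holomorphic_on_subset)
  then show ?thesis unfolding integ_op_def by (rule contour_integral_diff)
qed

text \<open>\<open>h\<close> is given only by its values on the disc because the integrand of a
  difference is the difference of the integrands there, where the functions are holomorphic.\<close>

lemma integ_op_funpow_diff:
  assumes f: "f holomorphic_on disc" and g: "g holomorphic_on disc" and z: "z \<in> disc"
    and h: "\<And>w. w \<in> disc \<Longrightarrow> h w = f w - g w"
  shows "(integ_op ^^ n) h z = (integ_op ^^ n) f z - (integ_op ^^ n) g z"
  using z
proof (induction n arbitrary: z)
  case (Suc n)
  have "(integ_op ^^ Suc n) h z = integ_op (\<lambda>w. (integ_op ^^ n) f w - (integ_op ^^ n) g w) z"
    using Suc by (auto intro!: integ_op_cong)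
  also have "\<dots> = (integ_op ^^ Suc n) f z - (integ_op ^^ Suc n) g z"
    using Suc.prems f g by (simp add: integ_op_diff holomorphic_integ_op_funpow)
  finally show ?case .
qed (use h in auto)

lemma Ig_diff:
  assumes g: "\<forall>k<n. g k holomorphic_on disc" and f: "f holomorphic_on disc" and h: "h holomorphic_on disc" and z: "z \<in> disc"
  shows "Ig n g (\<lambda>w. f w - h w) z = Ig n g f z - Ig n g h z"
  unfolding Ig_eq
proof (rule integ_op_funpow_diff)
  fix w assume w: "w \<in> disc"
  have "(deriv ^^ k) (\<lambda>w. f w - h w) w = (deriv ^^ k) f w - (deriv ^^ k) h w" for k
    by (rule higher_deriv_diff[OF f h _ w]) auto
  then show "Ig_integrand n g (\<lambda>w. f w - h w) w = Ig_integrand n g f w - Ig_integrand n g h w"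
    by (simp add: Ig_integrand_def left_diff_distrib sum_subtractf)
qed (use z in \<open>auto intro!: holomorphic_Ig_integrand f h simp: g\<close>)

text \<open>The limit of the images is \<open>Ig n g f\<close> for the locally uniform limit
  \<open>f\<close> of a subsequence; by linearity on the disc the error is the image of
  \<open>fs (r j) - f\<close>, a bounded sequence tending to 0 locally uniformly.\<close>

lemma compact_operator_Ig_suff:
  assumes p: "0 < p" and pq: "p \<le> q" and g: "\<forall>k<n. g k holomorphic_on disc"
    and lim: "\<forall>k<n. ((\<lambda>z. cmod (g k z) * (1 - cmod z) powr symbol_exp n p q k) \<longlongrightarrow> 0) at_circle"
  shows "compact_operator p q (Ig n g)"
proof -
  have q: "0 < q" using p pq by simp
  have "\<forall>k<n. \<exists>C. \<forall>z\<in>disc. cmod (g k z) * (1 - cmod z) powr symbol_exp n p q k \<le> C"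
    using g lim by (auto intro!: tendsto_at_circle_imp_bounded)
  then have "bounded_operator p q (Ig n g)"
    by (rule bounded_operator_Ig_suff[OF p pq g])
  then have maps: "Ig n g f \<in> bergman q" if "f \<in> bergman p" for f
    using that by (auto simp: bounded_operator_def)
  have "\<exists>(r :: nat \<Rightarrow> nat) h. strict_mono r \<and> h \<in> bergman q \<and>
           (\<lambda>j. bergman_norm q (\<lambda>z. Ig n g (fs (r j)) z - h z)) \<longlonglongrightarrow> 0"
    if fs: "\<forall>j. fs j \<in> bergman p \<and> bergman_norm p (fs j) \<le> 1" for fs
  proof -
    obtain r :: "nat \<Rightarrow> nat" and f where r: "strict_mono r" and f: "f \<in> bergman p" "bergman_norm p f \<le> 1"
      and unif: "\<And>R. R < 1 \<Longrightarrow> uniform_limit (cball 0 R) (\<lambda>j z. fs (r j) z - f z) (\<lambda>_. 0) sequentially"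
      by (rule bergman_Montel[OF p, of fs]) (use fs in auto)
    define u where "u j z = fs (r j) z - f z" for j z
    have hfs: "fs j holomorphic_on disc" for j using fs bergman_holomorphic by blast
    have hf: "f holomorphic_on disc" using f bergman_holomorphic by blast
    have hu: "u j holomorphic_on disc" for j
      unfolding u_def[abs_def] by (intro holomorphic_on_diff hfs hf)
    have le1: "weighted_int 0 p h \<le> ennreal pi" if "h \<in> bergman p" "bergman_norm p h \<le> 1" for h
    proof -
      have "bergman_norm p h powr p \<le> 1" using that p bergman_norm_nonneg[of p h] by (intro powr_le1) auto
      then show ?thesis using weighted_int_eq_bergman_norm[OF p that(1)] by (simp add: ennreal_leI)
    qed
    have wu: "weighted_int 0 p (u j) \<le> ennreal (2 powr p * (pi + pi))" for j
    proof -
      have "weighted_int 0 p (u j) \<le> ennreal (2 powr p) * (weighted_int 0 p (fs (r j)) + weighted_int 0 p f)"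
        unfolding u_def[abs_def] by (rule weighted_int_diff_le[OF p hfs hf])
      also have "\<dots> \<le> ennreal (2 powr p) * (ennreal pi + ennreal pi)"
        using fs f by (intro mult_left_mono add_mono le1) auto
      also have "\<dots> = ennreal (2 powr p * (pi + pi))"
        by (subst ennreal_plus[symmetric], simp, simp, rule ennreal_mult[symmetric]) auto
      finally show ?thesis .
    qed
    have unif': "uniform_limit (cball 0 R) (\<lambda>j. (deriv ^^ k) (u j)) (\<lambda>_. 0) sequentially" if "R < 1" for k R
      by (rule uniform_limit_higher_deriv_0[OF hu _ that]) (use unif in \<open>simp add: u_def[abs_def]\<close>)
    have "(\<lambda>j. bergman_norm q (\<lambda>z. Ig n g (fs (r j)) z - Ig n g f z)) \<longlonglongrightarrow> 0"
    proof (rule LIMSEQ_I)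
      fix e :: real assume e: "0 < e"
      have "eventually (\<lambda>j. weighted_int 0 q (Ig n g (u j)) \<le> ennreal (pi * (e / 2) powr q)) sequentially"
        by (rule weighted_int_Ig_tendsto_0[OF p pq g lim hu wu _ unif']) (use e in auto)
      then obtain J where J: "\<And>j. j \<ge> J \<Longrightarrow> weighted_int 0 q (Ig n g (u j)) \<le> ennreal (pi * (e / 2) powr q)"
        unfolding eventually_sequentially by blast
      have "norm (bergman_norm q (\<lambda>z. Ig n g (fs (r j)) z - Ig n g f z) - 0) < e" if "j \<ge> J" for j
      proof -
        have "weighted_int 0 q (\<lambda>z. Ig n g (fs (r j)) z - Ig n g f z) = weighted_int 0 q (Ig n g (u j))"
          unfolding u_def[abs_def] by (intro weighted_int_cong) (simp add: Ig_diff[OF g hfs hf])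
        then have "bergman_norm q (\<lambda>z. Ig n g (fs (r j)) z - Ig n g f z) \<le> e / 2"
          using J[OF that] e
          by (intro bergman_norm_le[OF q] holomorphic_on_diff holomorphic_Ig g hfs hf) auto
        then show ?thesis using e bergman_norm_nonneg[of q "\<lambda>z. Ig n g (fs (r j)) z - Ig n g f z"] by simp
      qed
      then show "\<exists>J. \<forall>j\<ge>J. norm (bergman_norm q (\<lambda>z. Ig n g (fs (r j)) z - Ig n g f z) - 0) < e" by blast
    qed
    then show ?thesis using r maps[OF f(1)] by blast
  qed
  then show ?thesis unfolding compact_operator_def using maps by blast
qed


section \<open>Necessity for compactness\<close>

text \<open>Suppose the quantity stays above \<open>\<epsilon>\<close> along points
  \<open>a j\<close> tending to the circle. Compactness gives a limit \<open>h\<close> of images;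
  since \<open>T (a j)\<close> tends to 0 locally uniformly, the \<open>n\<close>-th derivative of
  \<open>h\<close> vanishes. The growth estimate at the moving point itself then bounds
  \<open>\<epsilon>\<close> by a norm that tends to 0.\<close>

lemma compact_operator_Ig_nec_aux:
  fixes T :: "complex \<Rightarrow> complex \<Rightarrow> complex"
  assumes p: "0 < p" and pq: "p \<le> q" and g: "\<forall>k<n. g k holomorphic_on disc"
    and comp: "compact_operator p q (Ig n g)"
    and T: "\<And>a. a \<in> disc \<Longrightarrow> T a \<in> bergman p" "\<And>a. a \<in> disc \<Longrightarrow> bergman_norm p (T a) \<le> 1"
    and \<beta>: "0 < \<beta>"
    and dec: "\<And>a z. a \<in> disc \<Longrightarrow> z \<in> disc \<Longrightarrow> cmod (T a z) \<le> B * (1 - cmod a) powr \<beta> / (1 - cmod z) ^ N"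
  shows "((\<lambda>a. cmod (Ig_integrand n g (T a) a) * (1 - cmod a) powr (real n + 2 / q)) \<longlongrightarrow> 0) at_circle"
proof (rule ccontr)
  define E where "E a = cmod (Ig_integrand n g (T a) a) * (1 - cmod a) powr (real n + 2 / q)" for a
  have E0: "0 \<le> E a" for a by (simp add: E_def)
  have q: "0 < q" using p pq by simp
  assume "\<not> ((\<lambda>a. cmod (Ig_integrand n g (T a) a) * (1 - cmod a) powr (real n + 2 / q)) \<longlongrightarrow> 0) at_circle"
  then have "\<not> (E \<longlongrightarrow> 0) at_circle" by (simp add: E_def[abs_def])
  then obtain \<epsilon> where \<epsilon>: "0 < \<epsilon>" "\<not> eventually (\<lambda>a. dist (E a) 0 < \<epsilon>) at_circle"
    unfolding tendsto_iff by blast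
  have "\<exists>a. 1 - 1 / (real j + 2) < cmod a \<and> cmod a < 1 \<and> \<epsilon> \<le> E a" for j :: nat
  proof -
    have "1 - 1 / (real j + 2) < 1" by simp
    then show ?thesis using \<epsilon>(2) E0 unfolding eventually_at_circle by (fastforce simp: not_less)
  qed
  then obtain a where a: "\<And>j::nat. 1 - 1 / (real j + 2) < cmod (a j)" "\<And>j. cmod (a j) < 1" "\<And>j. \<epsilon> \<le> E (a j)"
    by metis
  have ad: "a j \<in> disc" for j using a(2) by simp
  define fs where "fs j = T (a j)" for j
  have hT: "fs j holomorphic_on disc" for j unfolding fs_def by (rule bergman_holomorphic[OF T(1)[OF ad]])
  have "\<forall>j. fs j \<in> bergman p \<and> bergman_norm p (fs j) \<le> 1" using T ad by (simp add: fs_def)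
  then obtain r :: "nat \<Rightarrow> nat" and h where r: "strict_mono r" and h: "h \<in> bergman q"
    and lim: "(\<lambda>j. bergman_norm q (\<lambda>z. Ig n g (fs (r j)) z - h z)) \<longlonglongrightarrow> 0"
    using comp unfolding compact_operator_def by blast
  have hh: "h holomorphic_on disc" by (rule bergman_holomorphic[OF h])
  obtain C where C: "0 < C" "\<And>f z. f \<in> bergman q \<Longrightarrow> z \<in> disc \<Longrightarrow>
    cmod ((deriv ^^ n) f z) * (1 - cmod z) powr (real n + 2 / q) \<le> C * bergman_norm q f"
    by (rule deriv_bergman_norm_le[OF q, of n]) blast
  have diff: "cmod (Ig_integrand n g (fs (r j)) z - (deriv ^^ n) h z) * (1 - cmod z) powr (real n + 2 / q)
      \<le> C * bergman_norm q (\<lambda>z. Ig n g (fs (r j)) z - h z)" if z: "z \<in> disc" for j z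
  proof -
    have "Ig n g (fs (r j)) \<in> bergman q"
      using comp T(1)[OF ad] unfolding compact_operator_def fs_def by blast
    then have "(\<lambda>z. Ig n g (fs (r j)) z - h z) \<in> bergman q" by (rule bergman_diff[OF q _ h])
    moreover have "(deriv ^^ n) (\<lambda>z. Ig n g (fs (r j)) z - h z) z = Ig_integrand n g (fs (r j)) z - (deriv ^^ n) h z"
      using higher_deriv_diff[OF holomorphic_Ig[OF g hT] hh _ z] higher_deriv_Ig[OF g hT z] by simp
    ultimately show ?thesis using C(2)[OF _ z] by metis
  qed
  have a1: "(\<lambda>j. 1 - cmod (a j)) \<longlonglongrightarrow> 0"
  proof (rule tendsto_sandwich[OF _ _ tendsto_const])
    show "(\<lambda>j. 1 / (real j + 2)) \<longlonglongrightarrow> 0" by real_asymp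
    show "eventually (\<lambda>j. 1 - cmod (a j) \<le> 1 / (real j + 2)) sequentially"
      using a(1) by (intro always_eventually allI) (smt (verit))
  qed (use a(2) in \<open>auto intro!: always_eventually less_imp_le\<close>)
  have der0: "(\<lambda>j. (deriv ^^ i) (fs j) z) \<longlonglongrightarrow> 0" if z: "z \<in> disc" for i z
  proof -
    define s where "s = (1 - cmod z) / 2"
    have s: "0 < s" using z by (simp add: s_def)
    have sub: "cmod w \<le> 1 - s" if "w \<in> cball z s" for w
      using that norm_triangle_sub[of w z] by (simp add: s_def dist_norm norm_minus_commute field_simps)
    then have sub': "cball z s \<subseteq> disc" using s by fastforce
    have le: "cmod ((deriv ^^ i) (fs j) z) \<le> fact i * (\<bar>B\<bar> * (1 - cmod (a j)) powr \<beta> / s ^ N) / s ^ i" for j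
    proof (rule Cauchy_inequality)
      show "fs j holomorphic_on ball z s"
        using sub' by (intro holomorphic_on_subset[OF hT]) auto
      show "continuous_on (cball z s) (fs j)"
        using sub' by (intro holomorphic_on_imp_continuous_on holomorphic_on_subset[OF hT])
      show "cmod (fs j w) \<le> \<bar>B\<bar> * (1 - cmod (a j)) powr \<beta> / s ^ N" if "cmod (z - w) = s" for w
      proof -
        have w: "w \<in> cball z s" using that by (simp add: dist_norm)
        have "cmod (fs j w) \<le> B * (1 - cmod (a j)) powr \<beta> / (1 - cmod w) ^ N"
          unfolding fs_def using w sub' by (intro dec ad) auto
        also have "\<dots> \<le> \<bar>B\<bar> * (1 - cmod (a j)) powr \<beta> / s ^ N"
          using sub[OF w] s by (intro frac_le mult_right_mono power_mono) auto
        finally show ?thesis .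
      qed
    qed (use s in auto)
    have "(\<lambda>j. (1 - cmod (a j)) powr \<beta>) \<longlonglongrightarrow> 0 powr \<beta>"
      using \<beta> a(2) by (intro tendsto_powr' a1 tendsto_const) (auto intro!: always_eventually less_imp_le)
    then have "(\<lambda>j. fact i * (\<bar>B\<bar> * (1 - cmod (a j)) powr \<beta> / s ^ N) / s ^ i) \<longlonglongrightarrow> fact i * (\<bar>B\<bar> * 0 powr \<beta> / s ^ N) / s ^ i"
      by (intro tendsto_divide tendsto_mult tendsto_const) (use s in auto)
    then have "(\<lambda>j. fact i * (\<bar>B\<bar> * (1 - cmod (a j)) powr \<beta> / s ^ N) / s ^ i) \<longlonglongrightarrow> 0" by simp
    then show ?thesis
      by (rule Lim_null_comparison[rotated]) (intro always_eventually allI le)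
  qed
  \<comment> \<open>Compare at a fixed \<open>z\<close>: the integrands tend to 0 by
    \<open>der0\<close>, and to \<open>(deriv ^^ n) h z\<close> by convergence in
    \<open>A^q\<close>.\<close>
  have hn: "(deriv ^^ n) h z = 0" if z: "z \<in> disc" for z
  proof -
    have d: "0 < (1 - cmod z) powr (real n + 2 / q)" using z by simp
    have "(\<lambda>j. Ig_integrand n g (fs j) z) \<longlonglongrightarrow> (\<Sum>k<n. 0 * g k z)"
      unfolding Ig_integrand_def by (intro tendsto_sum tendsto_mult der0[OF z] tendsto_const)
    then have "(\<lambda>j. Ig_integrand n g (fs (r j)) z) \<longlonglongrightarrow> 0"
      using LIMSEQ_subseq_LIMSEQ[OF _ r] by (fastforce simp: o_def)
    then have "(\<lambda>j. cmod (Ig_integrand n g (fs (r j)) z - (deriv ^^ n) h z) * (1 - cmod z) powr (real n + 2 / q))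
        \<longlonglongrightarrow> cmod (0 - (deriv ^^ n) h z) * (1 - cmod z) powr (real n + 2 / q)"
      by (intro tendsto_intros)
    moreover have "(\<lambda>j. C * bergman_norm q (\<lambda>z. Ig n g (fs (r j)) z - h z)) \<longlonglongrightarrow> C * 0"
      by (intro tendsto_mult lim tendsto_const)
    ultimately have "cmod (0 - (deriv ^^ n) h z) * (1 - cmod z) powr (real n + 2 / q) \<le> C * 0"
      using diff[OF z] by (intro LIMSEQ_le) auto
    then show ?thesis using d by (simp add: mult_le_0_iff)
  qed
  \<comment> \<open>The same estimate, now at the moving points \<open>a (r j)\<close>; its constant
    \<open>C\<close> does not depend on the point.\<close>
  have "E (a (r j)) \<le> C * bergman_norm q (\<lambda>z. Ig n g (fs (r j)) z - h z)" for j
    using diff[OF ad[of "r j"], of j] hn[OF ad, of "r j"] by (simp add: E_def fs_def)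
  then have "\<epsilon> \<le> C * bergman_norm q (\<lambda>z. Ig n g (fs (r j)) z - h z)" for j
    using a(3) order_trans by blast
  moreover have "(\<lambda>j. C * bergman_norm q (\<lambda>z. Ig n g (fs (r j)) z - h z)) \<longlonglongrightarrow> C * 0"
    by (intro tendsto_mult lim tendsto_const)
  ultimately have "\<epsilon> \<le> C * 0" by (intro LIMSEQ_le_const) auto
  then show False using \<epsilon> by simp
qed

lemma compact_operator_Ig_nec:
  assumes p: "0 < p" and pq: "p \<le> q" and g: "\<forall>k<n. g k holomorphic_on disc"
    and comp: "compact_operator p q (Ig n g)" and k: "k < n"
  shows "((\<lambda>z. cmod (g k z) * (1 - cmod z) powr symbol_exp n p q k) \<longlongrightarrow> 0) at_circle"
  using k
proof (induction "n - k" arbitrary: k rule: less_induct)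
  case less
  obtain T :: "complex \<Rightarrow> complex \<Rightarrow> complex" and c \<beta> :: real and B N D where c: "0 < c" "0 < \<beta>" and
    T: "\<And>a. a \<in> disc \<Longrightarrow> T a \<in> bergman p"
    "\<And>a. a \<in> disc \<Longrightarrow> bergman_norm p (T a) \<le> 1"
    "\<And>a z. a \<in> disc \<Longrightarrow> z \<in> disc \<Longrightarrow> cmod (T a z) \<le> B * (1 - cmod a) powr \<beta> / (1 - cmod z) ^ N" and
    rec: "\<And>g q a. a \<in> disc \<Longrightarrow> c * (cmod (g k a) * (1 - cmod a) powr symbol_exp n p q k)
       \<le> cmod (Ig_integrand n g (T a) a) * (1 - cmod a) powr (real n + 2 / q)
         + (\<Sum>i\<in>{k<..<n}. D i * (cmod (g i a) * (1 - cmod a) powr symbol_exp n p q i))"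
    by (rule symbol_recovery[OF p less.prems]) blast
  let ?R = "\<lambda>a. (cmod (Ig_integrand n g (T a) a) * (1 - cmod a) powr (real n + 2 / q)
         + (\<Sum>i\<in>{k<..<n}. D i * (cmod (g i a) * (1 - cmod a) powr symbol_exp n p q i))) / c"
  have "((\<lambda>z. cmod (g i z) * (1 - cmod z) powr symbol_exp n p q i) \<longlongrightarrow> 0) at_circle" if "i \<in> {k<..<n}" for i
    using that by (intro less.hyps) auto
  then have "((\<lambda>a. \<Sum>i\<in>{k<..<n}. D i * (cmod (g i a) * (1 - cmod a) powr symbol_exp n p q i)) \<longlongrightarrow> (\<Sum>i\<in>{k<..<n}. D i * 0)) at_circle"
    by (intro tendsto_sum tendsto_mult tendsto_const)
  then have "(?R \<longlongrightarrow> (0 + (\<Sum>i\<in>{k<..<n}. D i * 0)) / c) at_circle"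
    using c by (intro tendsto_divide tendsto_add tendsto_const compact_operator_Ig_nec_aux[OF p pq g comp T(1,2) c(2) T(3)]) auto
  then have "(?R \<longlongrightarrow> 0) at_circle" by simp
  then show ?case
  proof (rule Lim_null_comparison[rotated])
    show "eventually (\<lambda>a. norm (cmod (g k a) * (1 - cmod a) powr symbol_exp n p q k) \<le> ?R a) at_circle"
      using eventually_disc_at_circle
    proof eventually_elim
      case (elim a)
      then show ?case using rec[OF elim, of g q] c(1) by (simp add: field_simps)
    qed
  qed
qed

section \<open>Translation to the spaces of the statement\<close>

text \<open>The quotient of the two weights is \<open>1 + |z|\<close>, which lies between 1 and 2;
  \<open>\<bar>a\<bar>\<close> covers exponents of either sign.\<close>

lemma one_minus_square_powr_bounds:
  assumes "z \<in> disc"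
  shows "(1 - (cmod z)\<^sup>2) powr a \<le> 2 powr \<bar>a\<bar> * (1 - cmod z) powr a"
    and "(1 - cmod z) powr a \<le> 2 powr \<bar>a\<bar> * (1 - (cmod z)\<^sup>2) powr a"
proof -
  have eq: "(1 - (cmod z)\<^sup>2) powr a = (1 - cmod z) powr a * (1 + cmod z) powr a"
    by (simp add: power2_eq_square algebra_simps flip: powr_mult)
  have le: "(1 + cmod z) powr b \<le> 2 powr \<bar>a\<bar>" if "b \<le> \<bar>a\<bar>" for b
  proof -
    have "(1 + cmod z) powr b \<le> (1 + cmod z) powr \<bar>a\<bar>" using that by (intro powr_mono) auto
    also have "\<dots> \<le> 2 powr \<bar>a\<bar>" using assms by (intro powr_mono2) auto
    finally show ?thesis .
  qed
  show "(1 - (cmod z)\<^sup>2) powr a \<le> 2 powr \<bar>a\<bar> * (1 - cmod z) powr a"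
    unfolding eq using mult_left_mono[OF le[of a], of "(1 - cmod z) powr a"] by (simp add: mult.commute)
  have "(1 + cmod z) powr (- a) * (1 + cmod z) powr a = 1"
    using norm_ge_zero[of z] by (subst powr_add[symmetric]) (auto simp del: norm_ge_zero)
  then have "(1 - cmod z) powr a = (1 + cmod z) powr (- a) * (1 - (cmod z)\<^sup>2) powr a"
    unfolding eq by (metis mult.assoc mult.commute mult.right_neutral)
  also have "\<dots> \<le> 2 powr \<bar>a\<bar> * (1 - (cmod z)\<^sup>2) powr a"
    by (intro mult_right_mono le) auto
  finally show "(1 - cmod z) powr a \<le> 2 powr \<bar>a\<bar> * (1 - (cmod z)\<^sup>2) powr a" .
qed

lemma bloch_0_iff:
  assumes "g holomorphic_on disc"
  shows "g \<in> bloch 0 a \<longleftrightarrow> (\<exists>C. \<forall>z\<in>disc. cmod (g z) * (1 - cmod z) powr a \<le> C)"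
proof -
  have transfer: "\<exists>C. \<forall>z\<in>disc. cmod (g z) * v z \<le> C"
    if ex: "\<exists>C. \<forall>z\<in>disc. cmod (g z) * u z \<le> C" and vu: "\<And>z. z \<in> disc \<Longrightarrow> v z \<le> 2 powr \<bar>a\<bar> * u z"
    for u v :: "complex \<Rightarrow> real"
  proof -
    obtain C where C: "\<And>z. z \<in> disc \<Longrightarrow> cmod (g z) * u z \<le> C"
      using ex by blast
    have "cmod (g z) * v z \<le> 2 powr \<bar>a\<bar> * C" if z: "z \<in> disc" for z
    proof -
      have "cmod (g z) * v z \<le> cmod (g z) * (2 powr \<bar>a\<bar> * u z)"
        by (intro mult_left_mono vu z) auto
      also have "\<dots> \<le> 2 powr \<bar>a\<bar> * C"
        using mult_left_mono[OF C[OF z], of "2 powr \<bar>a\<bar>"] by (simp add: mult_ac)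
      finally show ?thesis .
    qed
    then show ?thesis by blast
  qed
  have "g \<in> bloch 0 a \<longleftrightarrow> (\<exists>C. \<forall>z\<in>disc. cmod (g z) * (1 - (cmod z)\<^sup>2) powr a \<le> C)"
    using assms by (simp add: bloch_def)
  also have "\<dots> \<longleftrightarrow> (\<exists>C. \<forall>z\<in>disc. cmod (g z) * (1 - cmod z) powr a \<le> C)"
    by (rule iffI; erule transfer; erule one_minus_square_powr_bounds)
  finally show ?thesis .
qed

lemma little_bloch_0_iff:
  assumes "g holomorphic_on disc"
  shows "g \<in> little_bloch 0 a \<longleftrightarrow> ((\<lambda>z. cmod (g z) * (1 - cmod z) powr a) \<longlongrightarrow> 0) at_circle"
proof -
  let ?s = "\<lambda>z. cmod (g z) * (1 - (cmod z)\<^sup>2) powr a" and ?d = "\<lambda>z. cmod (g z) * (1 - cmod z) powr a"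
  have "g \<in> little_bloch 0 a \<longleftrightarrow> (\<forall>\<epsilon>>0. eventually (\<lambda>z. ?s z < \<epsilon>) at_circle)"
    using assms by (simp add: little_bloch_def eventually_at_circle)
  also have "\<dots> \<longleftrightarrow> (?s \<longlongrightarrow> 0) at_circle"
    by (simp add: tendsto_iff abs_mult)
  also have "\<dots> \<longleftrightarrow> (?d \<longlongrightarrow> 0) at_circle"
  proof
    assume "(?s \<longlongrightarrow> 0) at_circle"
    then have "((\<lambda>z. 2 powr \<bar>a\<bar> * ?s z) \<longlongrightarrow> 2 powr \<bar>a\<bar> * 0) at_circle" by (intro tendsto_mult tendsto_const)
    then have "((\<lambda>z. 2 powr \<bar>a\<bar> * ?s z) \<longlongrightarrow> 0) at_circle" by simp
    then show "(?d \<longlongrightarrow> 0) at_circle"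
    proof (rule Lim_null_comparison[rotated])
      show "eventually (\<lambda>z. norm (?d z) \<le> 2 powr \<bar>a\<bar> * ?s z) at_circle"
        using eventually_disc_at_circle
        by eventually_elim (use mult_left_mono[OF one_minus_square_powr_bounds(2)] in \<open>simp add: abs_mult mult.left_commute\<close>)
    qed
  next
    assume "(?d \<longlongrightarrow> 0) at_circle"
    then have "((\<lambda>z. 2 powr \<bar>a\<bar> * ?d z) \<longlongrightarrow> 2 powr \<bar>a\<bar> * 0) at_circle" by (intro tendsto_mult tendsto_const)
    then have "((\<lambda>z. 2 powr \<bar>a\<bar> * ?d z) \<longlongrightarrow> 0) at_circle" by simp
    then show "(?s \<longlongrightarrow> 0) at_circle"
    proof (rule Lim_null_comparison[rotated])
      show "eventually (\<lambda>z. norm (?s z) \<le> 2 powr \<bar>a\<bar> * ?d z) at_circle"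
        using eventually_disc_at_circle
        by eventually_elim (use mult_left_mono[OF one_minus_square_powr_bounds(1)] in \<open>simp add: abs_mult mult.left_commute\<close>)
    qed
  qed
  finally show ?thesis .
qed

lemma tendsto_one_minus_norm_at_circle: "((\<lambda>z. 1 - cmod z) \<longlongrightarrow> 0) at_circle"
proof (rule tendstoI)
  fix e :: real assume "0 < e"
  then show "eventually (\<lambda>z. dist (1 - cmod z) 0 < e) at_circle"
    unfolding eventually_at_circle by (intro exI[of _ "1 - e"]) auto
qed

text \<open>Dividing by the weight gives \<open>|g| \<le> C * (1 - |z|)^(-a)\<close>, which tends to
  0 at the circle, and the maximum principle applies.\<close>

lemma bounded_negative_weight_imp_zero:
  assumes g: "g holomorphic_on disc" and a: "a < 0"
    and C: "\<And>z. z \<in> disc \<Longrightarrow> cmod (g z) * (1 - cmod z) powr a \<le> C" and z: "z \<in> disc"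
  shows "g z = 0"
proof (rule vanishing_at_circle_imp_zero[OF g _ z])
  have "((\<lambda>z. (1 - cmod z) powr (- a)) \<longlongrightarrow> 0 powr (- a)) at_circle"
    using a by (intro tendsto_powr' tendsto_one_minus_norm_at_circle tendsto_const)
      (auto intro: eventually_mono[OF eventually_disc_at_circle])
  then have "((\<lambda>z. C * (1 - cmod z) powr (- a)) \<longlongrightarrow> C * 0 powr (- a)) at_circle"
    by (intro tendsto_mult tendsto_const)
  then have "((\<lambda>z. C * (1 - cmod z) powr (- a)) \<longlongrightarrow> 0) at_circle" by simp
  then show "((\<lambda>z. cmod (g z)) \<longlongrightarrow> 0) at_circle"
  proof (rule Lim_null_comparison[rotated])
    show "eventually (\<lambda>z. norm (cmod (g z)) \<le> C * (1 - cmod z) powr (- a)) at_circle"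
      using eventually_disc_at_circle
    proof eventually_elim
      case (elim z)
      then show ?case using C[OF elim] by (simp add: powr_minus field_simps)
    qed
  qed
qed

text \<open>For \<open>a \<le> 0\<close> the weight is at least 1, so \<open>g\<close> itself tends
  to 0 at the circle. The exponent 0 is included, which is why the borderline case forces
  \<open>g k = 0\<close> for compactness but only boundedness of \<open>g k\<close> for boundedness
  of the operator.\<close>

lemma tendsto_nonpos_weight_imp_zero:
  assumes g: "g holomorphic_on disc" and a: "a \<le> 0"
    and lim: "((\<lambda>z. cmod (g z) * (1 - cmod z) powr a) \<longlongrightarrow> 0) at_circle" and z: "z \<in> disc"
  shows "g z = 0"
proof (rule vanishing_at_circle_imp_zero[OF g _ z])
  show "((\<lambda>z. cmod (g z)) \<longlongrightarrow> 0) at_circle"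
    using lim
  proof (rule Lim_null_comparison[rotated])
    show "eventually (\<lambda>z. norm (cmod (g z)) \<le> cmod (g z) * (1 - cmod z) powr a) at_circle"
      using eventually_disc_at_circle
    proof eventually_elim
      case (elim z)
      have "1 powr a \<le> (1 - cmod z) powr a"
        using elim a by (intro powr_mono2') auto
      then have "cmod (g z) * 1 \<le> cmod (g z) * (1 - cmod z) powr a"
        by (intro mult_left_mono) auto
      then show ?case by simp
    qed
  qed
qed

theorem theorem1p3:
  fixes n :: nat and g :: "nat \<Rightarrow> complex \<Rightarrow> complex" and p q :: real
  assumes "n > 0"
    and "\<forall>k<n. g k holomorphic_on disc"
    and "0 < p" and "p \<le> q"
  shows "(bounded_operator p q (Ig n g) \<longleftrightarrow>
           (\<forall>k<n. (real (n - k) \<ge> 2/p - 2/q \<longrightarrow> g k \<in> bloch 0 (real (n - k) - 2/p + 2/q)) \<and>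
                  (real (n - k) < 2/p - 2/q \<longrightarrow> (\<forall>z\<in>disc. g k z = 0))))
       \<and> (compact_operator p q (Ig n g) \<longleftrightarrow>
           (\<forall>k<n. (real (n - k) > 2/p - 2/q \<longrightarrow> g k \<in> little_bloch 0 (real (n - k) - 2/p + 2/q)) \<and>
                  (real (n - k) \<le> 2/p - 2/q \<longrightarrow> (\<forall>z\<in>disc. g k z = 0))))"
proof -
  note g = assms(2) and p = assms(3) and pq = assms(4)
  \<comment> \<open>Both equivalences are proved for this one quantity without cases; the sign of
    \<open>symbol_exp n p q k\<close> alone then decides which clause of the statement it amounts
    to.\<close>
  let ?w = "\<lambda>k z. cmod (g k z) * (1 - cmod z) powr symbol_exp n p q k"
  have bd: "(\<exists>C. \<forall>z\<in>disc. ?w k z \<le> C) \<longleftrightarrow>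
      (real (n - k) \<ge> 2/p - 2/q \<longrightarrow> g k \<in> bloch 0 (real (n - k) - 2/p + 2/q)) \<and>
      (real (n - k) < 2/p - 2/q \<longrightarrow> (\<forall>z\<in>disc. g k z = 0))" if k: "k < n" for k
  proof (cases "real (n - k) \<ge> 2/p - 2/q")
    case True
    then show ?thesis using g k by (simp add: bloch_0_iff symbol_exp_def)
  next
    case False
    then have neg: "symbol_exp n p q k < 0" by (simp add: symbol_exp_def)
    have "(\<exists>C. \<forall>z\<in>disc. ?w k z \<le> C) \<longleftrightarrow> (\<forall>z\<in>disc. g k z = 0)"
    proof
      assume "\<exists>C. \<forall>z\<in>disc. ?w k z \<le> C"
      then show "\<forall>z\<in>disc. g k z = 0"
        using bounded_negative_weight_imp_zero[of "g k", OF _ neg] g k by blast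
    next
      assume "\<forall>z\<in>disc. g k z = 0"
      then show "\<exists>C. \<forall>z\<in>disc. ?w k z \<le> C" by (intro exI[of _ 0]) simp
    qed
    then show ?thesis using False by auto
  qed
  have lim: "(?w k \<longlongrightarrow> 0) at_circle \<longleftrightarrow>
      (real (n - k) > 2/p - 2/q \<longrightarrow> g k \<in> little_bloch 0 (real (n - k) - 2/p + 2/q)) \<and>
      (real (n - k) \<le> 2/p - 2/q \<longrightarrow> (\<forall>z\<in>disc. g k z = 0))" if k: "k < n" for k
  proof (cases "real (n - k) > 2/p - 2/q")
    case True
    then show ?thesis using g k by (simp add: little_bloch_0_iff symbol_exp_def)
  next
    case False
    then have neg: "symbol_exp n p q k \<le> 0" by (simp add: symbol_exp_def)
    have "(?w k \<longlongrightarrow> 0) at_circle \<longleftrightarrow> (\<forall>z\<in>disc. g k z = 0)"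
    proof
      assume "(?w k \<longlongrightarrow> 0) at_circle"
      then show "\<forall>z\<in>disc. g k z = 0"
        using tendsto_nonpos_weight_imp_zero[of "g k", OF _ neg] g k by blast
    next
      assume "\<forall>z\<in>disc. g k z = 0"
      then have "eventually (\<lambda>z. ?w k z = 0) at_circle"
        by (intro eventually_mono[OF eventually_disc_at_circle]) simp
      then show "(?w k \<longlongrightarrow> 0) at_circle" by (rule tendsto_eventually)
    qed
    then show ?thesis using False by auto
  qed
  have "bounded_operator p q (Ig n g) \<longleftrightarrow> (\<forall>k<n. \<exists>C. \<forall>z\<in>disc. ?w k z \<le> C)"
    using bounded_operator_Ig_suff[OF p pq g] bounded_operator_Ig_nec[OF p pq g] by blast
  moreover have "compact_operator p q (Ig n g) \<longleftrightarrow> (\<forall>k<n. (?w k \<longlongrightarrow> 0) at_circle)"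
    using compact_operator_Ig_suff[OF p pq g] compact_operator_Ig_nec[OF p pq g] by blast
  ultimately show ?thesis using bd lim by simp
qed

end
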